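(* Let $\Omega\subset\mathbb{R}^n$ be a (nonempty) open and bounded set. Let $K:\mathbb{R}^n\setminus\{0\}\to(0,+\infty)$ be a measurable function such that $mK\in L^1(\mathbb{R}^n)$, where $m(x)=\min\{|x|^2,1\}$, and such that there exist $\theta>0$ and $s\in(0,1)$ with $K(x)\ge\theta|x|^{-(n+2s)}$ for all $x\in\mathbb{R}^n\setminus\{0\}$. Let $f:\Omega\times\mathbb{R}\to\mathbb{R}$ be a Carathéodory function for which there exist $a\in L^2(\Omega)$ and $b\ge 0$ with $|f(x,t)|\le a(x)+b|t|$ for a.e. $x\in\Omega$ and all $t\in\mathbb{R}$. For a.e. $x\in\Omega$ set $$\underline{\alpha}(x):=\liminf_{|t|\to\infty}\frac{f(x,t)}{t},\qquad \overline{\alpha}(x):=\limsup_{|t|\to\infty}\frac{f(x,t)}{t}.$$ Let $\lambda_1<\lambda_2\le\lambda_3\le\dots$ be the eigenvalues of $-\mathcal L_K$ in $Z$ (defined in the context). Assume that either $\overline{\alpha}(x)<\lambda_1$ for a.e. $x\in\Omega$, or there exists an integer $k\ge1$ such that $\lambda_k<\underline{\alpha}(x)\le\overline{\alpha}(x)<\lambda_{k+1}$ for a.e. $x\in\Omega$. Then there exists $u\in Z$ such that $$\int_Q (u(x)-u(y))(\varphi(x)-\varphi(y))K(x-y)\,dx\,dy=\int_\Omega f(x,u(x))\varphi(x)\,dx\quad\text{for every }\varphi\in Z.$$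
   Context: Notation: $\mathcal{C}\Omega=\mathbb{R}^n\setminus\Omega$ and $Q:=\mathbb{R}^{2n}\setminus(\mathcal{C}\Omega\times\mathcal{C}\Omega)$. $X$ is the linear space of Lebesgue measurable functions $u:\mathbb{R}^n\to\mathbb{R}$ (identified when equal a.e.) such that $(x,y)\mapsto (u(x)-u(y))^2K(x-y)$ is in $L^1(Q,dx\,dy)$, with norm $\|u\|_X=\big(\int_\Omega|u|^2dx+\int_Q|u(x)-u(y)|^2K(x-y)\,dx\,dy\big)^{1/2}$. $Z$ is the closure in $X$ of $C_0^\infty(\Omega)$ (smooth functions with compact support in $\Omega$, extended by $0$ to $\mathbb{R}^n$). $Z$ is a Hilbert space with scalar product $\langle u,v\rangle_Z=\int_Q(u(x)-u(y))(v(x)-v(y))K(x-y)\,dx\,dy$ and norm $\|u\|_Z=\langle u,u\rangle_Z^{1/2}$, which is equivalent to $\|\cdot\|_X$ on $Z$; $Z$ is compactly embedded in $L^2(\Omega)$. Eigenvalues: $\lambda\in\mathbb{R}$ is an eigenvalue of $-\mathcal L_K$ if there is $e\in Z\setminus\{0\}$ with $\langle e,\varphi\rangle_Z=\lambda\int_\Omega e\varphi\,dx$ for all $\varphi\in Z$; then $e$ is an eigenfunction. The eigenvalues, repeated according to multiplicity, form a sequence $0<\lambda_1<\lambda_2\le\lambda_3\le\dots$ with $\sup_j\lambda_j=+\infty$. Carathéodory: $f(\cdot,t)$ is measurable for each $t$ and $f(x,\cdot)$ is continuous for a.e. $x$. *)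

theory Defs
  imports "HOL-Analysis.Analysis"
begin

section \<open>Test functions\<close>

definition partial_deriv :: "'n::finite \<Rightarrow> (real^'n \<Rightarrow> real) \<Rightarrow> real^'n \<Rightarrow> real" where
  "partial_deriv i g = (\<lambda>x. frechet_derivative g (at x) (axis i 1))"

text \<open>A function is of class \<open>C\<^sup>k\<^sup>+\<^sup>1\<close> on the whole space iff it is differentiable
  and all its first partial derivatives are of class \<open>C\<^sup>k\<close>.\<close>

primrec class_C :: "nat \<Rightarrow> (real^'n::finite \<Rightarrow> real) \<Rightarrow> bool" where
  "class_C 0 g \<longleftrightarrow> continuous_on UNIV g"
| "class_C (Suc k) g \<longleftrightarrow> g differentiable_on UNIV \<and> (\<forall>i. class_C k (partial_deriv i g))"

definition test_functions :: "(real^'n::finite) set \<Rightarrow> (real^'n \<Rightarrow> real) set" where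
  "test_functions \<Omega> = {\<phi>. (\<forall>k. class_C k \<phi>) \<and>
     compact (closure {x. \<phi> x \<noteq> 0}) \<and> closure {x. \<phi> x \<noteq> 0} \<subseteq> \<Omega>}"


section \<open>The spaces X and Z\<close>

text \<open>Elements of \<open>X\<close> and \<open>Z\<close> are represented by functions; the identification of functions
  that agree almost everywhere is not built into a quotient, but taken into account where
  nonzero elements, linear independence and span are used below.

  The kernel is a total function whose value at \<open>0\<close> is irrelevant: it only enters
  the integrals over \<open>Q\<close> on the diagonal, which is a null set.\<close>

definition Q :: "(real^'n::finite) set \<Rightarrow> ((real^'n) \<times> (real^'n)) set" where
  "Q \<Omega> = - ((- \<Omega>) \<times> (- \<Omega>))"

definition space_X :: "(real^'n::finite) set \<Rightarrow> (real^'n \<Rightarrow> real) \<Rightarrow> (real^'n \<Rightarrow> real) set" where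
  "space_X \<Omega> K = {u \<in> borel_measurable lebesgue.
     integrable (lebesgue_on (Q \<Omega>)) (\<lambda>(x, y). (u x - u y)\<^sup>2 * K (x - y))}"

text \<open>Square integrability over \<open>\<Omega>\<close> need not be demanded in \<open>space_X\<close>: if \<open>\<Omega>\<close> is open, nonempty
  and bounded, and \<open>K x \<ge> \<theta> |x|\<^bsup>-(n+2s)\<^esup>\<close>, then \<open>K (x - y)\<close> is bounded below by a
  positive constant for distinct \<open>x\<close>, \<open>y\<close> in \<open>\<Omega>\<close>, so \<open>(u x - u y)\<^sup>2\<close> is integrable over
  \<open>\<Omega> \<times> \<Omega>\<close>, and by Fubini \<open>u\<close> is square integrable over \<open>\<Omega>\<close>.
  Likewise all test functions belong to \<open>space_X\<close> if \<open>min {|x|\<^sup>2, 1} K\<close> is integrable.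
  Thus both integrals below are those of integrable functions.\<close>

definition norm_X :: "(real^'n::finite) set \<Rightarrow> (real^'n \<Rightarrow> real) \<Rightarrow> (real^'n \<Rightarrow> real) \<Rightarrow> real" where
  "norm_X \<Omega> K u = sqrt ((\<integral>x. \<bar>u x\<bar>\<^sup>2 \<partial>lebesgue_on \<Omega>) +
     (\<integral>(x, y). \<bar>u x - u y\<bar>\<^sup>2 * K (x - y) \<partial>lebesgue_on (Q \<Omega>)))"

definition space_Z :: "(real^'n::finite) set \<Rightarrow> (real^'n \<Rightarrow> real) \<Rightarrow> (real^'n \<Rightarrow> real) set" where
  "space_Z \<Omega> K = {u \<in> space_X \<Omega> K.
     \<forall>\<epsilon>>0. \<exists>\<phi>\<in>test_functions \<Omega>. norm_X \<Omega> K (\<lambda>x. u x - \<phi> x) < \<epsilon>}"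

definition inner_Z ::
  "(real^'n::finite) set \<Rightarrow> (real^'n \<Rightarrow> real) \<Rightarrow> (real^'n \<Rightarrow> real) \<Rightarrow> (real^'n \<Rightarrow> real) \<Rightarrow> real" where
  "inner_Z \<Omega> K u v =
     (\<integral>(x, y). (u x - u y) * (v x - v y) * K (x - y) \<partial>lebesgue_on (Q \<Omega>))"


section \<open>Eigenvalues\<close>

definition eigenspace ::
  "(real^'n::finite) set \<Rightarrow> (real^'n \<Rightarrow> real) \<Rightarrow> real \<Rightarrow> (real^'n \<Rightarrow> real) set" where
  "eigenspace \<Omega> K \<mu> = {e \<in> space_Z \<Omega> K.
     \<forall>\<phi>\<in>space_Z \<Omega> K. inner_Z \<Omega> K e \<phi> = \<mu> * (\<integral>x. e x * \<phi> x \<partial>lebesgue_on \<Omega>)}"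

definition is_eigenvalue :: "(real^'n::finite) set \<Rightarrow> (real^'n \<Rightarrow> real) \<Rightarrow> real \<Rightarrow> bool" where
  "is_eigenvalue \<Omega> K \<mu> \<longleftrightarrow> (\<exists>e\<in>eigenspace \<Omega> K \<mu>. \<not> (AE x in lebesgue. e x = 0))"

text \<open>The linear space \<open>E\<close>, modulo equality almost everywhere, has a basis of \<open>m\<close> elements.\<close>

definition has_dim_ae :: "(real^'n::finite \<Rightarrow> real) set \<Rightarrow> nat \<Rightarrow> bool" where
  "has_dim_ae E m \<longleftrightarrow> (\<exists>e :: nat \<Rightarrow> real^'n \<Rightarrow> real.
     (\<forall>i<m. e i \<in> E) \<and>
     (\<forall>c :: nat \<Rightarrow> real. (AE x in lebesgue. (\<Sum>i<m. c i * e i x) = 0) \<longrightarrow> (\<forall>i<m. c i = 0)) \<and>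
     (\<forall>u\<in>E. \<exists>c :: nat \<Rightarrow> real. AE x in lebesgue. u x = (\<Sum>i<m. c i * e i x)))"

text \<open>\<open>lam 1 \<le> lam 2 \<le> \<dots>\<close> lists all eigenvalues, each repeated according to its multiplicity;
  \<open>lam 0\<close> is not used. This determines \<open>lam 1, lam 2, \<dots>\<close> uniquely. Existence of the sequence,
  \<open>0 < lam 1 < lam 2\<close> and \<open>lam j \<longlonglongrightarrow> \<infinity>\<close> are facts about \<open>\<Omega>\<close> and \<open>K\<close> and hence not part of
  the definition.\<close>

definition eigenvalue_sequence ::
  "(real^'n::finite) set \<Rightarrow> (real^'n \<Rightarrow> real) \<Rightarrow> (nat \<Rightarrow> real) \<Rightarrow> bool" where
  "eigenvalue_sequence \<Omega> K lam \<longleftrightarrow>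
     (\<forall>j\<ge>1. is_eigenvalue \<Omega> K (lam j)) \<and>
     (\<forall>j\<ge>1. lam j \<le> lam (Suc j)) \<and>
     (\<forall>\<mu>. is_eigenvalue \<Omega> K \<mu> \<longrightarrow>
        finite {j. j \<ge> 1 \<and> lam j = \<mu>} \<and>
        has_dim_ae (eigenspace \<Omega> K \<mu>) (card {j. j \<ge> 1 \<and> lam j = \<mu>}))"


section \<open>Nonlinearities\<close>

definition caratheodory :: "(real^'n::finite) set \<Rightarrow> (real^'n \<Rightarrow> real \<Rightarrow> real) \<Rightarrow> bool" where
  "caratheodory \<Omega> f \<longleftrightarrow>
     (\<forall>t. (\<lambda>x. f x t) \<in> borel_measurable (lebesgue_on \<Omega>)) \<and>
     (AE x in lebesgue_on \<Omega>. continuous_on UNIV (f x))"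

text \<open>On the reals, the filter \<open>at_infinity\<close> describes \<open>|t| \<rightarrow> \<infinity>\<close>.\<close>

definition alpha_lower :: "(real^'n::finite \<Rightarrow> real \<Rightarrow> real) \<Rightarrow> real^'n \<Rightarrow> ereal" where
  "alpha_lower f x = Liminf at_infinity (\<lambda>t. ereal (f x t / t))"

definition alpha_upper :: "(real^'n::finite \<Rightarrow> real \<Rightarrow> real) \<Rightarrow> real^'n \<Rightarrow> ereal" where
  "alpha_upper f x = Limsup at_infinity (\<lambda>t. ereal (f x t / t))"

end

theory Submission
  imports Defs
begin

text \<open>Up to almost everywhere equality, \<open>Z\<close> is the closure of the graph of the test functions under
  \<open>u \<mapsto> (u x - u y) \<surd>K(x - y)\<close> in a product of two \<open>L\<^sup>2\<close> spaces, hence a Hilbert space. Replacing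
  a function by its means over the cells of a fine grid costs little in \<open>L\<^sup>2\<close> when the energy is bounded,
  because of the lower bound on \<open>K\<close>; thus \<open>Z\<close> embeds compactly into \<open>L\<^sup>2\<close>. Minimising the Rayleigh
  quotient on the orthogonal complement of the first eigenfunctions shows that \<open>B\<close> is at least
  \<open>\<lambda>\<^sub>k\<^sub>+\<^sub>1 \<parallel>\<cdot>\<parallel>\<^sup>2\<close> there. For \<open>\<mu>\<close> midway in the gap, weak solutions are the fixed points of a compact
  map \<open>T\<close> on \<open>L\<^sup>2\<close>, the inverse of \<open>A - \<mu>\<close> after \<open>u \<mapsto> f(\<cdot>, u) - \<mu> u\<close>. Nonresonance bounds the
  solutions of \<open>u = \<tau> T u\<close>, \<open>0 \<le> \<tau> \<le> 1\<close>, independently of \<open>\<tau>\<close>, and Schaefer's theorem applies. If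
  the upper limit of \<open>f(x, t) / t\<close> is controlled, by \<open>\<lambda>\<^sub>1\<close>, the growth bound on \<open>f\<close> controls the lower one,
  and the same argument works with a gap that has no eigenfunctions below it.\<close>

section \<open>Fixed points of compact maps\<close>

text \<open>Nonresonance is strict at almost every point but has no margin uniform in x, so no
  inequality between forms follows from it. The a priori bound therefore argues by contradiction:
  after normalisation a positive margin is needed only where the limit is nonzero, and Fatou's lemma
  makes that enough. The homotopy stays harmless because \<mu> lies in the gap: for large |t| the
  quotient (1 - \<tau>) \<mu> + \<tau> f(x, t) / t remains in the gap as well. With eigenfunctions
  below the gap, B - \<mu> is indefinite; testing with a function reflected in their span yields
  both solvability and the energy inequality. The norm of X measures a function itself on \<Omega>
  only. That elements of Z vanish outside \<Omega> comes from the mixed part of Q: a function that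
  is 0 on \<Omega> and has zero energy is 0 almost everywhere, as K is positive. The eigenvalues are
  given as a list without variational characterisation; the gap holds because a Rayleigh minimiser
  below it would be an eigenfunction orthogonal to its own eigenspace.\<close>

lemma compact_closure_sequential:
  fixes S :: "'a::metric_space set"
  assumes "\<And>x :: nat \<Rightarrow> 'a. (\<And>n. x n \<in> S) \<Longrightarrow> \<exists>l r. strict_mono r \<and> (x \<circ> r) \<longlonglongrightarrow> l"
  shows "compact (closure S)"
  unfolding compact_eq_seq_compact_metric seq_compact_def
proof (intro allI impI)
  fix x :: "nat \<Rightarrow> 'a" assume x: "\<forall>n. x n \<in> closure S"
  have "\<exists>y\<in>S. dist y (x n) < inverse (real (Suc n))" for n
    using x closure_approachable[of "x n" S] by simp
  then obtain y where y: "\<And>n. y n \<in> S" "\<And>n. dist (y n) (x n) < inverse (real (Suc n))" by metis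
  obtain l r where lr: "strict_mono r" "(y \<circ> r) \<longlonglongrightarrow> l" using assms[of y] y(1) by blast
  have "(\<lambda>n. dist (y n) (x n)) \<longlonglongrightarrow> 0"
    by (rule tendsto_sandwich[OF _ _ tendsto_const LIMSEQ_inverse_real_of_nat])
       (use y(2) in \<open>auto intro!: always_eventually less_imp_le\<close>)
  from LIMSEQ_subseq_LIMSEQ[OF this lr(1)]
  have "(\<lambda>n. dist (y (r n)) (x (r n)) + dist (y (r n)) l) \<longlonglongrightarrow> 0 + 0"
    using tendsto_dist[OF lr(2) tendsto_const[of l]] by (intro tendsto_add) (auto simp: o_def)
  then have "(\<lambda>n. dist (y (r n)) (x (r n)) + dist (y (r n)) l) \<longlonglongrightarrow> 0" by simp
  moreover have "norm (dist (x (r n)) l) \<le> dist (y (r n)) (x (r n)) + dist (y (r n)) l" for n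
    using dist_triangle3[of "x (r n)" l "y (r n)"] by simp
  ultimately have "(\<lambda>n. dist (x (r n)) l) \<longlonglongrightarrow> 0"
    by (rule Lim_null_comparison[OF always_eventually, OF allI, rotated])
  then have "(x \<circ> r) \<longlonglongrightarrow> l"
    by (subst tendsto_dist_iff) (simp add: o_def)
  moreover have "l \<in> closure S"
    unfolding closure_sequential using lr(2) y(1) by (intro exI[of _ "y \<circ> r"]) auto
  ultimately show "\<exists>l\<in>closure S. \<exists>r. strict_mono r \<and> (x \<circ> r) \<longlonglongrightarrow> l" using lr(1) by blast
qed

text \<open>Tychonoff's theorem. The infinite product serves every dimension at once: coordinates
  beyond the dimension in use are set to 0.\<close>

lemma compact_unit_cube: "compact {c :: nat \<Rightarrow> real. \<forall>i. 0 \<le> c i \<and> c i \<le> 1}"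
proof -
  have "compactin (product_topology (\<lambda>_::nat. euclidean) UNIV) (PiE UNIV (\<lambda>_. {0..1::real}))"
    unfolding compactin_PiE by simp
  then show ?thesis
    by (simp add: euclidean_product_topology PiE_UNIV_domain Pi_def)
qed

text \<open>Brouwer's theorem on the cube of dimension \<open>N\<close>, by Kuhn's combinatorial
  lemma. The dimension is a number and not a type because it will be the size of an \<epsilon>-net.
  Points are sequences, and continuity refers to coordinatewise convergence.\<close>

lemma unit_cube_fixed_point:
  fixes M :: "nat \<Rightarrow> (nat \<Rightarrow> real) \<Rightarrow> real"
  assumes cont: "\<And>i x c. i < N \<Longrightarrow> (\<And>j. (\<lambda>m. x m j) \<longlonglongrightarrow> c j) \<Longrightarrow> (\<lambda>m. M i (x m)) \<longlonglongrightarrow> M i c"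
    and range: "\<And>i c. i < N \<Longrightarrow> 0 \<le> M i c \<and> M i c \<le> 1"
  obtains c where "\<And>i. i < N \<Longrightarrow> M i c = c i" "\<And>i. 0 \<le> c i"
proof -
  define P :: "nat \<Rightarrow> (nat \<Rightarrow> nat) \<Rightarrow> nat \<Rightarrow> real"
    where "P m x = (\<lambda>j. if j < N then real (x j) / real (Suc m) else 0)" for m x
  \<comment> \<open>The label tells in which direction \<open>M\<close> moves coordinate
    \<open>i\<close>. Kuhn's lemma dictates the labels on the faces; they agree with this reading
    because \<open>M\<close> has values in [0, 1].\<close>
  define lab :: "nat \<Rightarrow> (nat \<Rightarrow> nat) \<Rightarrow> nat \<Rightarrow> nat"
    where "lab m x i = (if x i = 0 then 0 else if x i = Suc m then 1
      else if M i (P m x) \<ge> P m x i then 0 else 1)" for m x i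
  define near where "near q r \<longleftrightarrow> (\<forall>j<N. q j \<le> r j \<and> r j \<le> q j + 1)" for q r :: "nat \<Rightarrow> nat"
  have lab0: "P m x i \<le> M i (P m x)" if "i < N" "lab m x i = 0" for m x i
    using that range[of i "P m x"] by (auto simp: lab_def P_def split: if_splits)
  have lab1: "M i (P m x) \<le> P m x i" if "i < N" "lab m x i \<noteq> 0" for m x i
    using that range[of i "P m x"] by (auto simp: lab_def P_def split: if_splits)
  have "\<exists>q. (\<forall>i<N. q i < Suc m) \<and> (\<forall>i<N. \<exists>r s. (\<forall>j<N. q j \<le> r j \<and> r j \<le> q j + 1) \<and>
     (\<forall>j<N. q j \<le> s j \<and> s j \<le> q j + 1) \<and> lab m r i = 0 \<and> lab m s i \<noteq> 0)" for m
  proof -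
    obtain q where q: "\<forall>i<N. q i < Suc m"
      "\<forall>i<N. \<exists>r s. (\<forall>j<N. q j \<le> r j \<and> r j \<le> q j + 1) \<and>
        (\<forall>j<N. q j \<le> s j \<and> s j \<le> q j + 1) \<and> lab m r i \<noteq> lab m s i"
    proof (rule kuhn_lemma[of "Suc m" N "lab m"])
      show "\<forall>x. (\<forall>i<N. x i \<le> Suc m) \<longrightarrow> (\<forall>i<N. lab m x i = 0 \<or> lab m x i = 1)"
        "\<forall>x. (\<forall>i<N. x i \<le> Suc m) \<longrightarrow> (\<forall>i<N. x i = 0 \<longrightarrow> lab m x i = 0)"
        "\<forall>x. (\<forall>i<N. x i \<le> Suc m) \<longrightarrow> (\<forall>i<N. x i = Suc m \<longrightarrow> lab m x i = 1)"
        by (simp_all add: lab_def)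
    qed auto
    have "\<exists>r s. (\<forall>j<N. q j \<le> r j \<and> r j \<le> q j + 1) \<and>
     (\<forall>j<N. q j \<le> s j \<and> s j \<le> q j + 1) \<and> lab m r i = 0 \<and> lab m s i \<noteq> 0" if i: "i < N" for i
    proof -
      obtain r s where rs: "\<forall>j<N. q j \<le> r j \<and> r j \<le> q j + 1"
        "\<forall>j<N. q j \<le> s j \<and> s j \<le> q j + 1" "lab m r i \<noteq> lab m s i" using q(2)[rule_format, OF i] by blast
      show ?thesis
      proof (cases "lab m r i = 0")
        case True then show ?thesis using rs by (intro exI[of _ r] exI[of _ s]) auto
      next
        case False
        then have "lab m s i = 0" using rs(3) by (auto simp: lab_def split: if_splits)
        then show ?thesis using rs False by (intro exI[of _ s] exI[of _ r]) auto
      qed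
    qed
    then show ?thesis using q(1) by blast
  qed
  then have "\<exists>q. \<forall>m. (\<forall>i<N. q m i < Suc m) \<and> (\<forall>i<N. \<exists>r s. near (q m) r \<and> near (q m) s \<and>
     lab m r i = 0 \<and> lab m s i \<noteq> 0)"
    unfolding near_def by (intro choice allI) blast
  then obtain q where q: "\<And>m i. i < N \<Longrightarrow> q m i < Suc m"
    and ex: "\<And>m i. i < N \<Longrightarrow> \<exists>r s. near (q m) r \<and> near (q m) s \<and> lab m r i = 0 \<and> lab m s i \<noteq> 0"
    by blast
  have "\<forall>m i. \<exists>r s. i < N \<longrightarrow> near (q m) r \<and> near (q m) s \<and> lab m r i = 0 \<and> lab m s i \<noteq> 0"
    using ex by blast
  then obtain r s where rs: "\<And>m i. i < N \<Longrightarrow> near (q m) (r m i)" "\<And>m i. i < N \<Longrightarrow> near (q m) (s m i)"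
      "\<And>m i. i < N \<Longrightarrow> lab m (r m i) i = 0" "\<And>m i. i < N \<Longrightarrow> lab m (s m i) i \<noteq> 0"
    by metis
  have "P m (q m) \<in> {c. \<forall>i. 0 \<le> c i \<and> c i \<le> 1}" for m
  proof -
    have "real (q m i) \<le> real (Suc m)" if "i < N" for i
      using q[OF that, of m] by linarith
    then show ?thesis by (auto simp: P_def)
  qed
  note in_cube = this
  have sc: "seq_compact {c :: nat \<Rightarrow> real. \<forall>i. 0 \<le> c i \<and> c i \<le> 1}"
    using compact_unit_cube by (simp add: compact_eq_seq_compact_metric)
  obtain c \<sigma> where c: "c \<in> {c. \<forall>i. 0 \<le> c i \<and> c i \<le> 1}" and \<sigma>: "strict_mono \<sigma>"
    and lim: "((\<lambda>m. P m (q m)) \<circ> \<sigma>) \<longlonglongrightarrow> c"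
    by (rule seq_compactE[OF sc, of "\<lambda>m. P m (q m)"]) (use in_cube in blast)+
  have component: "(\<lambda>m. x m j) \<longlonglongrightarrow> l j" if "x \<longlonglongrightarrow> l" for x :: "nat \<Rightarrow> nat \<Rightarrow> real" and l j
    using continuous_on_tendsto_compose[OF continuous_on_product_coordinates[of j] that] by simp
  have coord: "((\<lambda>m. P (\<sigma> m) (q (\<sigma> m)) j) \<longlonglongrightarrow> c j)" for j
    using component[OF lim] by (simp add: o_def)
  have inv: "(\<lambda>m. inverse (real (Suc (\<sigma> m)))) \<longlonglongrightarrow> 0"
    using LIMSEQ_subseq_LIMSEQ[OF LIMSEQ_inverse_real_of_nat \<sigma>] by (simp add: o_def)
  \<comment> \<open>All corners of a Kuhn cell lie within one mesh width of \<open>q\<close> in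
    every coordinate, so they have the same limit.\<close>
  have lim_near: "(\<lambda>m. P (\<sigma> m) (x m) j) \<longlonglongrightarrow> c j"
    if x: "\<And>m. near (q (\<sigma> m)) (x m)" for x j
  proof (rule Lim_transform2[OF coord[of j]])
    have "\<bar>P (\<sigma> m) (q (\<sigma> m)) j - P (\<sigma> m) (x m) j\<bar> \<le> inverse (real (Suc (\<sigma> m)))" for m
    proof (cases "j < N")
      case True
      then have "\<bar>real (q (\<sigma> m) j) - real (x m j)\<bar> \<le> 1" using x[of m] by (auto simp: near_def)
      then have "\<bar>real (q (\<sigma> m) j) - real (x m j)\<bar> / real (Suc (\<sigma> m)) \<le> 1 / real (Suc (\<sigma> m))"
        by (intro divide_right_mono) auto
      then show ?thesis using True by (simp add: P_def inverse_eq_divide abs_divide flip: diff_divide_distrib)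
    qed (simp add: P_def)
    then show "(\<lambda>m. P (\<sigma> m) (q (\<sigma> m)) j - P (\<sigma> m) (x m) j) \<longlonglongrightarrow> 0"
      by (intro Lim_null_comparison[OF _ inv]) auto
  qed
  \<comment> \<open>For each coordinate the cell has corners of both labels, and these give the two
    inequalities in the limit.\<close>
  have fixp: "M i c = c i" if i: "i < N" for i
  proof -
    have 1: "(\<lambda>m. P (\<sigma> m) (r (\<sigma> m) i) j) \<longlonglongrightarrow> c j" for j by (rule lim_near) (use rs i in auto)
    have 2: "(\<lambda>m. P (\<sigma> m) (s (\<sigma> m) i) j) \<longlonglongrightarrow> c j" for j by (rule lim_near) (use rs i in auto)
    have "c i \<le> M i c"
      by (rule LIMSEQ_le[OF 1 cont[OF i 1]]) (use lab0 rs i in auto)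
    moreover have "M i c \<le> c i"
      by (rule LIMSEQ_le[OF cont[OF i 2] 2]) (use lab1 rs i in auto)
    ultimately show ?thesis by simp
  qed
  show thesis by (rule that[of c]) (use fixp c in auto)
qed

text \<open>Brouwer's theorem is applied to the coefficients of combinations of an \<epsilon>-net of
  \<open>C\<close>, with hat functions as weights; this yields approximate fixed points. Compactness
  of \<open>C\<close> turns them into an exact one.\<close>

lemma schauder_fixed_point:
  fixes T :: "'a::real_normed_vector \<Rightarrow> 'a"
  assumes cont: "continuous_on UNIV T" and C: "compact C" "range T \<subseteq> C"
  shows "\<exists>u. T u = u"
proof -
  have appr: "\<exists>u. dist u (T u) \<le> \<epsilon>" if \<epsilon>: "\<epsilon> > 0" for \<epsilon>
  proof -
    obtain k where k: "finite k" "C \<subseteq> (\<Union>x\<in>k. ball x \<epsilon>)"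
      using C(1) \<epsilon> unfolding compact_eq_totally_bounded by blast
    obtain y :: "nat \<Rightarrow> 'a" and N where y: "k = y ` {..<N}"
      using finite_imp_nat_seg_image_inj_on[OF k(1)] by (metis lessThan_def)
    define m where "m i z = max 0 (\<epsilon> - dist z (y i))" for i z
    define s where "s z = (\<Sum>i<N. m i z)" for z
    have m0: "m i z \<ge> 0" for i z by (simp add: m_def)
    have spos: "s (T z) > 0" for z
    proof -
      obtain i where "i < N" "dist (y i) (T z) < \<epsilon>" 
      proof -
        have "T z \<in> (\<Union>x\<in>k. ball x \<epsilon>)" using k(2) C(2) by blast
        then show ?thesis using that y by auto
      qed
      then have "m i (T z) > 0" by (simp add: m_def dist_commute)
      with \<open>i < N\<close> show ?thesis unfolding s_def by (intro sum_pos2[of _ i]) (auto simp: m0)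
    qed
    \<comment> \<open>For arbitrary \<open>c\<close> in the cube, \<open>L c\<close> is not a convex
      combination. At a fixed point of \<open>M\<close> it is one, because the values of
      \<open>M\<close> are weights with sum 1.\<close>
    define L where "L c = (\<Sum>j<N. c j *\<^sub>R y j)" for c :: "nat \<Rightarrow> real"
    define M where "M i c = m i (T (L c)) / s (T (L c))" for i c
    have "(\<lambda>k. M i (x k)) \<longlonglongrightarrow> M i c" if "\<And>j. (\<lambda>k. x k j) \<longlonglongrightarrow> c j" for i x c
    proof -
      have "(\<lambda>k. T (L (x k))) \<longlonglongrightarrow> T (L c)"
        using cont unfolding L_def
        by (intro isCont_tendsto_compose[of _ T] tendsto_intros that) (simp add: continuous_on_eq_continuous_at)
      then show ?thesis unfolding M_def s_def m_def
        using spos[of "L c"] by (intro tendsto_intros) (auto simp: s_def m_def)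
    qed
    moreover have "0 \<le> M i c \<and> M i c \<le> 1" if "i < N" for i c
    proof -
      have "m i (T (L c)) \<le> s (T (L c))" unfolding s_def
        using that m0 by (intro member_le_sum) auto
      then show ?thesis using spos[of "L c"] m0 by (simp add: M_def)
    qed
    ultimately obtain c where c: "\<And>i. i < N \<Longrightarrow> M i c = c i" "\<And>i. 0 \<le> c i"
      using unit_cube_fixed_point[of N M] by blast
    have "(\<Sum>i<N. c i) = (\<Sum>i<N. M i c)" using c by simp
    also have "\<dots> = 1" using spos[of "L c"] by (simp add: M_def s_def flip: sum_divide_distrib)
    finally have c1: "(\<Sum>i<N. c i) = 1" .
    have "L c - T (L c) = (\<Sum>i<N. c i *\<^sub>R (y i - T (L c)))"
      by (simp add: scaleR_diff_right sum_subtractf L_def flip: scaleR_left.sum)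
         (simp add: c1)
    also have "norm \<dots> \<le> (\<Sum>i<N. c i * \<epsilon>)"
    proof (rule sum_norm_le)
      fix i assume "i \<in> {..<N}"
      then have i: "i < N" by simp
      \<comment> \<open>A nonzero weight means that the hat at \<open>y i\<close> is positive at
        \<open>T (L c)\<close>, so this net point is \<epsilon>-close.\<close>
      show "norm (c i *\<^sub>R (y i - T (L c))) \<le> c i * \<epsilon>"
      proof (cases "c i = 0")
        case False
        then have "m i (T (L c)) \<noteq> 0" using c(1)[OF i] by (auto simp: M_def)
        then have "dist (T (L c)) (y i) < \<epsilon>" by (auto simp: m_def max_def split: if_splits)
        then show ?thesis using c(2)[of i] by (auto simp: dist_norm norm_minus_commute intro!: mult_left_mono)
      qed simp
    qed
    also have "\<dots> = \<epsilon>" using c1 by (simp flip: sum_distrib_right)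
    finally show ?thesis by (auto simp: dist_norm)
  qed
  then have "\<exists>u. dist u (T u) \<le> inverse (real (Suc n))" for n by (simp add: appr)
  then obtain u where u: "\<And>n. dist (u n) (T (u n)) \<le> inverse (real (Suc n))" by metis
  have "T (u n) \<in> C" for n using C(2) by auto
  then obtain l r where lr: "strict_mono (r :: nat \<Rightarrow> nat)" "((\<lambda>n. T (u n)) \<circ> r) \<longlonglongrightarrow> l"
    using C(1) unfolding compact_eq_seq_compact_metric seq_compact_def by metis
  have inv: "(\<lambda>n. inverse (real (Suc (r n)))) \<longlonglongrightarrow> 0"
    using LIMSEQ_subseq_LIMSEQ[OF LIMSEQ_inverse_real_of_nat lr(1)] by (simp add: o_def)
  have "norm (T (u (r n)) - u (r n)) \<le> inverse (real (Suc (r n)))" for n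
    using u[of "r n"] by (simp add: dist_norm norm_minus_commute)
  then have "(\<lambda>n. T (u (r n)) - u (r n)) \<longlonglongrightarrow> 0"
    by (rule Lim_null_comparison[OF always_eventually, OF allI inv])
  then have "(\<lambda>n. u (r n)) \<longlonglongrightarrow> l"
    using lr(2) Lim_transform2[of "\<lambda>n. T (u (r n))" l sequentially "\<lambda>n. u (r n)"] by (simp add: o_def)
  then have "(\<lambda>n. T (u (r n))) \<longlonglongrightarrow> T l"
    using cont by (intro isCont_tendsto_compose[of _ T]) (simp_all add: continuous_on_eq_continuous_at)
  then show ?thesis using lr(2) LIMSEQ_unique by (fastforce simp: o_def)
qed

text \<open>Schauder's theorem for \<open>T\<close> combined with the radial retraction
  \<open>t\<close> onto the ball of radius \<open>R\<close>. If \<open>t\<close> acted nontrivially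
  at the value of \<open>T\<close>, the fixed point would have norm \<open>R\<close> and solve u =
  \<tau> T u with \<tau> = R / |T u|, which the bound excludes.\<close>

lemma schaefer_fixed_point:
  fixes T :: "'a::real_normed_vector \<Rightarrow> 'a"
  assumes cont: "continuous_on UNIV T"
    and comp: "compact (closure (T ` cball 0 R))"
    and R: "R > 0" "\<And>u \<tau>. 0 \<le> \<tau> \<Longrightarrow> \<tau> \<le> 1 \<Longrightarrow> u = \<tau> *\<^sub>R T u \<Longrightarrow> norm u < R"
  shows "\<exists>u. T u = u"
proof -
  define t :: "'a \<Rightarrow> 'a" where "t x = (R / max R (norm x)) *\<^sub>R x" for x
  have ct: "continuous_on S t" for S
    unfolding t_def using R(1) by (intro continuous_intros) auto
  have tin: "norm (t x) \<le> R" for x using R(1) by (auto simp: t_def max_def)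
  have tid: "t x = x" if "norm x \<le> R" for x using R(1) that by (simp add: t_def max_def)
  \<comment> \<open>The inner retraction confines \<open>T\<close> to the ball where it is compact;
    the outer one brings the value back to the ball, so at a fixed point the inner one acts as the
    identity.\<close>
  have "\<exists>u. t (T (t u)) = u"
  proof (rule schauder_fixed_point)
    show "continuous_on UNIV (\<lambda>u. t (T (t u)))"
      by (intro continuous_on_compose2[OF ct] continuous_on_compose2[OF cont] ct) auto
    show "compact (t ` closure (T ` cball 0 R))" by (rule compact_continuous_image[OF ct comp])
    show "range (\<lambda>u. t (T (t u))) \<subseteq> t ` closure (T ` cball 0 R)"
      using tin by (intro image_subsetI imageI subsetD[OF closure_subset]) auto
  qed
  then obtain u where u: "t (T (t u)) = u" ..
  then have nu: "norm u \<le> R" using tin by metis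
  then have u2: "t (T u) = u" using u tid by simp
  have "norm u < R"
    using R(1) u2 by (intro R(2)[of "R / max R (norm (T u))"]) (auto simp: t_def)
  have "norm (T u) \<le> R"
  proof (rule ccontr)
    assume "\<not> ?thesis"
    then have "norm (t (T u)) = R" using R(1) by (cases "T u = 0") (auto simp: t_def max_def)
    then show False using u2 \<open>norm u < R\<close> by simp
  qed
  then show ?thesis using u2 tid by metis
qed

section \<open>Symmetric forms on a subspace\<close>

text \<open>The source of Euler equations: expanding a functional along a line through its minimiser
  leaves such a quadratic.\<close>

lemma quadratic_nonneg_imp_linear_zero:
  fixes a b :: real
  assumes a: "a \<ge> 0" and nn: "\<And>t. t\<^sup>2 * a + 2 * t * b \<ge> 0"
  shows "b = 0"
proof -
  \<comment> \<open>The summand 1 keeps the denominator positive also for a = 0; at -c the quadratic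
    equals -c^2 (a + 2).\<close>
  define c where "c = b / (a + 1)"
  have b: "b = c * (a + 1)" using a by (simp add: c_def)
  have "0 \<le> (- c)\<^sup>2 * a + 2 * (- c) * b" by (rule nn)
  also have "\<dots> = - (c\<^sup>2 * (a + 2))" by (simp add: b power2_eq_square algebra_simps)
  finally have "c = 0" using a by (simp add: mult_le_0_iff)
  then show ?thesis using b by simp
qed

text \<open>Form domains are subspaces with a norm of their own; hence \<open>D\<close> is a set in
  the ambient space instead of a separate type, and the laws are stated on \<open>D\<close>
  only.\<close>

locale sym_form =
  fixes D :: "'h::real_vector set" and C :: "'h \<Rightarrow> 'h \<Rightarrow> real"
  assumes D: "subspace D"
    and add: "\<And>x y z. x \<in> D \<Longrightarrow> y \<in> D \<Longrightarrow> z \<in> D \<Longrightarrow> C (x + y) z = C x z + C y z"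
    and scale: "\<And>x z c. x \<in> D \<Longrightarrow> z \<in> D \<Longrightarrow> C (c *\<^sub>R x) z = c * C x z"
    and sym: "\<And>x y. x \<in> D \<Longrightarrow> y \<in> D \<Longrightarrow> C x y = C y x"
begin

lemma D_simps [simp]:
  "0 \<in> D" "x \<in> D \<Longrightarrow> y \<in> D \<Longrightarrow> x + y \<in> D" "x \<in> D \<Longrightarrow> y \<in> D \<Longrightarrow> x - y \<in> D"
  "x \<in> D \<Longrightarrow> c *\<^sub>R x \<in> D"
  using D subspace_0 subspace_add subspace_diff subspace_scale by blast+

lemma D_sum [simp]: "(\<And>i. i \<in> I \<Longrightarrow> f i \<in> D) \<Longrightarrow> sum f I \<in> D"
  using D by (rule subspace_sum)

lemma add2: "x \<in> D \<Longrightarrow> y \<in> D \<Longrightarrow> z \<in> D \<Longrightarrow> C z (x + y) = C z x + C z y"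
  by (metis add sym D_simps(2))

lemma scale2: "x \<in> D \<Longrightarrow> z \<in> D \<Longrightarrow> C z (c *\<^sub>R x) = c * C z x"
  by (metis scale sym D_simps(4))

lemma diff: "x \<in> D \<Longrightarrow> y \<in> D \<Longrightarrow> z \<in> D \<Longrightarrow> C (x - y) z = C x z - C y z"
  using add[of x "(-1) *\<^sub>R y" z] scale[of y z "-1"] D_simps(4)[of y "-1"] by simp

lemma diff2: "x \<in> D \<Longrightarrow> y \<in> D \<Longrightarrow> z \<in> D \<Longrightarrow> C z (x - y) = C z x - C z y"
  by (metis diff sym D_simps(3))

lemma zero [simp]: "z \<in> D \<Longrightarrow> C 0 z = 0"
  using scale[of z z 0] by simp

lemma sum: "finite I \<Longrightarrow> (\<And>i. i \<in> I \<Longrightarrow> f i \<in> D) \<Longrightarrow> z \<in> D \<Longrightarrow> C (\<Sum>i\<in>I. f i) z = (\<Sum>i\<in>I. C (f i) z)"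
  by (induction I rule: finite_induct) (auto simp: add)

text \<open>Solved for the difference, with the midpoint isolated: a lower bound at midpoints turns
  minimising sequences into Cauchy sequences.\<close>

lemma parallelogram:
  assumes "x \<in> D" "y \<in> D"
  shows "C (x - y) (x - y) = 2 * C x x + 2 * C y y - 4 * C ((1/2) *\<^sub>R (x + y)) ((1/2) *\<^sub>R (x + y))"
  using assms by (simp add: scale scale2 add add2 diff diff2 sym[of y x] field_simps)

lemma line:
  assumes "x \<in> D" "y \<in> D"
  shows "C (x + t *\<^sub>R y) (x + t *\<^sub>R y) = C x x + 2 * t * C x y + t\<^sup>2 * C y y"
  using assms by (simp add: scale scale2 add add2 sym[of y x] power2_eq_square algebra_simps)

end

locale nonneg_form = sym_form +
  assumes nonneg: "\<And>x. x \<in> D \<Longrightarrow> 0 \<le> C x x"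
begin

lemma Cauchy_Schwarz: "x \<in> D \<Longrightarrow> y \<in> D \<Longrightarrow> (C x y)\<^sup>2 \<le> C x x * C y y"
proof -
  assume x: "x \<in> D" and y: "y \<in> D"
  show ?thesis
  proof (cases "C y y = 0")
    case True
    have "C x y = 0"
    proof (rule ccontr)
      assume "C x y \<noteq> 0"
      \<comment> \<open>With C y y = 0 the form is affine along the line through x in direction y;
        this multiple of y brings it down to -1.\<close>
      have "0 \<le> C (x + (- (C x x + 1) / (2 * C x y)) *\<^sub>R y) (x + (- (C x x + 1) / (2 * C x y)) *\<^sub>R y)"
        using x y by (intro nonneg) auto
      also have "\<dots> = - 1" unfolding line[OF x y] using True \<open>C x y \<noteq> 0\<close> by (simp add: field_simps)
      finally show False by simp
    qed
    then show ?thesis using True by simp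
  next
    case False
    then have pos: "C y y > 0" using nonneg[OF y] by simp
    have "0 \<le> C (x + (- C x y / C y y) *\<^sub>R y) (x + (- C x y / C y y) *\<^sub>R y)"
      using x y by (intro nonneg) auto
    also have "\<dots> = C x x - (C x y)\<^sup>2 / C y y"
      unfolding line[OF x y] using pos by (simp add: field_simps power2_eq_square)
    finally show ?thesis using pos by (simp add: field_simps)
  qed
qed

lemma tendsto_form:
  assumes x: "\<And>n. x n \<in> D" and l: "l \<in> D" and y: "y \<in> D"
    and lim: "(\<lambda>n. C (x n - l) (x n - l)) \<longlonglongrightarrow> 0"
  shows "(\<lambda>n. C (x n) y) \<longlonglongrightarrow> C l y"
proof -
  have "(\<lambda>n. C (x n - l) (x n - l) * C y y) \<longlonglongrightarrow> 0"
    using tendsto_mult_right[OF lim, of "C y y"] by simp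
  then have "(\<lambda>n. (C (x n - l) y)\<^sup>2) \<longlonglongrightarrow> 0"
    using x l y Cauchy_Schwarz
    by (intro tendsto_sandwich[OF _ _ tendsto_const, of 0 "\<lambda>n. (C (x n - l) y)\<^sup>2" _ "\<lambda>n. C (x n - l) (x n - l) * C y y"])
       (auto intro!: always_eventually)
  then have "(\<lambda>n. C (x n - l) y) \<longlonglongrightarrow> 0" by simp
  then have "(\<lambda>n. C (x n) y - C l y) \<longlonglongrightarrow> 0" using x l y by (simp add: diff)
  then show ?thesis by (simp add: LIM_zero_iff)
qed

text \<open>Direct minimisation of C x x - 2 l x. Completeness refers to \<open>C\<close> itself, as
  \<open>D\<close> is in general not complete in the ambient norm.\<close>

lemma riesz_representation:
  assumes complete: "\<And>x. (\<And>n. x n \<in> D) \<Longrightarrow>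
      (\<And>e. e > 0 \<Longrightarrow> \<exists>N. \<forall>m\<ge>N. \<forall>n\<ge>N. C (x m - x n) (x m - x n) < e) \<Longrightarrow>
      \<exists>l\<in>D. (\<lambda>n. C (x n - l) (x n - l)) \<longlonglongrightarrow> 0"
    and l_add: "\<And>x y. x \<in> D \<Longrightarrow> y \<in> D \<Longrightarrow> l (x + y) = l x + l y"
    and l_scale: "\<And>x c. x \<in> D \<Longrightarrow> l (c *\<^sub>R x) = c * l x"
    and l_bound: "\<And>x. x \<in> D \<Longrightarrow> (l x)\<^sup>2 \<le> M * C x x" and M: "M \<ge> 0"
  shows "\<exists>u\<in>D. \<forall>x\<in>D. C u x = l x"
proof -
  define J where "J x = C x x - 2 * l x" for x
  have Jlow: "- M \<le> J x" if "x \<in> D" for x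
  proof (rule ccontr)
    assume "\<not> ?thesis"
    then have "C x x + M < 2 * l x" by (simp add: J_def)
    then have "(C x x + M)\<^sup>2 < (2 * l x)\<^sup>2" using nonneg[OF that] M by (intro power_strict_mono) auto
    then have "(C x x + M)\<^sup>2 < 4 * (M * C x x)" using l_bound[OF that] by (simp add: power_mult_distrib)
    then have "(C x x - M)\<^sup>2 < 0" by (simp add: power2_eq_square algebra_simps)
    then show False by simp
  qed
  define m where "m = Inf (J ` D)"
  have bdd: "bdd_below (J ` D)" using Jlow by (intro bdd_belowI2)
  have m_le: "m \<le> J x" if "x \<in> D" for x unfolding m_def using that by (intro cINF_lower bdd)
  have "\<exists>x\<in>D. J x < m + inverse (real (Suc n))" for n
  proof -
    have "Inf (J ` D) < m + inverse (real (Suc n))" by (simp add: m_def)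
    then show ?thesis using cInf_lessD[of "J ` D"] D_simps(1) by blast
  qed
  then obtain x where x: "\<And>n. x n \<in> D" "\<And>n. J (x n) < m + inverse (real (Suc n))" by metis
  have J_mid: "C (x i - x j) (x i - x j) = 2 * J (x i) + 2 * J (x j) - 4 * J ((1/2) *\<^sub>R (x i + x j))" for i j
    unfolding parallelogram[OF x(1) x(1)] J_def using x(1) by (simp add: l_add l_scale field_simps)
  have small: "C (x i - x j) (x i - x j) < 2 * inverse (real (Suc i)) + 2 * inverse (real (Suc j))" for i j
  proof -
    have "m \<le> J ((1/2) *\<^sub>R (x i + x j))" by (rule m_le) (use x(1) in auto)
    then show ?thesis using x(2)[of i] x(2)[of j] unfolding J_mid by linarith
  qed
  have "\<exists>N. \<forall>i\<ge>N. \<forall>j\<ge>N. C (x i - x j) (x i - x j) < e" if "e > 0" for e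
  proof -
    obtain N where N: "inverse (real (Suc N)) < e / 4" using reals_Archimedean[of "e/4"] \<open>e > 0\<close> by auto
    have "C (x i - x j) (x i - x j) < e" if "i \<ge> N" "j \<ge> N" for i j
    proof -
      have "inverse (real (Suc i)) \<le> inverse (real (Suc N))" "inverse (real (Suc j)) \<le> inverse (real (Suc N))"
        using that by (auto intro: le_imp_inverse_le)
      then show ?thesis using small[of i j] N by linarith
    qed
    then show ?thesis by blast
  qed
  from complete[OF x(1) this] obtain u where u: "u \<in> D" "(\<lambda>n. C (x n - u) (x n - u)) \<longlonglongrightarrow> 0"
    by blast
  have "C u y - l y = 0" if y: "y \<in> D" for y
  proof (rule quadratic_nonneg_imp_linear_zero[of "C y y"])
    show "C y y \<ge> 0" using nonneg[OF y] .
    fix t :: real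
    have lim: "(\<lambda>n. inverse (real (Suc n)) + 2 * t * (C (x n) y - l y) + t\<^sup>2 * C y y)
        \<longlonglongrightarrow> 0 + 2 * t * (C u y - l y) + t\<^sup>2 * C y y"
      by (intro tendsto_intros LIMSEQ_inverse_real_of_nat tendsto_form[OF x(1) u(1) y u(2)])
    \<comment> \<open>Minimality is exploited along the sequence, with an error below 1 / (n + 1);
      the functional is never evaluated at the limit \<open>u\<close>.\<close>
    have "0 \<le> inverse (real (Suc n)) + 2 * t * (C (x n) y - l y) + t\<^sup>2 * C y y" for n
    proof -
      have "m \<le> J (x n + t *\<^sub>R y)" by (rule m_le) (use x(1) y in auto)
      also have "J (x n + t *\<^sub>R y) = J (x n) + 2 * t * (C (x n) y - l y) + t\<^sup>2 * C y y"
        using x(1) y by (simp add: J_def line l_add l_scale algebra_simps)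
      finally show ?thesis using x(2)[of n] by linarith
    qed
    then have "0 \<le> 0 + 2 * t * (C u y - l y) + t\<^sup>2 * C y y"
      by (intro LIMSEQ_le_const[OF lim]) auto
    then show "0 \<le> t\<^sup>2 * C y y + 2 * t * (C u y - l y)" by linarith
  qed
  then show ?thesis using u(1) by (intro bexI[of _ u]) auto
qed

end

section \<open>Eigenvalue problems with compact embedding\<close>

text \<open>The two analytic properties of the energy on which the spectral theory rests: the form
  is closed, and its domain embeds compactly into the ambient space.\<close>

locale compact_form = nonneg_form D B for D :: "'h::real_inner set" and B +
  assumes complete: "\<And>x. (\<And>n. x n \<in> D) \<Longrightarrow>
      (\<And>e. e > 0 \<Longrightarrow> \<exists>N. \<forall>m\<ge>N. \<forall>n\<ge>N. B (x m - x n) (x m - x n) + (norm (x m - x n))\<^sup>2 < e) \<Longrightarrow>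
      \<exists>l\<in>D. (\<lambda>n. B (x n - l) (x n - l) + (norm (x n - l))\<^sup>2) \<longlonglongrightarrow> 0"
    and compact: "\<And>x M. (\<And>n. x n \<in> D) \<Longrightarrow> (\<And>n. B (x n) (x n) + (norm (x n))\<^sup>2 \<le> M) \<Longrightarrow>
      \<exists>l r. strict_mono (r :: nat \<Rightarrow> nat) \<and> (x \<circ> r) \<longlonglongrightarrow> l"
begin

lemma graph_norm_limitD:
  assumes "\<And>n. x n \<in> D" "l \<in> D" "(\<lambda>n. B (x n - l) (x n - l) + (norm (x n - l))\<^sup>2) \<longlonglongrightarrow> 0"
  shows "(\<lambda>n. B (x n - l) (x n - l)) \<longlonglongrightarrow> 0" "x \<longlonglongrightarrow> l"
proof -
  have nn: "0 \<le> B (x n - l) (x n - l)" for n using assms by (intro nonneg) auto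
  show "(\<lambda>n. B (x n - l) (x n - l)) \<longlonglongrightarrow> 0"
    by (rule tendsto_sandwich[OF _ _ tendsto_const assms(3)]) (use nn in auto)
  have "(\<lambda>n. (norm (x n - l))\<^sup>2) \<longlonglongrightarrow> 0"
    by (rule tendsto_sandwich[OF _ _ tendsto_const assms(3)]) (use nn in auto)
  then have "(\<lambda>n. norm (x n - l)) \<longlonglongrightarrow> 0" by simp
  then show "x \<longlonglongrightarrow> l" by (simp add: LIM_zero_iff tendsto_norm_zero_iff)
qed

text \<open>The infimum of B on the unit sphere of \<open>E\<close> is attained: compactness gives
  convergence in the ambient norm, and the parallelogram law for B - \<nu> improves it to the graph
  norm. The Euler equation is obtained against \<open>E\<close> only.\<close>

lemma rayleigh_minimizer:
  assumes E: "subspace E" "E \<subseteq> D" and Ecl: "\<And>x l. (\<And>n. x n \<in> E) \<Longrightarrow> x \<longlonglongrightarrow> l \<Longrightarrow> l \<in> D \<Longrightarrow> l \<in> E"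
    and z: "z \<in> E" "B z z < lp * (norm z)\<^sup>2"
  shows "\<exists>e\<in>E. \<exists>\<nu><lp. norm e = 1 \<and> (\<forall>y\<in>E. B e y = \<nu> * inner e y)"
proof -
  have ED: "x \<in> D" if "x \<in> E" for x using that E(2) by blast
  define U where "U = {x \<in> E. norm x = 1}"
  have z0: "z \<noteq> 0" using z(2) by auto
  define z1 where "z1 = (1 / norm z) *\<^sub>R z"
  have z1: "z1 \<in> U" using z(1) z0 E(1) by (auto simp: z1_def U_def subspace_scale)
  have Bz1: "B z1 z1 < lp"
    using z z0 ED[OF z(1)] by (simp add: z1_def scale scale2 field_simps power2_eq_square)
  define \<nu> where "\<nu> = Inf ((\<lambda>x. B x x) ` U)"
  have bdd: "bdd_below ((\<lambda>x. B x x) ` U)" using ED nonneg by (intro bdd_belowI2[of _ 0]) (auto simp: U_def)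
  have nu_le: "\<nu> \<le> B x x" if "x \<in> U" for x unfolding \<nu>_def using that by (intro cINF_lower bdd)
  have nu_lam: "\<nu> < lp" using nu_le[OF z1] Bz1 by simp
  have "\<exists>x\<in>U. B x x < \<nu> + inverse (real (Suc n))" for n
  proof -
    have "Inf ((\<lambda>x. B x x) ` U) < \<nu> + inverse (real (Suc n))" by (simp add: \<nu>_def)
    then show ?thesis using cInf_lessD[of "(\<lambda>x. B x x) ` U"] z1 by blast
  qed
  then obtain x0 where x0: "\<And>n. x0 n \<in> U" "\<And>n. B (x0 n) (x0 n) < \<nu> + inverse (real (Suc n))" by metis
  have "B (x0 n) (x0 n) + (norm (x0 n))\<^sup>2 \<le> \<nu> + 2" for n
  proof -
    have "inverse (real (Suc n)) \<le> 1" by (simp add: divide_simps)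
    then show ?thesis using x0(1)[of n] x0(2)[of n] by (simp add: U_def)
  qed
  then obtain l r where r: "strict_mono (r :: nat \<Rightarrow> nat)" "(x0 \<circ> r) \<longlonglongrightarrow> l"
    using compact[of x0] x0(1) ED by (metis (mono_tags, lifting) U_def mem_Collect_eq)
  define x where "x n = x0 (r n)" for n
  have x: "x n \<in> U" "x n \<in> E" "x n \<in> D" "norm (x n) = 1" for n
    using x0(1)[of "r n"] ED by (auto simp: x_def U_def)
  have xB: "B (x n) (x n) < \<nu> + inverse (real (Suc n))" for n
  proof -
    have "inverse (real (Suc (r n))) \<le> inverse (real (Suc n))"
      using seq_suble[OF r(1), of n] by (intro le_imp_inverse_le) auto
    then show ?thesis using x0(2)[of "r n"] unfolding x_def by linarith
  qed
  have xl: "x \<longlonglongrightarrow> l" using r(2) by (simp add: x_def[abs_def] o_def)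
  \<comment> \<open>By the choice of \<nu> this form is nonnegative on \<open>E\<close>, and it
    tends to 0 along the minimising sequence.\<close>
  define C where "C y w = B y w - \<nu> * inner y w" for y w
  interpret E: nonneg_form E C
  proof
    show "subspace E" by fact
    show "0 \<le> C y y" if y: "y \<in> E" for y
    proof (cases "y = 0")
      case True then show ?thesis using y ED by (simp add: C_def)
    next
      case False
      have "\<nu> \<le> B ((1 / norm y) *\<^sub>R y) ((1 / norm y) *\<^sub>R y)"
        using False y E(1) by (intro nu_le) (auto simp: U_def subspace_scale)
      also have "\<dots> = B y y / (norm y)\<^sup>2" using ED[OF y] by (simp add: scale scale2 power2_eq_square)
      finally show ?thesis using False by (simp add: C_def field_simps power2_norm_eq_inner)
    qed
    show "C x y = C y x" if "x \<in> E" "y \<in> E" for x y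
      using that ED sym[of x y] by (simp add: C_def inner_commute)
  qed (use ED in \<open>auto simp: C_def add scale inner_add_left algebra_simps\<close>)
  have Cx: "C (x n) (x n) < inverse (real (Suc n))" for n
    using xB[of n] x(4)[of n] by (simp add: C_def flip: power2_norm_eq_inner)
  have small: "B (x i - x j) (x i - x j) + (norm (x i - x j))\<^sup>2
      \<le> 2 * inverse (real (Suc i)) + 2 * inverse (real (Suc j)) + (\<bar>\<nu>\<bar> + 1) * (norm (x i - x j))\<^sup>2" for i j
  proof -
    have "C (x i - x j) (x i - x j) \<le> 2 * C (x i) (x i) + 2 * C (x j) (x j)"
      unfolding E.parallelogram[OF x(2) x(2)]
      using E.nonneg[of "(1/2) *\<^sub>R (x i + x j)"] x(2) by simp
    then have "B (x i - x j) (x i - x j)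
        \<le> 2 * inverse (real (Suc i)) + 2 * inverse (real (Suc j)) + \<nu> * (norm (x i - x j))\<^sup>2"
      using Cx[of i] Cx[of j] by (simp add: C_def power2_norm_eq_inner)
    moreover have "\<nu> * (norm (x i - x j))\<^sup>2 \<le> \<bar>\<nu>\<bar> * (norm (x i - x j))\<^sup>2" by (intro mult_right_mono) auto
    ultimately show ?thesis by (simp add: algebra_simps)
  qed
  have "\<exists>N. \<forall>i\<ge>N. \<forall>j\<ge>N. B (x i - x j) (x i - x j) + (norm (x i - x j))\<^sup>2 < e" if e: "e > 0" for e
  proof -
    have "(\<lambda>n. 4 * inverse (real (Suc n))) \<longlonglongrightarrow> 4 * 0"
      by (intro tendsto_intros LIMSEQ_inverse_real_of_nat)
    then have "\<forall>\<^sub>F n in sequentially. 4 * inverse (real (Suc n)) < e / 2"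
      by (rule order_tendstoD(2)) (use e in simp)
    then obtain N1 where N1: "4 * inverse (real (Suc N1)) < e / 2"
      by (auto simp: eventually_sequentially)
    \<comment> \<open>The norm term of \<open>small\<close> gets half of e through \<delta>; the two
      inverses get the other half through \<open>N1\<close>.\<close>
    define \<delta> where "\<delta> = sqrt (e / (2 * (\<bar>\<nu>\<bar> + 1)))"
    have dp: "\<delta> > 0" using e by (simp add: \<delta>_def)
    have d2: "(\<bar>\<nu>\<bar> + 1) * \<delta>\<^sup>2 = e / 2" using e by (simp add: \<delta>_def field_simps)
    obtain N2 where N2: "\<And>i j. i \<ge> N2 \<Longrightarrow> j \<ge> N2 \<Longrightarrow> norm (x i - x j) < \<delta>"
      using LIMSEQ_imp_Cauchy[OF xl] dp unfolding Cauchy_def by (metis dist_norm)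
    have "B (x i - x j) (x i - x j) + (norm (x i - x j))\<^sup>2 < e" if "i \<ge> max N1 N2" "j \<ge> max N1 N2" for i j
    proof -
      have "inverse (real (Suc i)) \<le> inverse (real (Suc N1))" "inverse (real (Suc j)) \<le> inverse (real (Suc N1))"
        using that by (auto intro: le_imp_inverse_le)
      moreover have "(\<bar>\<nu>\<bar> + 1) * (norm (x i - x j))\<^sup>2 \<le> (\<bar>\<nu>\<bar> + 1) * \<delta>\<^sup>2"
        using N2[of i j] that by (intro mult_left_mono power_mono) auto
      ultimately show ?thesis using small[of i j] N1 d2 by linarith
    qed
    then show ?thesis by blast
  qed
  from complete[OF x(3) this] obtain e where e: "e \<in> D" and elim: "(\<lambda>n. B (x n - e) (x n - e) + (norm (x n - e))\<^sup>2) \<longlonglongrightarrow> 0"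
    by blast
  note elim2 = graph_norm_limitD[OF x(3) e elim]
  have eE: "e \<in> E" by (rule Ecl[OF x(2) elim2(2) e])
  have "norm e = 1" using tendsto_norm[OF elim2(2)] x(4) by (simp add: LIMSEQ_const_iff)
  moreover have "C e y = 0" if y: "y \<in> E" for y
  proof (rule quadratic_nonneg_imp_linear_zero[of "C y y"])
    show "C y y \<ge> 0" using E.nonneg[OF y] .
    fix t :: real
    have "(\<lambda>n. C (x n) y) \<longlonglongrightarrow> C e y" unfolding C_def
      by (intro tendsto_intros tendsto_form[OF x(3) e ED[OF y] elim2(1)] elim2(2))
    then have lim: "(\<lambda>n. inverse (real (Suc n)) + 2 * t * C (x n) y + t\<^sup>2 * C y y)
        \<longlonglongrightarrow> 0 + 2 * t * C e y + t\<^sup>2 * C y y"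
      by (intro tendsto_intros LIMSEQ_inverse_real_of_nat)
    have "0 \<le> inverse (real (Suc n)) + 2 * t * C (x n) y + t\<^sup>2 * C y y" for n
    proof -
      have "0 \<le> C (x n + t *\<^sub>R y) (x n + t *\<^sub>R y)" using x(2) y by (intro E.nonneg) auto
      then show ?thesis using Cx[of n] x(2) y by (simp add: E.line)
    qed
    then have "0 \<le> 0 + 2 * t * C e y + t\<^sup>2 * C y y"
      by (intro LIMSEQ_le_const[OF lim]) auto
    then show "0 \<le> t\<^sup>2 * C y y + 2 * t * C e y" by linarith
  qed
  ultimately show ?thesis using eE nu_lam by (auto simp: C_def intro!: bexI[of _ e] exI[of _ \<nu>])
qed

end


text \<open>\<open>G\<close> is an orthonormal family of eigenvectors for the part of the spectrum
  up to \<open>lm\<close>; on its complement the spectrum starts at \<open>lp\<close>. The ends can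
  be numbers other than eigenvalues, and \<open>G\<close> can be empty, as in the case below the
  first eigenvalue.\<close>

locale spectral_gap = compact_form D B for D :: "'h::real_inner set" and B +
  fixes G :: "'h set" and ev :: "'h \<Rightarrow> real" and lm lp :: real
  assumes G: "finite G" "G \<subseteq> D"
    and orthonormal: "\<And>g h. g \<in> G \<Longrightarrow> h \<in> G \<Longrightarrow> inner g h = (if g = h then 1 else 0)"
    and eigen: "\<And>g y. g \<in> G \<Longrightarrow> y \<in> D \<Longrightarrow> B g y = ev g * inner g y"
    and ev_le: "\<And>g. g \<in> G \<Longrightarrow> ev g \<le> lm"
    and gap: "\<And>z. z \<in> D \<Longrightarrow> (\<And>g. g \<in> G \<Longrightarrow> inner z g = 0) \<Longrightarrow> lp * (norm z)\<^sup>2 \<le> B z z"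
    and less: "lm < lp"
begin

definition P :: "'h \<Rightarrow> 'h" where "P u = (\<Sum>g\<in>G. inner u g *\<^sub>R g)"

lemma P_in_D [simp]: "P u \<in> D"
  unfolding P_def using G by (intro D_sum D_simps) auto

lemma P_add: "P (x + y) = P x + P y" by (simp add: P_def inner_add_left scaleR_add_left sum.distrib)

lemma P_scale: "P (c *\<^sub>R x) = c *\<^sub>R P x" by (simp add: P_def scaleR_sum_right)

lemma P_diff: "P (x - y) = P x - P y" by (simp add: P_def inner_diff_left scaleR_diff_left sum_subtractf)

lemma tendsto_P: "(x \<longlongrightarrow> l) F \<Longrightarrow> ((\<lambda>n. P (x n)) \<longlongrightarrow> P l) F"
  unfolding P_def by (intro tendsto_intros)

lemma inner_P: "g \<in> G \<Longrightarrow> inner (P u) g = inner u g"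
proof -
  assume g: "g \<in> G"
  have "inner (P u) g = (\<Sum>h\<in>G. inner u h * inner h g)" by (simp add: P_def inner_sum_left)
  also have "\<dots> = (\<Sum>h\<in>G. if h = g then inner u g else 0)"
    using g by (intro sum.cong) (auto simp: orthonormal)
  finally show ?thesis using g G by simp
qed

lemma P_P [simp]: "P (P u) = P u"
  unfolding P_def[of "P u"] by (subst P_def[of u]) (intro sum.cong, auto simp: inner_P)

lemma inner_P_perp: "(\<And>g. g \<in> G \<Longrightarrow> inner z g = 0) \<Longrightarrow> inner (P u) z = 0"
  unfolding P_def inner_sum_left inner_scaleR_left by (intro sum.neutral) (simp add: inner_commute[of _ z])

lemma perp: "g \<in> G \<Longrightarrow> inner (u - P u) g = 0" by (simp add: inner_diff_left inner_P)

lemma P_orth [simp]: "inner (P u) (y - P y) = 0" "inner (y - P y) (P u) = 0"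
  using inner_P_perp[of "y - P y" u] perp by (auto simp: inner_commute)

lemma B_P: "y \<in> D \<Longrightarrow> B (P u) y = (\<Sum>g\<in>G. ev g * inner u g * inner g y)"
proof -
  assume y: "y \<in> D"
  have "B (P u) y = (\<Sum>g\<in>G. B (inner u g *\<^sub>R g) y)"
    unfolding P_def using G y by (intro sum) auto
  also have "\<dots> = (\<Sum>g\<in>G. ev g * inner u g * inner g y)"
    using G y by (intro sum.cong) (auto simp: scale subset_iff eigen)
  finally show ?thesis .
qed

text \<open>Since \<open>G\<close> consists of eigenvectors, the orthogonal splitting by
  \<open>P\<close> is orthogonal for B as well.\<close>

lemma B_P_orth [simp]: "y \<in> D \<Longrightarrow> B (P u) (y - P y) = 0" "y \<in> D \<Longrightarrow> B (y - P y) (P u) = 0"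
proof -
  assume y: "y \<in> D"
  show "B (P u) (y - P y) = 0" using y perp by (simp add: B_P inner_commute)
  then show "B (y - P y) (P u) = 0" using y by (simp add: sym)
qed

lemma norm_P: "(norm (P u))\<^sup>2 = (\<Sum>g\<in>G. (inner u g)\<^sup>2)"
proof -
  have "(norm (P u))\<^sup>2 = inner (P u) (P u)" by (simp add: power2_norm_eq_inner)
  also have "\<dots> = (\<Sum>g\<in>G. inner u g * inner g (P u))" by (subst P_def) (simp add: inner_sum_left)
  also have "\<dots> = (\<Sum>g\<in>G. (inner u g)\<^sup>2)"
    by (intro sum.cong) (auto simp: inner_commute[of _ "P u"] inner_P power2_eq_square)
  finally show ?thesis .
qed

lemma B_P_le: "B (P u) (P u) \<le> lm * (norm (P u))\<^sup>2"
proof -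
  have "B (P u) (P u) = (\<Sum>g\<in>G. ev g * (inner u g)\<^sup>2)"
    unfolding B_P[OF P_in_D]
    by (intro sum.cong) (auto simp: inner_commute[of _ "P u"] inner_P power2_eq_square)
  also have "\<dots> \<le> (\<Sum>g\<in>G. lm * (inner u g)\<^sup>2)"
    by (intro sum_mono mult_right_mono ev_le) auto
  finally show ?thesis by (simp add: norm_P sum_distrib_left)
qed

lemma B_perp_ge: "u \<in> D \<Longrightarrow> lp * (norm (u - P u))\<^sup>2 \<le> B (u - P u) (u - P u)"
  by (rule gap) (auto simp: perp)

lemma norm_split: "(norm u)\<^sup>2 = (norm (P u))\<^sup>2 + (norm (u - P u))\<^sup>2"
proof -
  have "(norm u)\<^sup>2 = inner (P u + (u - P u)) (P u + (u - P u))" by (simp add: power2_norm_eq_inner)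
  also have "\<dots> = (norm (P u))\<^sup>2 + (norm (u - P u))\<^sup>2"
    unfolding inner_add_left inner_add_right by (simp add: power2_norm_eq_inner)
  finally show ?thesis .
qed

lemma B_split: "u \<in> D \<Longrightarrow> B u u = B (P u) (P u) + B (u - P u) (u - P u)"
proof -
  assume u: "u \<in> D"
  have "B (p + z) (p + z) = B p p + B z z" if "p \<in> D" "z \<in> D" "B p z = 0" "B z p = 0" for p z
    using that by (simp add: add add2)
  from this[of "P u" "u - P u"] show ?thesis using u by simp
qed

text \<open>The reflection in the span of \<open>G\<close> turns \<open>B - \<mu>\<langle>\<cdot>,\<cdot>\<rangle>\<close>, with \<open>\<mu>\<close> in the gap, into a coercive
  symmetric form.\<close>

definition R :: "'h \<Rightarrow> 'h" where "R u = (u - P u) - P u"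

definition \<mu> :: real where "\<mu> = (lm + lp) / 2"

text \<open>The distance from \<mu> to the ends of the gap; it becomes the coercivity constant of
  \<open>A\<close>.\<close>

definition \<delta> :: real where "\<delta> = (lp - lm) / 2"

lemma \<delta>_pos: "\<delta> > 0" using less by (simp add: \<delta>_def)

lemma R_in_D [simp]: "u \<in> D \<Longrightarrow> R u \<in> D" by (simp add: R_def)

lemma R_R [simp]: "R (R u) = u" by (simp add: R_def P_diff)

lemma P_R: "P (R u) = - P u" "R u - P (R u) = u - P u" by (simp_all add: R_def P_diff)

lemma norm_R [simp]: "norm (R u) = norm u"
proof -
  have "(norm (R u))\<^sup>2 = (norm u)\<^sup>2" 
    unfolding norm_split[of u] norm_split[of "R u"] P_R(2) unfolding P_R(1) by simp
  then show ?thesis by simp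
qed

lemma B_R: "u \<in> D \<Longrightarrow> y \<in> D \<Longrightarrow> B u (R y) = B (u - P u) (y - P y) - B (P u) (P y)"
proof -
  assume u: "u \<in> D" and y: "y \<in> D"
  have "B u (R y) = B ((u - P u) + P u) ((y - P y) - P y)" by (simp add: R_def)
  also have "\<dots> = B (u - P u) (y - P y) - B (u - P u) (P y) + (B (P u) (y - P y) - B (P u) (P y))"
    using u y by (subst add) (simp_all del: diff_add_cancel add: diff2[of "y - P y" "P y"])
  finally show ?thesis using u y by simp
qed

lemma inner_R: "inner u (R y) = inner (u - P u) (y - P y) - inner (P u) (P y)"
proof -
  have "inner u (R y) = inner ((u - P u) + P u) ((y - P y) - P y)" by (simp add: R_def)
  also have "\<dots> = inner (u - P u) (y - P y) - inner (P u) (P y)"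
    unfolding inner_add_left inner_diff_right[of _ "y - P y" "P y"] by simp
  finally show ?thesis .
qed

definition A :: "'h \<Rightarrow> 'h \<Rightarrow> real" where "A u y = B u (R y) - \<mu> * inner u (R y)"

text \<open>The factor by which \<open>A\<close> dominates B: passing from \<open>A\<close> to B
  costs at most |\<mu>| times the squared norm off the span of \<open>G\<close> and |lm| times it on
  the span, and \<open>A\<close> controls the squared norm with constant \<delta>.\<close>

definition \<kappa> :: real where "\<kappa> = 1 + (\<bar>\<mu>\<bar> + \<bar>lm\<bar>) / \<delta>"

text \<open>\<open>A u u\<close> splits into \<open>X\<close> off the span of \<open>G\<close> and
  \<open>Y\<close> on the span. Each is at least \<delta> times the squared norm of its component,
  because \<mu> has distance \<delta> from both ends of the gap. Hence \<open>A\<close> is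
  equivalent to the graph norm.\<close>

lemma A_bounds:
  assumes u: "u \<in> D"
  shows "\<delta> * (norm u)\<^sup>2 \<le> A u u" "B u u \<le> \<kappa> * A u u" "A u u \<le> B u u + \<bar>\<mu>\<bar> * (norm u)\<^sup>2"
proof -
  define X where "X = B (u - P u) (u - P u) - \<mu> * (norm (u - P u))\<^sup>2"
  define Y where "Y = \<mu> * (norm (P u))\<^sup>2 - B (P u) (P u)"
  have A: "A u u = X + Y" using u
    by (simp add: A_def X_def Y_def B_R inner_R power2_norm_eq_inner algebra_simps)
  have X: "\<delta> * (norm (u - P u))\<^sup>2 \<le> X"
    using B_perp_ge[OF u] by (simp add: X_def \<delta>_def \<mu>_def field_simps)
  have Y: "\<delta> * (norm (P u))\<^sup>2 \<le> Y"
    using B_P_le[of u] by (simp add: Y_def \<delta>_def \<mu>_def field_simps)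
  show "\<delta> * (norm u)\<^sup>2 \<le> A u u"
    using X Y unfolding A norm_split[of u] by (simp add: distrib_left)
  have dp: "\<delta> > 0" by (rule \<delta>_pos)
  have "B (u - P u) (u - P u) \<le> X + \<bar>\<mu>\<bar> * (norm (u - P u))\<^sup>2"
    using mult_right_mono[of \<mu> "\<bar>\<mu>\<bar>" "(norm (u - P u))\<^sup>2"] by (simp add: X_def)
  moreover have "\<bar>\<mu>\<bar> * (norm (u - P u))\<^sup>2 \<le> \<bar>\<mu>\<bar> / \<delta> * X"
    using mult_left_mono[OF X, of "\<bar>\<mu>\<bar> / \<delta>"] dp by simp
  moreover have "B (P u) (P u) \<le> \<bar>lm\<bar> * (norm (P u))\<^sup>2"
    by (rule order_trans[OF B_P_le]) (auto intro: mult_right_mono)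
  moreover have "\<bar>lm\<bar> * (norm (P u))\<^sup>2 \<le> \<bar>lm\<bar> / \<delta> * Y"
    using mult_left_mono[OF Y, of "\<bar>lm\<bar> / \<delta>"] dp by simp
  moreover have "0 \<le> X" "0 \<le> Y"
    using X Y dp by (smt (verit) mult_nonneg_nonneg zero_le_power2)+
  moreover have "\<bar>lm\<bar> / \<delta> * X \<ge> 0" "\<bar>\<mu>\<bar> / \<delta> * Y \<ge> 0" using calculation dp by auto
  moreover have "\<kappa> * (X + Y) = X + Y + \<bar>\<mu>\<bar> / \<delta> * X + \<bar>lm\<bar> / \<delta> * Y + \<bar>lm\<bar> / \<delta> * X + \<bar>\<mu>\<bar> / \<delta> * Y"
    using dp by (simp add: \<kappa>_def field_simps)
  ultimately show "B u u \<le> \<kappa> * A u u" unfolding A B_split[OF u] by linarith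
  have "\<mu> * (norm (P u))\<^sup>2 \<le> \<bar>\<mu>\<bar> * (norm (P u))\<^sup>2"
    "- (\<mu> * (norm (u - P u))\<^sup>2) \<le> \<bar>\<mu>\<bar> * (norm (u - P u))\<^sup>2"
    using mult_right_mono[of \<mu> "\<bar>\<mu>\<bar>" "(norm (P u))\<^sup>2"] mult_right_mono[of "-\<mu>" "\<bar>\<mu>\<bar>" "(norm (u - P u))\<^sup>2"]
    by auto
  moreover have "0 \<le> B (P u) (P u)" by (simp add: nonneg)
  ultimately show "A u u \<le> B u u + \<bar>\<mu>\<bar> * (norm u)\<^sup>2"
    unfolding A B_split[OF u] norm_split[of u] by (simp add: X_def Y_def distrib_left)
qed

lemma \<kappa>_ge: "\<kappa> \<ge> 1" using \<delta>_pos by (simp add: \<kappa>_def)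

sublocale A: nonneg_form D A
proof
  show "subspace D" by (rule D)
  fix x y z c assume x: "x \<in> D" and z: "z \<in> D"
  show "A (c *\<^sub>R x) z = c * A x z" using x z by (simp add: A_def scale algebra_simps)
  show "A x z = A z x" using x z by (simp add: A_def B_R inner_R sym inner_commute)
  assume y: "y \<in> D"
  show "A (x + y) z = A x z + A y z" using x y z by (simp add: A_def add inner_add_left algebra_simps)
next
  fix x assume "x \<in> D"
  then show "0 \<le> A x x" using A_bounds(1)[of x] \<delta>_pos by (smt (verit) mult_nonneg_nonneg zero_le_power2)
qed

text \<open>The equation for B - \<mu> tested with \<open>R y\<close> is the equation for
  \<open>A\<close> tested with y, and \<open>R\<close> is an involution of \<open>D\<close>; the
  coercive form \<open>A\<close> falls under the Riesz theorem.\<close>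

lemma solve:
  "\<exists>u\<in>D. \<forall>y\<in>D. B u y - \<mu> * inner u y = inner h y"
proof -
  have "\<exists>u\<in>D. \<forall>y\<in>D. A u y = inner h (R y)"
  proof (rule A.riesz_representation[where M = "(norm h)\<^sup>2 / \<delta>"])
    fix x :: "nat \<Rightarrow> 'h" assume x: "\<And>n. x n \<in> D"
      and C: "\<And>e. e > 0 \<Longrightarrow> \<exists>N. \<forall>m\<ge>N. \<forall>n\<ge>N. A (x m - x n) (x m - x n) < e"
    have q_le: "B u u + (norm u)\<^sup>2 \<le> (\<kappa> + 1 / \<delta>) * A u u" if "u \<in> D" for u
    proof -
      have "(norm u)\<^sup>2 \<le> 1 / \<delta> * A u u" using A_bounds(1)[OF that] \<delta>_pos by (simp add: field_simps)
      then show ?thesis using A_bounds(2)[OF that] by (simp add: distrib_right)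
    qed
    have kp: "\<kappa> + 1 / \<delta> > 0" using \<kappa>_ge \<delta>_pos by (simp add: add_pos_pos)
    have "\<exists>l\<in>D. (\<lambda>n. B (x n - l) (x n - l) + (norm (x n - l))\<^sup>2) \<longlonglongrightarrow> 0"
    proof (rule complete[OF x])
      fix e :: real assume "e > 0"
      then obtain N where N: "\<And>m n. m \<ge> N \<Longrightarrow> n \<ge> N \<Longrightarrow> A (x m - x n) (x m - x n) < e / (\<kappa> + 1 / \<delta>)"
        using C[of "e / (\<kappa> + 1 / \<delta>)"] kp by fastforce
      have "B (x m - x n) (x m - x n) + (norm (x m - x n))\<^sup>2 < e" if "m \<ge> N" "n \<ge> N" for m n
      proof -
        have "(\<kappa> + 1 / \<delta>) * A (x m - x n) (x m - x n) < e"
          using N[OF that] kp by (simp add: pos_less_divide_eq mult.commute)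
        then show ?thesis using q_le[of "x m - x n"] x by simp
      qed
      then show "\<exists>N. \<forall>m\<ge>N. \<forall>n\<ge>N. B (x m - x n) (x m - x n) + (norm (x m - x n))\<^sup>2 < e" by blast
    qed
    then obtain l where l: "l \<in> D" "(\<lambda>n. B (x n - l) (x n - l) + (norm (x n - l))\<^sup>2) \<longlonglongrightarrow> 0" by blast
    have nn: "0 \<le> A (x n - l) (x n - l)" "0 \<le> B (x n - l) (x n - l)" for n
      using x l(1) by (auto intro!: A.nonneg nonneg)
    have bound: "A (x n - l) (x n - l) \<le> (1 + \<bar>\<mu>\<bar>) * (B (x n - l) (x n - l) + (norm (x n - l))\<^sup>2)" for n
    proof -
      have "A (x n - l) (x n - l) \<le> B (x n - l) (x n - l) + \<bar>\<mu>\<bar> * (norm (x n - l))\<^sup>2"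
        using x l(1) by (intro A_bounds(3)) auto
      moreover have "0 \<le> \<bar>\<mu>\<bar> * B (x n - l) (x n - l)" using nn by simp
      ultimately have "A (x n - l) (x n - l) \<le> B (x n - l) (x n - l) + \<bar>\<mu>\<bar> * (norm (x n - l))\<^sup>2
          + \<bar>\<mu>\<bar> * B (x n - l) (x n - l) + (norm (x n - l))\<^sup>2" by (smt (verit) zero_le_power2)
      then show ?thesis by (simp add: algebra_simps)
    qed
    have lim: "(\<lambda>n. (1 + \<bar>\<mu>\<bar>) * (B (x n - l) (x n - l) + (norm (x n - l))\<^sup>2)) \<longlonglongrightarrow> 0"
      using tendsto_mult_left[OF l(2), of "1 + \<bar>\<mu>\<bar>"] by simp
    have "(\<lambda>n. A (x n - l) (x n - l)) \<longlonglongrightarrow> 0"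
      by (rule tendsto_sandwich[OF always_eventually[OF allI[OF nn(1)]]
            always_eventually[OF allI[OF bound]] tendsto_const lim])
    then show "\<exists>l\<in>D. (\<lambda>n. A (x n - l) (x n - l)) \<longlonglongrightarrow> 0" using l(1) by blast
  next
    fix x assume x: "x \<in> D"
    have "(inner h (R x))\<^sup>2 \<le> (norm h)\<^sup>2 * (norm x)\<^sup>2"
      using Cauchy_Schwarz_ineq[of h "R x"] by (simp flip: power2_norm_eq_inner)
    also have "\<dots> = (norm h)\<^sup>2 / \<delta> * (\<delta> * (norm x)\<^sup>2)" using \<delta>_pos by simp
    also have "\<dots> \<le> (norm h)\<^sup>2 / \<delta> * A x x"
      using \<delta>_pos by (intro mult_left_mono A_bounds(1) x) auto
    finally show "(inner h (R x))\<^sup>2 \<le> (norm h)\<^sup>2 / \<delta> * A x x" .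
  qed (use \<delta>_pos in \<open>auto simp: R_def P_add P_scale inner_add_right inner_diff_right algebra_simps\<close>)
  then obtain u where u: "u \<in> D" "\<And>y. y \<in> D \<Longrightarrow> A u y = inner h (R y)" by blast
  have "B u y - \<mu> * inner u y = inner h y" if "y \<in> D" for y
    using u(2)[of "R y"] that by (simp add: A_def)
  then show ?thesis using u(1) by blast
qed

text \<open>Test with \<open>R u\<close>. Applied to differences, the first bound gives Lipschitz
  continuity of the solution operator; the two bounds together give its compactness.\<close>

lemma solution_bound:
  assumes u: "u \<in> D" "\<And>y. y \<in> D \<Longrightarrow> B u y - \<mu> * inner u y = inner h y"
  shows "norm u \<le> norm h / \<delta>" "B u u \<le> \<kappa> * ((norm h)\<^sup>2 / \<delta>)"
proof -
  have A: "A u u = inner h (R u)" using u(2)[of "R u"] u(1) by (simp add: A_def)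
  have A2: "A u u \<le> norm h * norm u" unfolding A using norm_cauchy_schwarz[of h "R u"] by simp
  have "\<delta> * (norm u)\<^sup>2 \<le> norm h * norm u" using A2 A_bounds(1)[OF u(1)] by simp
  then show n: "norm u \<le> norm h / \<delta>" using \<delta>_pos
    by (cases "norm u = 0") (auto simp: power2_eq_square field_simps)
  have "A u u \<le> norm h * (norm h / \<delta>)" using A2 mult_left_mono[OF n, of "norm h"] by simp
  then have "\<kappa> * A u u \<le> \<kappa> * ((norm h)\<^sup>2 / \<delta>)" using \<kappa>_ge by (intro mult_left_mono) (auto simp: power2_eq_square)
  then show "B u u \<le> \<kappa> * ((norm h)\<^sup>2 / \<delta>)" using A_bounds(2)[OF u(1)] by simp
qed

text \<open>Testing with the reflection of u turns the upper bound for B on the span of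
  \<open>G\<close> into a lower one, so that both ends of the gap contribute in the same
  direction.\<close>

lemma energy_inequality:
  assumes u: "u \<in> D" "\<And>y. y \<in> D \<Longrightarrow> B u y = inner g y"
  shows "lp * (norm (u - P u))\<^sup>2 - lm * (norm (P u))\<^sup>2 \<le> inner g ((u - P u) - P u)"
proof -
  have "inner g ((u - P u) - P u) = B u (R u)" using u by (simp add: R_def)
  also have "\<dots> = B (u - P u) (u - P u) - B (P u) (P u)" using u(1) by (simp add: B_R)
  finally show ?thesis using B_perp_ge[OF u(1)] B_P_le[of u] by simp
qed

text \<open>The right-hand side in \<open>apriori\<close> is what u = \<tau> T u becomes for T u = S
  (N u - \<mu> u), where \<open>S\<close> solves the linear problem at \<mu>.\<close>

lemma nonlinear_solution:
  fixes N :: "'h \<Rightarrow> 'h"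
  assumes cont: "continuous_on UNIV N" and growth: "\<And>u. norm (N u) \<le> a0 + b0 * norm u" "b0 \<ge> 0"
    and apriori: "\<And>u \<tau>. u \<in> D \<Longrightarrow> 0 \<le> \<tau> \<Longrightarrow> \<tau> \<le> 1 \<Longrightarrow>
       (\<And>y. y \<in> D \<Longrightarrow> B u y = inner ((1 - \<tau>) *\<^sub>R \<mu> *\<^sub>R u + \<tau> *\<^sub>R N u) y) \<Longrightarrow> norm u < r"
    and r: "r > 0"
  shows "\<exists>u\<in>D. \<forall>y\<in>D. B u y = inner (N u) y"
proof -
  obtain S where S: "\<And>h. S h \<in> D" "\<And>h y. y \<in> D \<Longrightarrow> B (S h) y - \<mu> * inner (S h) y = inner h y"
    using solve by metis
  have S_dist: "norm (S h - S h') \<le> norm (h - h') / \<delta>" for h h'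
    by (rule solution_bound(1)) (use S in \<open>auto simp: diff inner_diff_left algebra_simps\<close>)
  have S0: "norm (S h) \<le> norm h / \<delta>" "B (S h) (S h) \<le> \<kappa> * ((norm h)\<^sup>2 / \<delta>)" for h
    using solution_bound[OF S(1) S(2)] by blast+
  have cS: "continuous_on UNIV S"
  proof (rule continuous_on_iff[THEN iffD2], safe)
    fix x e :: real and h :: 'h assume "e > 0"
    have "dist (S h') (S h) < e" if "dist h' h < e * \<delta>" for h'
    proof -
      have "norm (h' - h) / \<delta> < e" using that \<delta>_pos by (simp add: dist_norm field_simps)
      then show ?thesis using S_dist[of h' h] by (simp add: dist_norm)
    qed
    then show "\<exists>d>0. \<forall>h'\<in>UNIV. dist h' h < d \<longrightarrow> dist (S h') (S h) < e"
      using \<delta>_pos \<open>e > 0\<close> by (intro exI[of _ "e * \<delta>"]) auto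
  qed
  define T where "T u = S (N u - \<mu> *\<^sub>R u)" for u
  have cT: "continuous_on UNIV T" unfolding T_def
    by (intro continuous_on_compose2[OF cS] continuous_intros cont) auto
  have "compact (closure (T ` cball 0 r))"
  proof (rule compact_closure_sequential)
    fix x :: "nat \<Rightarrow> 'h" assume x: "\<And>n. x n \<in> T ` cball 0 r"
    define M where "M = a0 + b0 * r + \<bar>\<mu>\<bar> * r"
    have "B (x n) (x n) + (norm (x n))\<^sup>2 \<le> \<kappa> * (M\<^sup>2 / \<delta>) + (M / \<delta>)\<^sup>2" for n
    proof -
      obtain u where u: "norm u \<le> r" "x n = T u" using x[of n] by auto
      define h where "h = N u - \<mu> *\<^sub>R u"
      have "norm h \<le> norm (N u) + \<bar>\<mu>\<bar> * norm u" unfolding h_def by (metis norm_scaleR norm_triangle_ineq4)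
      also have "\<dots> \<le> M"
        using growth(1)[of u] mult_left_mono[OF u(1) growth(2)] mult_left_mono[OF u(1), of "\<bar>\<mu>\<bar>"] by (simp add: M_def)
      finally have h: "norm h \<le> M" .
      then have "(norm h)\<^sup>2 \<le> M\<^sup>2" by (intro power_mono) auto
      then have "\<kappa> * ((norm h)\<^sup>2 / \<delta>) \<le> \<kappa> * (M\<^sup>2 / \<delta>)"
        using \<kappa>_ge \<delta>_pos by (intro mult_left_mono divide_right_mono) auto
      moreover have "(norm (S h))\<^sup>2 \<le> (M / \<delta>)\<^sup>2"
        using S0(1)[of h] h \<delta>_pos by (intro power_mono order_trans[OF S0(1)] divide_right_mono) auto
      ultimately show ?thesis using S0(2)[of h] u(2) by (simp add: T_def h_def)
    qed
    moreover have "x n \<in> D" for n using x[of n] S(1) by (auto simp: T_def)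
    ultimately show "\<exists>l r. strict_mono r \<and> (x \<circ> r) \<longlonglongrightarrow> l" by (rule compact[rotated])
  qed
  then have "\<exists>u. T u = u"
  proof (rule schaefer_fixed_point[OF cT _ r])
    fix u \<tau> assume \<tau>: "(0::real) \<le> \<tau>" "\<tau> \<le> 1" and u: "u = \<tau> *\<^sub>R T u"
    have TD: "T u \<in> D" by (simp add: T_def S)
    have uD: "u \<in> D" using TD u by (metis D_simps(4))
    show "norm u < r"
    proof (rule apriori[OF uD \<tau>])
      fix y assume y: "y \<in> D"
      have "B u y = \<tau> * B (T u) y" using u TD y by (metis scale)
      moreover have "B (T u) y = \<mu> * inner (T u) y + inner (N u - \<mu> *\<^sub>R u) y"
        using S(2)[OF y, of "N u - \<mu> *\<^sub>R u"] by (simp add: T_def)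
      moreover have "inner u y = \<tau> * inner (T u) y" using u by (metis inner_scaleR_left)
      ultimately show "B u y = inner ((1 - \<tau>) *\<^sub>R \<mu> *\<^sub>R u + \<tau> *\<^sub>R N u) y"
        by (simp add: inner_add_left inner_diff_left algebra_simps)
    qed
  qed
  then obtain u where u: "T u = u" by blast
  have "u \<in> D" using S(1) u by (metis T_def)
  moreover have "B u y = inner (N u) y" if "y \<in> D" for y
    using S(2)[OF that, of "N u - \<mu> *\<^sub>R u"] u by (simp add: T_def inner_diff_left)
  ultimately show ?thesis by blast
qed

end

section \<open>The Hilbert space of square integrable functions\<close>

text \<open>The Riesz-Fischer argument, arranged so that it produces an integrable bound for all the
  squares along with the pointwise limit.\<close>

lemma fast_L2_Cauchy_convergent:
  fixes f :: "nat \<Rightarrow> 'a \<Rightarrow> real"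
  assumes [measurable]: "\<And>n. f n \<in> borel_measurable M"
    and int: "\<And>n. integrable M (\<lambda>x. (f n x)\<^sup>2)"
    and fast: "\<And>k. (\<integral>x. (f (Suc k) x - f k x)\<^sup>2 \<partial>M) \<le> (1/8)^k"
  obtains F G where "F \<in> borel_measurable M" "integrable M G"
    "AE x in M. (\<forall>n. (f n x)\<^sup>2 \<le> G x) \<and> (\<lambda>n. f n x) \<longlonglongrightarrow> F x"
proof -
  define d where "d k x = f (Suc k) x - f k x" for k x
  have [measurable]: "d k \<in> borel_measurable M" for k unfolding d_def by measurable
  have d_int: "integrable M (\<lambda>x. (d k x)\<^sup>2)" for k
  proof (rule Bochner_Integration.integrable_bound)
    show "integrable M (\<lambda>x. 2 * (f (Suc k) x)\<^sup>2 + 2 * (f k x)\<^sup>2)"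
      by (intro Bochner_Integration.integrable_add integrable_mult_right int)
    show "AE x in M. norm ((d k x)\<^sup>2) \<le> norm (2 * (f (Suc k) x)\<^sup>2 + 2 * (f k x)\<^sup>2)"
    proof (intro AE_I2)
      fix x
      have "2 * (f (Suc k) x)\<^sup>2 + 2 * (f k x)\<^sup>2 - (d k x)\<^sup>2 = (f (Suc k) x + f k x)\<^sup>2"
        by (simp add: d_def power2_eq_square algebra_simps)
      then show "norm ((d k x)\<^sup>2) \<le> norm (2 * (f (Suc k) x)\<^sup>2 + 2 * (f k x)\<^sup>2)"
        by (smt (verit) real_norm_def zero_le_power2)
    qed
  qed simp
  \<comment> \<open>The weight 4^k is small enough for the integrals to stay below 2^(-k), and large
    enough for Cauchy-Schwarz: the reciprocal weights sum to 4/3.\<close>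
  define e where "e k x = 4^k * (d k x)\<^sup>2" for k x
  have [measurable]: "e k \<in> borel_measurable M" for k unfolding e_def by measurable
  have e_int: "integrable M (e k)" for k unfolding e_def by (intro integrable_mult_right d_int)
  have e0: "e k x \<ge> 0" for k x by (simp add: e_def)
  have e_le: "(\<integral>x. e k x \<partial>M) \<le> (1/2)^k" for k
  proof -
    have "(\<integral>x. e k x \<partial>M) \<le> 4^k * (1/8)^k"
      unfolding e_def using fast[of k] by (simp add: d_def)
    then show ?thesis by (simp flip: power_mult_distrib)
  qed
  have "(\<integral>\<^sup>+x. (\<Sum>k. ennreal (e k x)) \<partial>M) = (\<Sum>k. \<integral>\<^sup>+x. ennreal (e k x) \<partial>M)"
    by (rule nn_integral_suminf) measurable
  also have "\<dots> = (\<Sum>k. ennreal (\<integral>x. e k x \<partial>M))"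
    using e_int e0 by (simp add: nn_integral_eq_integral)
  also have "\<dots> \<le> (\<Sum>k. ennreal ((1/2)^k))"
    using e_le by (intro suminf_le ennreal_leI) auto
  also have "\<dots> = ennreal (\<Sum>k. (1/2)^k)" by (intro suminf_ennreal2) (auto intro: summable_geometric)
  finally have fin: "(\<integral>\<^sup>+x. (\<Sum>k. ennreal (e k x)) \<partial>M) \<noteq> \<infinity>" by (auto simp: top_unique)
  have "AE x in M. (\<Sum>k. ennreal (e k x)) \<noteq> \<infinity>"
    using fin by (intro nn_integral_PInf_AE) auto
  then have AE_sum: "AE x in M. summable (\<lambda>k. e k x)"
  proof eventually_elim
    case (elim x)
    then show ?case using e0 by (intro summable_suminf_not_top) auto
  qed
  define H where "H x = (\<Sum>k. e k x)" for x
  have H_int: "integrable M H" unfolding H_def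
  proof (rule integrable_suminf[OF e_int])
    show "AE x in M. summable (\<lambda>i. norm (e i x))" using AE_sum e0 by simp
    show "summable (\<lambda>i. \<integral>x. norm (e i x) \<partial>M)"
      by (rule summable_comparison_test'[OF summable_geometric[of "1/2"]]) (use e_le e0 in auto)
  qed
  \<comment> \<open>f n is f 0 plus a sum of the \<open>d k\<close>, whose square is at most 4/3 H;
    twice 4/3 is rounded up to 3.\<close>
  define G where "G x = 2 * (f 0 x)\<^sup>2 + 3 * H x" for x
  define F where "F x = lim (\<lambda>n. f n x)" for x
  show thesis
  proof (rule that[of F G])
    show "F \<in> borel_measurable M" unfolding F_def by measurable
    show "integrable M G" unfolding G_def by (intro Bochner_Integration.integrable_add integrable_mult_right int H_int)
    show "AE x in M. (\<forall>n. (f n x)\<^sup>2 \<le> G x) \<and> (\<lambda>n. f n x) \<longlonglongrightarrow> F x"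
      using AE_sum
    proof eventually_elim
      case (elim x)
      have S: "(\<Sum>k<n. \<bar>d k x\<bar>)\<^sup>2 \<le> 4/3 * H x" for n
      proof -
        have sq: "(c^k)\<^sup>2 = (c\<^sup>2)^k" for c :: real and k by (metis power_mult mult.commute)
        have "(\<Sum>k<n. \<bar>d k x\<bar>)\<^sup>2 = (\<Sum>k<n. (1/2)^k * (2^k * \<bar>d k x\<bar>))\<^sup>2"
          by (simp add: power_divide)
        also have "\<dots> \<le> (\<Sum>k<n. ((1/2)^k)\<^sup>2) * (\<Sum>k<n. (2^k * \<bar>d k x\<bar>)\<^sup>2)"
          by (rule Cauchy_Schwarz_ineq_sum)
        also have "(\<Sum>k<n. (2^k * \<bar>d k x\<bar>)\<^sup>2) = (\<Sum>k<n. e k x)"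
          by (intro sum.cong refl) (simp add: e_def power_mult_distrib sq)
        also have "(\<Sum>k<n. ((1/2)^k)\<^sup>2) = (\<Sum>k<n. (1/4::real)^k)"
          by (intro sum.cong refl) (simp add: sq power_divide)
        also have "(\<Sum>k<n. (1/4::real)^k) * (\<Sum>k<n. e k x) \<le> 4/3 * H x"
        proof (rule mult_mono)
          have "(\<Sum>k<n. (1/4::real)^k) \<le> (\<Sum>k. (1/4)^k)"
            by (intro sum_le_suminf summable_geometric) auto
          then show "(\<Sum>k<n. (1/4::real)^k) \<le> 4/3" by (simp add: suminf_geometric)
          show "(\<Sum>k<n. e k x) \<le> H x" unfolding H_def by (intro sum_le_suminf elim) (use e0 in auto)
        qed (auto intro: sum_nonneg e0)
        finally show ?thesis .
      qed
      have tele: "f n x = f 0 x + (\<Sum>k<n. d k x)" for n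
        by (induction n) (auto simp: d_def)
      have H0: "0 \<le> H x" using S[of 0] by simp
      have "(f n x)\<^sup>2 \<le> G x" for n
      proof -
        have "\<bar>\<Sum>k<n. d k x\<bar> \<le> (\<Sum>k<n. \<bar>d k x\<bar>)" by (rule sum_abs)
        then have "(\<Sum>k<n. d k x)\<^sup>2 \<le> 4/3 * H x"
          using S[of n] power_mono[of "\<bar>\<Sum>k<n. d k x\<bar>" "\<Sum>k<n. \<bar>d k x\<bar>" 2] by simp
        moreover have "(f n x)\<^sup>2 \<le> 2 * (f 0 x)\<^sup>2 + 2 * (\<Sum>k<n. d k x)\<^sup>2"
          unfolding tele[of n] using zero_le_power2[of "f 0 x - (\<Sum>k<n. d k x)"]
          by (simp add: power2_eq_square algebra_simps)
        ultimately show ?thesis using H0 unfolding G_def by linarith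
      qed
      moreover have "convergent (\<lambda>n. f n x)"
      proof -
        have le_sq: "t \<le> t\<^sup>2 + 1" for t :: real
          using zero_le_power2[of "t - 1/2"] by (simp add: power2_eq_square algebra_simps)
        have "(\<Sum>k<n. \<bar>d k x\<bar>) \<le> 4/3 * H x + 1" for n
          using S[of n] le_sq[of "\<Sum>k<n. \<bar>d k x\<bar>"] by linarith
        then have "summable (\<lambda>k. \<bar>d k x\<bar>)"
          by (intro bounded_imp_summable[where B = "4/3 * H x + 1"]) (simp_all only: lessThan_Suc_atMost[symmetric] abs_ge_zero)
        then have "summable (\<lambda>k. d k x)" by (rule summable_rabs_cancel)
        then have "(\<lambda>n. f 0 x + (\<Sum>k<n. d k x)) \<longlonglongrightarrow> f 0 x + (\<Sum>k. d k x)"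
          by (intro tendsto_intros summable_LIMSEQ)
        then show ?thesis unfolding tele[symmetric] by (rule convergentI)
      qed
      ultimately show ?case by (simp add: F_def convergent_LIMSEQ_iff)
    qed
  qed
qed

definition sq_int :: "('a::euclidean_space \<Rightarrow> real) set" where
  "sq_int = {f \<in> borel_measurable lebesgue. integrable lebesgue (\<lambda>x. (f x)\<^sup>2)}"

lemma sq_int_measurable [measurable_dest]: "f \<in> sq_int \<Longrightarrow> f \<in> borel_measurable lebesgue"
  by (simp add: sq_int_def)

lemma sq_int_bound:
  assumes "f \<in> borel_measurable lebesgue" "integrable lebesgue g" "AE x in lebesgue. (f x)\<^sup>2 \<le> g x"
  shows "f \<in> sq_int"
  unfolding sq_int_def
  using assms by (auto intro!: Bochner_Integration.integrable_bound[OF assms(2)] elim!: eventually_mono)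

lemma sq_int_mult_integrable:
  assumes "f \<in> sq_int" "g \<in> sq_int"
  shows "integrable lebesgue (\<lambda>x. f x * g x)"
proof (rule Bochner_Integration.integrable_bound)
  show "integrable lebesgue (\<lambda>x. (f x)\<^sup>2 + (g x)\<^sup>2)"
    using assms by (intro Bochner_Integration.integrable_add) (auto simp: sq_int_def)
  have "\<bar>f x * g x\<bar> \<le> (f x)\<^sup>2 + (g x)\<^sup>2" for x
  proof -
    have "0 \<le> (\<bar>f x\<bar> - \<bar>g x\<bar>)\<^sup>2" by simp
    then have "2 * \<bar>f x * g x\<bar> \<le> (f x)\<^sup>2 + (g x)\<^sup>2" by (simp add: power2_diff abs_mult)
    moreover have "0 \<le> \<bar>f x * g x\<bar>" by simp
    ultimately show ?thesis by linarith
  qed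
  then show "AE x in lebesgue. norm (f x * g x) \<le> norm ((f x)\<^sup>2 + (g x)\<^sup>2)" by simp
  show "(\<lambda>x. f x * g x) \<in> borel_measurable lebesgue" using assms by measurable
qed

lemma sq_int_add: 
  assumes "f \<in> sq_int" "g \<in> sq_int" shows "(\<lambda>x. f x + g x) \<in> sq_int"
proof (rule sq_int_bound)
  show "(\<lambda>x. f x + g x) \<in> borel_measurable lebesgue" using assms by measurable
  show "integrable lebesgue (\<lambda>x. 2 * (f x)\<^sup>2 + 2 * (g x)\<^sup>2)"
    using assms by (intro Bochner_Integration.integrable_add integrable_mult_right) (auto simp: sq_int_def)
  have "(f x + g x)\<^sup>2 \<le> 2 * (f x)\<^sup>2 + 2 * (g x)\<^sup>2" for x
    using zero_le_power2[of "f x - g x"] by (simp add: power2_eq_square algebra_simps)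
  then show "AE x in lebesgue. (f x + g x)\<^sup>2 \<le> 2 * (f x)\<^sup>2 + 2 * (g x)\<^sup>2" by simp
qed

lemma sq_int_scale: "f \<in> sq_int \<Longrightarrow> (\<lambda>x. c * f x) \<in> sq_int"
  by (auto simp: sq_int_def power_mult_distrib)

lemma sq_int_diff: "f \<in> sq_int \<Longrightarrow> g \<in> sq_int \<Longrightarrow> (\<lambda>x. f x - g x) \<in> sq_int"
  using sq_int_add[of f "\<lambda>x. -1 * g x"] sq_int_scale[of g "-1"] by simp

\<comment> \<open>Equality almost everywhere becomes equality, as the Hilbert space lemmas above
  demand. The base type is an arbitrary Euclidean space because the construction is applied to
  functions of points and to functions of pairs of points.\<close>
quotient_type (overloaded) 'a l2 = "'a::euclidean_space \<Rightarrow> real" /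
  partial: "\<lambda>f g. f \<in> sq_int \<and> g \<in> sq_int \<and> (AE x in lebesgue. f x = g x)"
proof (rule part_equivpI)
  show "\<exists>f::'a \<Rightarrow> real. f \<in> sq_int \<and> f \<in> sq_int \<and> (AE x in lebesgue. f x = f x)"
    by (intro exI[of _ "\<lambda>_. 0"]) (auto simp: sq_int_def)
qed (auto intro!: sympI transpI elim: eventually_elim2)

instantiation l2 :: (euclidean_space) real_vector
begin

lift_definition zero_l2 :: "'a l2" is "\<lambda>_. 0" by (simp add: sq_int_def)

lift_definition plus_l2 :: "'a l2 \<Rightarrow> 'a l2 \<Rightarrow> 'a l2" is "\<lambda>f g x. f x + g x"
  by (auto intro: sq_int_add elim: eventually_elim2)

lift_definition minus_l2 :: "'a l2 \<Rightarrow> 'a l2 \<Rightarrow> 'a l2" is "\<lambda>f g x. f x - g x"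
  by (auto intro: sq_int_diff elim: eventually_elim2)

lift_definition uminus_l2 :: "'a l2 \<Rightarrow> 'a l2" is "\<lambda>f x. - f x"
  using sq_int_scale[of _ "-1"] by (auto elim: eventually_mono)

lift_definition scaleR_l2 :: "real \<Rightarrow> 'a l2 \<Rightarrow> 'a l2" is "\<lambda>c f x. c * f x"
  by (auto intro: sq_int_scale elim: eventually_mono)

instance
proof
  fix u v w :: "'a l2" and c e :: real
  show "u + v + w = u + (v + w)" by transfer (auto simp: add.assoc intro!: sq_int_add)
  show "u + v = v + u" by transfer (auto simp: add.commute intro!: sq_int_add)
  show "0 + u = u" by transfer auto
  show "- u + u = 0" by transfer (auto simp: sq_int_def)
  show "u - v = u + - v" by transfer (auto intro: sq_int_diff)
  show "c *\<^sub>R (u + v) = c *\<^sub>R u + c *\<^sub>R v"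
    by transfer (auto simp: distrib_left intro!: sq_int_add sq_int_scale)
  show "(c + e) *\<^sub>R u = c *\<^sub>R u + e *\<^sub>R u"
    by transfer (auto simp: distrib_right intro!: sq_int_add sq_int_scale)
  show "c *\<^sub>R e *\<^sub>R u = (c * e) *\<^sub>R u"
    by transfer (auto simp: mult.assoc intro!: sq_int_scale)
  show "1 *\<^sub>R u = u" by transfer auto
qed

end

instantiation l2 :: (euclidean_space) real_inner
begin

lift_definition inner_l2 :: "'a l2 \<Rightarrow> 'a l2 \<Rightarrow> real" is "\<lambda>f g. \<integral>x. f x * g x \<partial>lebesgue"
  by (intro integral_cong_AE) (auto elim: eventually_elim2 simp: sq_int_def)

definition norm_l2 :: "'a l2 \<Rightarrow> real" where "norm_l2 u = sqrt (inner u u)"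

definition sgn_l2 :: "'a l2 \<Rightarrow> 'a l2" where "sgn_l2 u = inverse (norm u) *\<^sub>R u"

definition dist_l2 :: "'a l2 \<Rightarrow> 'a l2 \<Rightarrow> real" where "dist_l2 u v = norm (u - v)"

definition uniformity_l2 :: "('a l2 \<times> 'a l2) filter" where
  "uniformity_l2 = (INF e\<in>{0<..}. principal {(u, v). dist u v < e})"

definition open_l2 :: "'a l2 set \<Rightarrow> bool" where
  "open_l2 U = (\<forall>x\<in>U. eventually (\<lambda>(x', y). x' = x \<longrightarrow> y \<in> U) uniformity)"

instance
proof
  fix u v w :: "'a l2" and c e :: real
  show "dist u v = norm (u - v)" by (rule dist_l2_def)
  show "sgn u = u /\<^sub>R norm u" by (simp add: sgn_l2_def)
  show "uniformity = (INF e\<in>{0<..}. principal {(x, y :: 'a l2). dist x y < e})" by (rule uniformity_l2_def)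
  show "norm u = sqrt (inner u u)" by (rule norm_l2_def)
  show "inner u v = inner v u" by transfer (simp add: mult.commute)
  show "inner (u + v) w = inner u w + inner v w"
    by transfer (simp add: distrib_right sq_int_mult_integrable)
  show "inner (c *\<^sub>R u) v = c * inner u v"
    by transfer (simp add: mult.assoc)
  show "0 \<le> inner u u" by transfer simp
  show "inner u u = 0 \<longleftrightarrow> u = 0"
  proof (transfer, simp)
    fix f :: "'a \<Rightarrow> real" assume f: "f \<in> sq_int"
    have "(\<integral>x. f x * f x \<partial>lebesgue) = 0 \<longleftrightarrow> (AE x in lebesgue. f x * f x = 0)"
      by (rule integral_nonneg_eq_0_iff_AE) (auto intro!: sq_int_mult_integrable f)
    then show "((\<integral>x. f x * f x \<partial>lebesgue) = 0) = ((\<lambda>_. 0) \<in> (sq_int :: ('a \<Rightarrow> real) set) \<and> (AE x in lebesgue. f x = 0))"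
      by (simp add: sq_int_def)
  qed
next
  fix U :: "'a l2 set"
  show "open U = (\<forall>x\<in>U. \<forall>\<^sub>F (x', y) in uniformity. x' = x \<longrightarrow> y \<in> U)" by (rule open_l2_def)
qed

end


section \<open>Classes, representatives, and pointwise convergence along subsequences\<close>

lift_definition cls :: "('a::euclidean_space \<Rightarrow> real) \<Rightarrow> 'a l2" is
  "\<lambda>f. if f \<in> sq_int then f else (\<lambda>_. 0)" by (simp add: sq_int_def)

lemma cls_eq_iff: "f \<in> sq_int \<Longrightarrow> g \<in> sq_int \<Longrightarrow> cls f = cls g \<longleftrightarrow> (AE x in lebesgue. f x = g x)"
  by transfer simp

text \<open>The representative is chosen Borel so that Fubini's theorem for \<open>lborel\<close>
  can be applied to expressions in it.\<close>

definition rep :: "'a::euclidean_space l2 \<Rightarrow> 'a \<Rightarrow> real" where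
  "rep u = (SOME f. f \<in> borel_measurable borel \<and> f \<in> sq_int \<and> cls f = u)"

lemma rep_props: "rep u \<in> borel_measurable borel \<and> rep u \<in> sq_int \<and> cls (rep u) = u"
proof -
  have "\<exists>f. f \<in> sq_int \<and> cls f = u" by transfer auto
  then obtain f where f: "f \<in> sq_int" "cls f = u" by blast
  then obtain g where g: "g \<in> borel_measurable lborel" "AE x in lborel. f x = g x"
    using completion_ex_borel_measurable_real[of f lborel] by (auto simp: sq_int_def)
  have ae: "AE x in lebesgue. f x = g x" using g(2) by (rule AE_completion)
  have gm: "g \<in> borel_measurable lebesgue" using g(1) by (simp add: measurable_completion)
  have "g \<in> sq_int"
    by (rule sq_int_bound[where g = "\<lambda>x. (f x)\<^sup>2"]) (use f ae gm in \<open>auto simp: sq_int_def elim!: eventually_mono\<close>)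
  moreover have "cls g = u" using cls_eq_iff[OF f(1) \<open>g \<in> sq_int\<close>] ae f(2) by simp
  ultimately have "\<exists>f. f \<in> borel_measurable borel \<and> f \<in> sq_int \<and> cls f = u" using g(1) by auto
  then show ?thesis unfolding rep_def by (rule someI_ex)
qed

lemma rep_borel [measurable]: "rep u \<in> borel_measurable borel"
  and rep_sq_int [simp]: "rep u \<in> sq_int"
  and cls_rep [simp]: "cls (rep u) = u"
  using rep_props by blast+

lemma rep_cls: "f \<in> sq_int \<Longrightarrow> AE x in lebesgue. rep (cls f) x = f x"
  using cls_eq_iff[of "rep (cls f)" f] by simp

lemma cls_add: "f \<in> sq_int \<Longrightarrow> g \<in> sq_int \<Longrightarrow> cls (\<lambda>x. f x + g x) = cls f + cls g"
  by transfer (simp add: sq_int_add)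

lemma cls_diff: "f \<in> sq_int \<Longrightarrow> g \<in> sq_int \<Longrightarrow> cls (\<lambda>x. f x - g x) = cls f - cls g"
  by transfer (simp add: sq_int_diff)

lemma cls_scale: "f \<in> sq_int \<Longrightarrow> cls (\<lambda>x. c * f x) = c *\<^sub>R cls f"
  by transfer (simp add: sq_int_scale)

lemma inner_cls: "f \<in> sq_int \<Longrightarrow> g \<in> sq_int \<Longrightarrow> inner (cls f) (cls g) = (\<integral>x. f x * g x \<partial>lebesgue)"
  by transfer simp

lemma norm_cls: "f \<in> sq_int \<Longrightarrow> (norm (cls f))\<^sup>2 = (\<integral>x. (f x)\<^sup>2 \<partial>lebesgue)"
  unfolding power2_norm_eq_inner by (simp add: inner_cls power2_eq_square)

lemma norm_rep: "(norm u)\<^sup>2 = (\<integral>x. (rep u x)\<^sup>2 \<partial>lebesgue)"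
  using norm_cls[of "rep u"] by simp

lemma rep_add: "AE x in lebesgue. rep (u + v) x = rep u x + rep v x"
  using rep_cls[of "\<lambda>x. rep u x + rep v x"] by (simp add: sq_int_add cls_add)

lemma rep_scale: "AE x in lebesgue. rep (c *\<^sub>R u) x = c * rep u x"
  using rep_cls[of "\<lambda>x. c * rep u x"] by (simp add: sq_int_scale cls_scale)

lemma norm_diff_rep: "(norm (u - v))\<^sup>2 = (\<integral>x. (rep u x - rep v x)\<^sup>2 \<partial>lebesgue)"
  using norm_cls[of "\<lambda>x. rep u x - rep v x"] by (simp add: sq_int_diff cls_diff)

lemma Cauchy_fast_subseq:
  fixes X :: "nat \<Rightarrow> 'a::metric_space"
  assumes "Cauchy X" "\<And>k. \<epsilon> k > 0"
  obtains r where "strict_mono (r :: nat \<Rightarrow> nat)" "\<And>k. dist (X (r (Suc k))) (X (r k)) < \<epsilon> k"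
proof -
  have "\<exists>N. \<forall>m\<ge>N. \<forall>n\<ge>N. dist (X m) (X n) < \<epsilon> k" for k
    using assms unfolding Cauchy_def by blast
  then obtain N where N: "\<And>k m n. m \<ge> N k \<Longrightarrow> n \<ge> N k \<Longrightarrow> dist (X m) (X n) < \<epsilon> k" by metis
  define r where "r = rec_nat (N 0) (\<lambda>k p. max (Suc p) (N (Suc k)))"
  have r_Suc: "r (Suc k) = max (Suc (r k)) (N (Suc k))" and "r 0 = N 0" for k by (simp_all add: r_def)
  then have N_le: "N k \<le> r k" for k by (cases k) auto
  have mono: "r k < r (Suc k)" for k by (simp add: r_Suc)
  show thesis
  proof (rule that)
    show "strict_mono r" using mono by (simp add: strict_mono_Suc_iff)
    show "dist (X (r (Suc k))) (X (r k)) < \<epsilon> k" for k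
      using N_le[of k] mono[of k] by (intro N) auto
  qed
qed

text \<open>The partial converse of dominated convergence. It translates norm convergence into
  pointwise convergence below a majorant, the form in which superposition operators and Fatou's
  lemma can use it.\<close>

lemma l2_Cauchy_subseq:
  fixes X :: "nat \<Rightarrow> 'a::euclidean_space l2"
  assumes "Cauchy X"
  obtains r l G where "strict_mono r" "(X \<circ> r) \<longlonglongrightarrow> l" "integrable lebesgue G"
    "AE x in lebesgue. (\<forall>n. (rep (X (r n)) x)\<^sup>2 \<le> G x) \<and> (\<lambda>n. rep (X (r n)) x) \<longlonglongrightarrow> rep l x"
proof -
  obtain r where r: "strict_mono (r :: nat \<Rightarrow> nat)" "\<And>k. dist (X (r (Suc k))) (X (r k)) < sqrt ((1/8)^k)"
    using Cauchy_fast_subseq[OF assms, of "\<lambda>k. sqrt ((1/8)^k)"] by auto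
  have fast: "(\<integral>x. (rep (X (r (Suc k))) x - rep (X (r k)) x)\<^sup>2 \<partial>lebesgue) \<le> (1/8)^k" for k
  proof -
    have "(norm (X (r (Suc k)) - X (r k)))\<^sup>2 \<le> (sqrt ((1/8)^k))\<^sup>2"
      using r(2)[of k] by (intro power_mono) (auto simp: dist_norm)
    then show ?thesis by (simp add: norm_diff_rep)
  qed
  have [measurable]: "rep u \<in> borel_measurable lebesgue" for u :: "'a l2"
    using rep_sq_int[of u] by (simp add: sq_int_def)
  obtain F G where F: "F \<in> borel_measurable lebesgue" and G: "integrable lebesgue G"
    and ae: "AE x in lebesgue. (\<forall>n. (rep (X (r n)) x)\<^sup>2 \<le> G x) \<and> (\<lambda>n. rep (X (r n)) x) \<longlonglongrightarrow> F x"
    by (rule fast_L2_Cauchy_convergent[of "\<lambda>n. rep (X (r n))" lebesgue])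
       (use fast rep_sq_int in \<open>auto simp: sq_int_def\<close>)
  have FG: "AE x in lebesgue. (F x)\<^sup>2 \<le> G x"
    using ae
  proof eventually_elim
    case (elim x)
    then have "(\<lambda>n. (rep (X (r n)) x)\<^sup>2) \<longlonglongrightarrow> (F x)\<^sup>2" by (intro tendsto_intros) auto
    then show ?case using elim by (intro LIMSEQ_le_const2) auto
  qed
  have Fs: "F \<in> sq_int" by (rule sq_int_bound[OF F G FG])
  have "(\<lambda>n. \<integral>x. (rep (X (r n)) x - F x)\<^sup>2 \<partial>lebesgue) \<longlonglongrightarrow> (\<integral>x. 0 \<partial>(lebesgue :: 'a measure))"
  proof (rule integral_dominated_convergence[where w = "\<lambda>x. 4 * G x"])
    show "AE x in lebesgue. (\<lambda>n. (rep (X (r n)) x - F x)\<^sup>2) \<longlonglongrightarrow> 0"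
      using ae
    proof eventually_elim
      case (elim x)
      then have "(\<lambda>n. (rep (X (r n)) x - F x)\<^sup>2) \<longlonglongrightarrow> (F x - F x)\<^sup>2" by (intro tendsto_intros) auto
      then show ?case by simp
    qed
    show "AE x in lebesgue. norm ((rep (X (r n)) x - F x)\<^sup>2) \<le> 4 * G x" for n
      using ae FG
    proof eventually_elim
      case (elim x)
      have "(rep (X (r n)) x - F x)\<^sup>2 \<le> 2 * (rep (X (r n)) x)\<^sup>2 + 2 * (F x)\<^sup>2"
        using zero_le_power2[of "rep (X (r n)) x + F x"] by (simp add: power2_eq_square algebra_simps)
      moreover have "(rep (X (r n)) x)\<^sup>2 \<le> G x" using elim by blast
      ultimately show ?case using elim(2) by simp
    qed
    show "(\<lambda>x. (rep (X (r n)) x - F x)\<^sup>2) \<in> borel_measurable lebesgue" for n using F by measurable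
  qed (use G in auto)
  then have "(\<lambda>n. (norm (X (r n) - cls F))\<^sup>2) \<longlonglongrightarrow> 0"
    using norm_cls[OF sq_int_diff[OF rep_sq_int Fs]] by (simp add: cls_diff Fs)
  then have "(\<lambda>n. norm (X (r n) - cls F)) \<longlonglongrightarrow> 0" by simp
  then have lim: "(X \<circ> r) \<longlonglongrightarrow> cls F" by (simp add: LIM_zero_iff tendsto_norm_zero_iff o_def)
  have "AE x in lebesgue. (\<forall>n. (rep (X (r n)) x)\<^sup>2 \<le> G x) \<and> (\<lambda>n. rep (X (r n)) x) \<longlonglongrightarrow> rep (cls F) x"
    using ae rep_cls[OF Fs] by eventually_elim simp
  then show thesis by (rule that[OF r(1) lim G])
qed

instance l2 :: (euclidean_space) complete_space
proof
  fix X :: "nat \<Rightarrow> 'a l2" assume X: "Cauchy X"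
  obtain r l where "strict_mono r" "(X \<circ> r) \<longlonglongrightarrow> l" using l2_Cauchy_subseq[OF X] by metis
  then show "convergent X" using X Cauchy_converges_subseq convergent_def by metis
qed

lemma l2_convergent_subseq:
  fixes X :: "nat \<Rightarrow> 'a::euclidean_space l2"
  assumes "X \<longlonglongrightarrow> l"
  obtains r G where "strict_mono r" "integrable lebesgue G"
    "AE x in lebesgue. (\<forall>n. (rep (X (r n)) x)\<^sup>2 \<le> G x) \<and> (\<lambda>n. rep (X (r n)) x) \<longlonglongrightarrow> rep l x"
proof -
  obtain r l' G where r: "strict_mono r" "(X \<circ> r) \<longlonglongrightarrow> l'" "integrable lebesgue G"
    "AE x in lebesgue. (\<forall>n. (rep (X (r n)) x)\<^sup>2 \<le> G x) \<and> (\<lambda>n. rep (X (r n)) x) \<longlonglongrightarrow> rep l' x"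
    by (rule l2_Cauchy_subseq[OF LIMSEQ_imp_Cauchy[OF assms]])
  have "l' = l" using LIMSEQ_unique[OF r(2) LIMSEQ_subseq_LIMSEQ[OF assms r(1)]] .
  then show thesis using r by (intro that) auto
qed

section \<open>Superposition operators\<close>

text \<open>Convergence in mean square gives pointwise information along subsequences only; this
  criterion recovers the whole sequence.\<close>

lemma LIMSEQ_subseq_criterion:
  fixes y :: "nat \<Rightarrow> 'a::metric_space"
  assumes "\<And>r :: nat \<Rightarrow> nat. strict_mono r \<Longrightarrow> \<exists>s :: nat \<Rightarrow> nat. strict_mono s \<and> (\<lambda>n. y (r (s n))) \<longlonglongrightarrow> l"
  shows "y \<longlonglongrightarrow> l"
proof (rule ccontr)
  assume "\<not> ?thesis"
  then obtain e where e: "e > 0" "\<And>N. \<exists>n\<ge>N. dist (y n) l \<ge> e"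
    unfolding lim_sequentially by (metis not_less)
  have "infinite {n. dist (y n) l \<ge> e}"
    unfolding infinite_nat_iff_unbounded_le using e(2) by auto
  then obtain r where r: "strict_mono (r :: nat \<Rightarrow> nat)" "\<And>n. dist (y (r n)) l \<ge> e"
    using infinite_enumerate by blast
  obtain s where "(\<lambda>n. y (r (s n))) \<longlonglongrightarrow> l" using assms[OF r(1)] by blast
  then obtain N where "dist (y (r (s N))) l < e" using e(1) unfolding lim_sequentially by blast
  then show False using r(2)[of "s N"] by simp
qed

lemma tendsto_floor_approximation:
  "(\<lambda>j. real_of_int \<lfloor>real (Suc j) * t\<rfloor> / real (Suc j)) \<longlonglongrightarrow> t"
proof (rule Lim_transform2[OF tendsto_const[of t]])
  have "norm (t - real_of_int \<lfloor>real (Suc j) * t\<rfloor> / real (Suc j)) \<le> inverse (real (Suc j))" for j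
  proof -
    have f: "real_of_int \<lfloor>real (Suc j) * t\<rfloor> \<le> real (Suc j) * t" "real (Suc j) * t \<le> real_of_int \<lfloor>real (Suc j) * t\<rfloor> + 1"
      by linarith+
    have "t - real_of_int \<lfloor>real (Suc j) * t\<rfloor> / real (Suc j)
        = (real (Suc j) * t - real_of_int \<lfloor>real (Suc j) * t\<rfloor>) / real (Suc j)"
      by (simp add: diff_divide_distrib del: of_nat_Suc)
    moreover have "\<bar>real (Suc j) * t - real_of_int \<lfloor>real (Suc j) * t\<rfloor>\<bar> / real (Suc j) \<le> 1 / real (Suc j)"
      using f by (intro divide_right_mono) linarith+
    ultimately show ?thesis by (simp add: abs_divide inverse_eq_divide del: of_nat_Suc)
  qed
  then show "(\<lambda>j. t - real_of_int \<lfloor>real (Suc j) * t\<rfloor> / real (Suc j)) \<longlonglongrightarrow> 0"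
    by (rule Lim_null_comparison[OF always_eventually[OF allI] LIMSEQ_inverse_real_of_nat])
qed

text \<open>Rounding \<open>u\<close> down to multiples of 1 / (j + 1) leaves countably many values,
  for which measurability of each g(., t) suffices; continuity in t carries this to the
  limit.\<close>

lemma superposition_measurable:
  fixes g :: "'a \<Rightarrow> real \<Rightarrow> real"
  assumes g: "\<And>t. (\<lambda>x. g x t) \<in> borel_measurable M" "\<And>x. x \<in> space M \<Longrightarrow> continuous_on UNIV (g x)"
    and u: "u \<in> borel_measurable M"
  shows "(\<lambda>x. g x (u x)) \<in> borel_measurable M"
proof (rule borel_measurable_LIMSEQ_real)
  fix j :: nat
  have k: "(\<lambda>x. \<lfloor>real (Suc j) * u x\<rfloor>) \<in> measurable M (count_space UNIV)" using u by measurable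
  show "(\<lambda>x. g x (real_of_int \<lfloor>real (Suc j) * u x\<rfloor> / real (Suc j))) \<in> borel_measurable M"
    by (rule measurable_compose_countable[OF _ k, of "\<lambda>i x. g x (real_of_int i / real (Suc j))"]) (rule g(1))
next
  fix x assume "x \<in> space M"
  then have "isCont (g x) (u x)" using g(2) by (simp add: continuous_on_eq_continuous_at)
  then show "(\<lambda>j. g x (real_of_int \<lfloor>real (Suc j) * u x\<rfloor> / real (Suc j))) \<longlonglongrightarrow> g x (u x)"
    by (rule isCont_tendsto_compose[OF _ tendsto_floor_approximation])
qed

lemma norm_cls_mono:
  assumes "f \<in> sq_int" "g \<in> sq_int" "AE x in lebesgue. \<bar>f x\<bar> \<le> g x"
  shows "norm (cls f) \<le> norm (cls g)"
proof -
  have "(norm (cls f))\<^sup>2 \<le> (norm (cls g))\<^sup>2"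
    unfolding norm_cls[OF assms(1)] norm_cls[OF assms(2)]
  proof (rule integral_mono_AE)
    show "AE x in lebesgue. (f x)\<^sup>2 \<le> (g x)\<^sup>2" using assms(3)
      by eventually_elim (metis abs_ge_zero power2_abs power_mono)
  qed (use assms in \<open>auto simp: sq_int_def\<close>)
  then show ?thesis by (rule power2_le_imp_le) simp
qed

lemma sq_int_abs: "f \<in> sq_int \<Longrightarrow> (\<lambda>x. \<bar>f x\<bar>) \<in> sq_int" by (auto simp: sq_int_def)

lemma norm_cls_abs:
  assumes f: "f \<in> sq_int" shows "norm (cls (\<lambda>x. \<bar>f x\<bar>)) = norm (cls f)"
proof (rule power2_eq_imp_eq)
  show "(norm (cls (\<lambda>x. \<bar>f x\<bar>)))\<^sup>2 = (norm (cls f))\<^sup>2"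
    by (simp only: norm_cls[OF f] norm_cls[OF sq_int_abs[OF f]] power2_abs)
qed simp_all

text \<open>Continuity and growth are demanded at every point; a nonlinearity that has them almost
  everywhere is first set to 0 at the exceptional points.\<close>

locale superposition =
  fixes g :: "'a::euclidean_space \<Rightarrow> real \<Rightarrow> real" and a :: "'a \<Rightarrow> real" and b :: real
  assumes g_meas: "\<And>t. (\<lambda>x. g x t) \<in> borel_measurable lebesgue"
    and g_cont: "\<And>x. continuous_on UNIV (g x)"
    and a: "a \<in> sq_int" and b: "b \<ge> 0"
    and growth: "\<And>x t. \<bar>g x t\<bar> \<le> a x + b * \<bar>t\<bar>"
begin

lemma a_nonneg: "0 \<le> a x" using growth[of x 0] by simp

definition N :: "'a l2 \<Rightarrow> 'a l2" where "N u = cls (\<lambda>x. g x (rep u x))"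

lemma rep_lebesgue [measurable]: "rep u \<in> borel_measurable (lebesgue :: 'a measure)"
  by (rule sq_int_measurable) simp

lemma bound_sq_int: "(\<lambda>x. a x + b * \<bar>rep u x\<bar>) \<in> sq_int"
  by (intro sq_int_add a sq_int_scale sq_int_abs) simp

lemma superposition_sq_int: "(\<lambda>x. g x (rep u x)) \<in> sq_int"
proof (rule sq_int_bound)
  show "(\<lambda>x. g x (rep u x)) \<in> borel_measurable lebesgue"
    by (rule superposition_measurable) (use g_meas g_cont in measurable)
  show "integrable lebesgue (\<lambda>x. (a x + b * \<bar>rep u x\<bar>)\<^sup>2)" using bound_sq_int by (simp add: sq_int_def)
  show "AE x in lebesgue. (g x (rep u x))\<^sup>2 \<le> (a x + b * \<bar>rep u x\<bar>)\<^sup>2"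
    using growth by (intro AE_I2) (metis abs_ge_zero power2_abs power_mono)
qed

lemma norm_N: "norm (N u) \<le> norm (cls a) + b * norm u"
proof -
  have "norm (N u) \<le> norm (cls (\<lambda>x. a x + b * \<bar>rep u x\<bar>))"
    unfolding N_def by (intro norm_cls_mono superposition_sq_int bound_sq_int) (simp add: growth)
  also have "cls (\<lambda>x. a x + b * \<bar>rep u x\<bar>) = cls a + b *\<^sub>R cls (\<lambda>x. \<bar>rep u x\<bar>)"
    using cls_add[OF a sq_int_scale[OF sq_int_abs[OF rep_sq_int]]]
    by (simp add: cls_scale sq_int_abs)
  also have "norm \<dots> \<le> norm (cls a) + norm (b *\<^sub>R cls (\<lambda>x. \<bar>rep u x\<bar>))" by (rule norm_triangle_ineq)
  also have "norm (b *\<^sub>R cls (\<lambda>x. \<bar>rep u x\<bar>)) = b * norm u" using b by (simp add: norm_cls_abs)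
  finally show ?thesis .
qed

lemma continuous_N: "continuous_on UNIV N"
proof (rule continuous_on_sequentially[THEN iffD2], safe)
  fix X :: "nat \<Rightarrow> 'a l2" and l assume X: "X \<longlonglongrightarrow> l"
  show "(N \<circ> X) \<longlonglongrightarrow> N l"
  proof (rule LIMSEQ_subseq_criterion)
    fix r :: "nat \<Rightarrow> nat" assume "strict_mono r"
    then have "(X \<circ> r) \<longlonglongrightarrow> l" by (rule LIMSEQ_subseq_LIMSEQ[OF X])
    then obtain s G where s: "strict_mono s" and G: "integrable lebesgue G"
      and ae: "AE x in lebesgue. (\<forall>n. (rep ((X \<circ> r) (s n)) x)\<^sup>2 \<le> G x) \<and> (\<lambda>n. rep ((X \<circ> r) (s n)) x) \<longlonglongrightarrow> rep l x"
      by (rule l2_convergent_subseq)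
    define u where "u n = X (r (s n))" for n
    have ae: "AE x in lebesgue. (\<forall>n. (rep (u n) x)\<^sup>2 \<le> G x) \<and> (\<lambda>n. rep (u n) x) \<longlonglongrightarrow> rep l x"
      using ae by (simp add: u_def)
    have meas [measurable]: "(\<lambda>x. g x (rep v x)) \<in> borel_measurable lebesgue" for v
      using superposition_sq_int by (simp add: sq_int_def)
    have "(\<lambda>n. \<integral>x. (g x (rep (u n) x) - g x (rep l x))\<^sup>2 \<partial>lebesgue) \<longlonglongrightarrow> (\<integral>x. 0 \<partial>(lebesgue :: 'a measure))"
    \<comment> \<open>The majorant comes from (p - q)^2 \<le> 2 p^2 + 2 q^2 for the two values of g,
      followed by g^2 \<le> 2 a^2 + 2 b^2 t^2 from the growth bound.\<close>
    proof (rule integral_dominated_convergence[where w = "\<lambda>x. 8 * (a x)\<^sup>2 + 4 * b\<^sup>2 * G x + 4 * b\<^sup>2 * (rep l x)\<^sup>2"])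
      show "integrable lebesgue (\<lambda>x. 8 * (a x)\<^sup>2 + 4 * b\<^sup>2 * G x + 4 * b\<^sup>2 * (rep l x)\<^sup>2)"
        using a rep_sq_int[of l] G by (intro Bochner_Integration.integrable_add integrable_mult_right) (auto simp: sq_int_def)
      show "AE x in lebesgue. (\<lambda>n. (g x (rep (u n) x) - g x (rep l x))\<^sup>2) \<longlonglongrightarrow> 0"
        using ae
      proof eventually_elim
        case (elim x)
        have "isCont (g x) (rep l x)" using g_cont by (simp add: continuous_on_eq_continuous_at)
        then have "(\<lambda>n. g x (rep (u n) x)) \<longlonglongrightarrow> g x (rep l x)"
          using elim by (intro isCont_tendsto_compose[of _ "g x"]) auto
        then have "(\<lambda>n. (g x (rep (u n) x) - g x (rep l x))\<^sup>2) \<longlonglongrightarrow> (g x (rep l x) - g x (rep l x))\<^sup>2"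
          by (intro tendsto_intros)
        then show ?case by simp
      qed
      show "AE x in lebesgue. norm ((g x (rep (u n) x) - g x (rep l x))\<^sup>2)
          \<le> 8 * (a x)\<^sup>2 + 4 * b\<^sup>2 * G x + 4 * b\<^sup>2 * (rep l x)\<^sup>2" for n
        using ae
      proof eventually_elim
        case (elim x)
        have sq: "(g x t)\<^sup>2 \<le> 2 * (a x)\<^sup>2 + 2 * b\<^sup>2 * t\<^sup>2" for t
        proof -
          have "(g x t)\<^sup>2 \<le> (a x + b * \<bar>t\<bar>)\<^sup>2" using growth by (metis abs_ge_zero power2_abs power_mono)
          also have "\<dots> \<le> 2 * (a x)\<^sup>2 + 2 * (b * \<bar>t\<bar>)\<^sup>2"
            using zero_le_power2[of "a x - b * \<bar>t\<bar>"] unfolding power2_sum power2_diff by linarith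
          finally show ?thesis by (simp add: power_mult_distrib)
        qed
        have "(g x (rep (u n) x) - g x (rep l x))\<^sup>2 \<le> 2 * (g x (rep (u n) x))\<^sup>2 + 2 * (g x (rep l x))\<^sup>2"
          using zero_le_power2[of "g x (rep (u n) x) + g x (rep l x)"] unfolding power2_sum power2_diff by linarith
        moreover have "4 * b\<^sup>2 * (rep (u n) x)\<^sup>2 \<le> 4 * b\<^sup>2 * G x" using elim by (intro mult_left_mono) auto
        ultimately have "(g x (rep (u n) x) - g x (rep l x))\<^sup>2 \<le> 8 * (a x)\<^sup>2 + 4 * b\<^sup>2 * G x + 4 * b\<^sup>2 * (rep l x)\<^sup>2"
          using sq[of "rep (u n) x"] sq[of "rep l x"] by linarith
        then show ?case by simp
      qed
    qed measurable
    then have "(\<lambda>n. (norm (N (u n) - N l))\<^sup>2) \<longlonglongrightarrow> 0"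
      unfolding N_def using norm_cls[OF sq_int_diff[OF superposition_sq_int superposition_sq_int]]
      by (simp add: cls_diff superposition_sq_int)
    then have "(\<lambda>n. norm (N (u n) - N l)) \<longlonglongrightarrow> 0" by simp
    then have "(\<lambda>n. N (u n)) \<longlonglongrightarrow> N l" by (simp add: LIM_zero_iff tendsto_norm_zero_iff)
    then show "\<exists>s. strict_mono s \<and> (\<lambda>n. (N \<circ> X) (r (s n))) \<longlonglongrightarrow> N l"
      using s by (auto simp: u_def)
  qed
qed

end

section \<open>A priori bound\<close>

text \<open>The situation at one point x: \<open>W\<close>, \<open>V\<close> and \<open>H\<close>
  are the values of the normalised solution, of its projection and of its right-hand side, and
  \<open>c\<close> is the norm divided out. Where \<omega> \<noteq> 0, the product c W is unbounded
  and H / W ends up strictly inside the gap; where \<omega> = 0, \<open>H\<close> tends to 0 and the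
  limit (lp - lm) v^2 is merely nonnegative.\<close>

lemma nonresonant_liminf:
  fixes g :: "real \<Rightarrow> real" and W V c \<tau> :: "nat \<Rightarrow> real" and \<omega> v a b lm lp \<mu> :: real
  defines "H \<equiv> \<lambda>n. (1 - \<tau> n) * \<mu> * W n + \<tau> n / c n * g (c n * W n)"
  assumes lim: "W \<longlonglongrightarrow> \<omega>" "V \<longlonglongrightarrow> v" and c: "filterlim c at_top sequentially" "\<And>n. c n > 0"
    and \<tau>: "\<And>n. 0 \<le> \<tau> n" "\<And>n. \<tau> n \<le> 1"
    and growth: "\<And>t. \<bar>g t\<bar> \<le> a + b * \<bar>t\<bar>" and b: "b \<ge> 0"
    and \<mu>: "lm < \<mu>" "\<mu> < lp"
    and alpha: "\<omega> \<noteq> 0 \<Longrightarrow> ereal lm < Liminf at_infinity (\<lambda>t. ereal (g t / t))"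
      "\<omega> \<noteq> 0 \<Longrightarrow> Limsup at_infinity (\<lambda>t. ereal (g t / t)) < ereal lp"
  shows "\<exists>\<eta>\<ge>0. (\<omega> \<noteq> 0 \<longrightarrow> \<eta> > 0) \<and> (\<forall>e>0. eventually (\<lambda>n.
    \<eta> - e \<le> lp * (W n - V n)\<^sup>2 - lm * (V n)\<^sup>2 - H n * ((W n - V n) - V n)) sequentially)"
proof (cases "\<omega> = 0")
  case True
  have ic: "(\<lambda>n. inverse (c n)) \<longlonglongrightarrow> 0"
    using c(1) by (rule tendsto_inverse_0_at_top)
  have "\<bar>H n\<bar> \<le> (\<bar>\<mu>\<bar> + b) * \<bar>W n\<bar> + a * inverse (c n)" for n
  proof -
    have "\<bar>H n\<bar> \<le> \<bar>(1 - \<tau> n) * \<mu> * W n\<bar> + \<bar>\<tau> n / c n * g (c n * W n)\<bar>" unfolding H_def by (rule abs_triangle_ineq)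
    also have "\<bar>(1 - \<tau> n) * \<mu> * W n\<bar> \<le> 1 * (\<bar>\<mu>\<bar> * \<bar>W n\<bar>)"
      unfolding abs_mult mult.assoc using \<tau>[of n] by (intro mult_right_mono) auto
    also have "\<bar>\<tau> n / c n * g (c n * W n)\<bar> \<le> 1 / c n * (a + b * \<bar>c n * W n\<bar>)"
      unfolding abs_mult[of "\<tau> n / c n"] abs_divide
      using \<tau>[of n] c(2)[of n] growth[of "c n * W n"] by (intro mult_mono divide_mono) auto
    also have "\<dots> = a * inverse (c n) + b * \<bar>W n\<bar>" using c(2)[of n] by (simp add: abs_mult field_simps)
    finally show ?thesis by (simp add: algebra_simps)
  qed
  moreover have "(\<lambda>n. (\<bar>\<mu>\<bar> + b) * \<bar>W n\<bar> + a * inverse (c n)) \<longlonglongrightarrow> (\<bar>\<mu>\<bar> + b) * \<bar>\<omega>\<bar> + a * 0"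
    by (intro tendsto_intros lim ic)
  ultimately have H0: "H \<longlonglongrightarrow> 0"
    using True by (intro Lim_null_comparison[of H "\<lambda>n. (\<bar>\<mu>\<bar> + b) * \<bar>W n\<bar> + a * inverse (c n)"]) auto
  have "(\<lambda>n. lp * (W n - V n)\<^sup>2 - lm * (V n)\<^sup>2 - H n * ((W n - V n) - V n))
     \<longlonglongrightarrow> lp * (\<omega> - v)\<^sup>2 - lm * v\<^sup>2 - 0 * ((\<omega> - v) - v)"
    by (intro tendsto_intros lim H0)
  moreover have "lp * (\<omega> - v)\<^sup>2 - lm * v\<^sup>2 - 0 * ((\<omega> - v) - v) = (lp - lm) * v\<^sup>2"
    using True by (simp add: algebra_simps)
  ultimately have L: "(\<lambda>n. lp * (W n - V n)\<^sup>2 - lm * (V n)\<^sup>2 - H n * ((W n - V n) - V n)) \<longlonglongrightarrow> (lp - lm) * v\<^sup>2"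
    by simp
  have "\<forall>\<^sub>F n in sequentially. (lp - lm) * v\<^sup>2 - e \<le> lp * (W n - V n)\<^sup>2 - lm * (V n)\<^sup>2 - H n * ((W n - V n) - V n)"
    if "e > 0" for e
    using order_tendstoD(1)[OF L, of "(lp - lm) * v\<^sup>2 - e"] that by (auto elim: eventually_mono)
  then show ?thesis using True \<mu> by (intro exI[of _ "(lp - lm) * v\<^sup>2"]) auto
next
  case False
  obtain lm1 where lm1: "lm < lm1" "ereal lm1 < Liminf at_infinity (\<lambda>t. ereal (g t / t))"
    using ereal_dense2[OF alpha(1)[OF False]] by auto
  obtain lp1 where lp1: "lp1 < lp" "Limsup at_infinity (\<lambda>t. ereal (g t / t)) < ereal lp1"
    using ereal_dense2[OF alpha(2)[OF False]] by auto
  \<comment> \<open>Enlarging the interval so that it contains \<mu> makes it stable under the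
    convex combinations of the homotopy.\<close>
  define l where "l = min lm1 \<mu>"
  define p where "p = max lp1 \<mu>"
  have lp: "lm < l" "p < lp" "l \<le> \<mu>" "\<mu> \<le> p" using lm1 lp1 \<mu> by (auto simp: l_def p_def)
  have ev: "eventually (\<lambda>t. l \<le> g t / t \<and> g t / t \<le> p) at_infinity"
    using less_LiminfD[OF lm1(2)] Limsup_lessD[OF lp1(2)]
    by eventually_elim (auto simp: l_def p_def)
  then obtain R where R: "\<And>t. \<bar>t\<bar> \<ge> R \<Longrightarrow> l \<le> g t / t \<and> g t / t \<le> p"
    by (auto simp: eventually_at_infinity)
  have "\<forall>\<^sub>F n in sequentially. \<bar>\<omega>\<bar> / 2 < \<bar>W n\<bar>"
    by (rule order_tendstoD(1)[OF tendsto_rabs[OF lim(1)]]) (use False in simp)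
  moreover have "\<forall>\<^sub>F n in sequentially. 2 * \<bar>R\<bar> / \<bar>\<omega>\<bar> < c n"
    using c(1) by (simp add: filterlim_at_top_dense)
  ultimately have low: "\<forall>\<^sub>F n in sequentially. (lp - p) * (W n - V n)\<^sup>2 + (l - lm) * (V n)\<^sup>2
      \<le> lp * (W n - V n)\<^sup>2 - lm * (V n)\<^sup>2 - H n * ((W n - V n) - V n)"
  proof eventually_elim
    case (elim n)
    have W0: "W n \<noteq> 0" using elim(1) by auto
    have "\<bar>R\<bar> \<le> c n * \<bar>W n\<bar>"
    proof -
      have "\<bar>R\<bar> = (2 * \<bar>R\<bar> / \<bar>\<omega>\<bar>) * (\<bar>\<omega>\<bar> / 2)" using False by simp
      also have "\<dots> \<le> c n * \<bar>W n\<bar>" using elim c(2)[of n] by (intro mult_mono) auto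
      finally show ?thesis .
    qed
    then have "\<bar>c n * W n\<bar> \<ge> R" using c(2)[of n] by (simp add: abs_mult)
    note q = R[OF this]
    define m where "m = (1 - \<tau> n) * \<mu> + \<tau> n * (g (c n * W n) / (c n * W n))"
    have "m \<le> (1 - \<tau> n) * p + \<tau> n * p" unfolding m_def
      using \<tau>[of n] q lp by (intro add_mono mult_left_mono) auto
    then have mp: "m \<le> p" by (simp add: algebra_simps)
    have "(1 - \<tau> n) * l + \<tau> n * l \<le> m" unfolding m_def
      using \<tau>[of n] q lp by (intro add_mono mult_left_mono) auto
    then have ml: "l \<le> m" by (simp add: algebra_simps)
    have "H n = m * W n" using W0 c(2)[of n] by (simp add: H_def m_def field_simps)
    then have "H n * ((W n - V n) - V n) = m * (W n - V n)\<^sup>2 - m * (V n)\<^sup>2"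
      by (simp add: power2_eq_square algebra_simps)
    moreover have "m * (W n - V n)\<^sup>2 \<le> p * (W n - V n)\<^sup>2" "l * (V n)\<^sup>2 \<le> m * (V n)\<^sup>2"
      using mp ml by (auto intro: mult_right_mono)
    ultimately show ?case by (simp add: left_diff_distrib)
  qed
  define \<eta> where "\<eta> = (lp - p) * (\<omega> - v)\<^sup>2 + (l - lm) * v\<^sup>2"
  have L: "(\<lambda>n. (lp - p) * (W n - V n)\<^sup>2 + (l - lm) * (V n)\<^sup>2) \<longlonglongrightarrow> \<eta>"
    unfolding \<eta>_def by (intro tendsto_intros lim)
  \<comment> \<open>Since \<omega> \<noteq> 0, the numbers \<omega> - v and v cannot both
    vanish.\<close>
  have "\<eta> > 0"
  proof (cases "v = 0")
    case True then show ?thesis using False lp by (simp add: \<eta>_def)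
  next
    case False then show ?thesis using lp unfolding \<eta>_def by (intro add_nonneg_pos) auto
  qed
  moreover have "\<forall>\<^sub>F n in sequentially. \<eta> - e \<le> lp * (W n - V n)\<^sup>2 - lm * (V n)\<^sup>2 - H n * ((W n - V n) - V n)"
    if "e > 0" for e
  proof -
    have "\<forall>\<^sub>F n in sequentially. \<eta> - e < (lp - p) * (W n - V n)\<^sup>2 + (l - lm) * (V n)\<^sup>2"
      by (rule order_tendstoD(1)[OF L]) (use that in simp)
    with low show ?thesis by eventually_elim linarith
  qed
  ultimately show ?thesis by (intro exI[of _ \<eta>]) auto
qed

text \<open>Nonresonance is available on \<open>S\<close> only, which stands for \<Omega>;
  \<open>vanish\<close> confines the solutions, and with them any limit, to this set.\<close>

locale nonresonance = spectral_gap D B G ev lm lp + superposition g a b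
  for D :: "'a::euclidean_space l2 set" and B G ev lm lp and g :: "'a \<Rightarrow> real \<Rightarrow> real" and a b +
  fixes S :: "'a set"
  assumes vanish: "\<And>u. u \<in> D \<Longrightarrow> AE x in lebesgue. x \<notin> S \<longrightarrow> rep u x = 0"
    and alpha: "AE x in lebesgue. x \<in> S \<longrightarrow> ereal lm < Liminf at_infinity (\<lambda>t. ereal (g x t / t)) \<and>
       Limsup at_infinity (\<lambda>t. ereal (g x t / t)) < ereal lp"
begin

text \<open>Normalised solutions of unbounded norm would converge to some \<open>l\<close> with \<open>\<parallel>l\<parallel> = 1\<close>. The integral of
  \<open>\<psi>\<close> is nonpositive by the energy inequality, while nonresonance makes its lower limit nonnegative,
  and positive wherever \<open>l \<noteq> 0\<close>; this contradicts Fatou's lemma.\<close>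

lemma apriori_bound:
  "\<exists>r>0. \<forall>u\<in>D. \<forall>\<tau>. 0 \<le> \<tau> \<longrightarrow> \<tau> \<le> 1 \<longrightarrow>
     (\<forall>y\<in>D. B u y = inner ((1 - \<tau>) *\<^sub>R \<mu> *\<^sub>R u + \<tau> *\<^sub>R N u) y) \<longrightarrow> norm u < r"
proof (rule ccontr)
  assume neg: "\<not> ?thesis"
  have "\<exists>u \<tau>. u \<in> D \<and> 0 \<le> \<tau> \<and> \<tau> \<le> 1 \<and>
     (\<forall>y\<in>D. B u y = inner ((1 - \<tau>) *\<^sub>R \<mu> *\<^sub>R u + \<tau> *\<^sub>R N u) y) \<and> real (Suc n) \<le> norm u" for n
  proof (rule ccontr)
    assume "\<not> ?thesis"
    then have "\<forall>u\<in>D. \<forall>\<tau>. 0 \<le> \<tau> \<longrightarrow> \<tau> \<le> 1 \<longrightarrow>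
     (\<forall>y\<in>D. B u y = inner ((1 - \<tau>) *\<^sub>R \<mu> *\<^sub>R u + \<tau> *\<^sub>R N u) y) \<longrightarrow> norm u < real (Suc n)"
      by (meson not_less)
    moreover have "real (Suc n) > 0" by simp
    ultimately show False using neg by blast
  qed
  then obtain U T where U: "\<And>n. U n \<in> D" and T: "\<And>n. 0 \<le> T n" "\<And>n. T n \<le> 1"
    and eq: "\<And>n y. y \<in> D \<Longrightarrow> B (U n) y = inner ((1 - T n) *\<^sub>R \<mu> *\<^sub>R U n + T n *\<^sub>R N (U n)) y"
    and U_large: "\<And>n. real (Suc n) \<le> norm (U n)"
    by metis
  have U1: "1 \<le> norm (U n)" for n using U_large[of n] by simp
  have U_pos: "0 < norm (U n)" for n using U1[of n] by linarith
  define w where "w n = (1 / norm (U n)) *\<^sub>R U n" for n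
  \<comment> \<open>The right-hand side of the homotopy equation divided by the norm of
    \<open>U n\<close>. The growth bound keeps it bounded, and so \<open>w\<close> is bounded in the
    graph norm.\<close>
  define h where "h n = ((1 - T n) * \<mu>) *\<^sub>R w n + (T n / norm (U n)) *\<^sub>R N (U n)" for n
  have wD: "w n \<in> D" for n using U by (simp add: w_def)
  have w1: "norm (w n) = 1" for n using U_pos[of n] by (simp add: w_def)
  have Uw: "U n = norm (U n) *\<^sub>R w n" for n using U_pos[of n] by (simp add: w_def)
  have Bw: "B (w n) y = inner (h n) y" if "y \<in> D" for n y
  proof -
    have "h n = (1 / norm (U n)) *\<^sub>R ((1 - T n) *\<^sub>R \<mu> *\<^sub>R U n + T n *\<^sub>R N (U n))"
      by (simp add: h_def w_def scaleR_add_right)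
    moreover have "B (w n) y = (1 / norm (U n)) * B (U n) y" unfolding w_def by (rule scale[OF U that])
    ultimately show ?thesis using eq[OF that, of n] by simp
  qed
  have h_norm: "norm (h n) \<le> \<bar>\<mu>\<bar> + norm (cls a) + b" for n
  proof -
    have "norm (h n) \<le> norm (((1 - T n) * \<mu>) *\<^sub>R w n) + norm ((T n / norm (U n)) *\<^sub>R N (U n))"
      unfolding h_def by (rule norm_triangle_ineq)
    also have "norm (((1 - T n) * \<mu>) *\<^sub>R w n) \<le> 1 * \<bar>\<mu>\<bar>"
      using T[of n] unfolding norm_scaleR w1 abs_mult mult_1_right by (intro mult_right_mono) auto
    also have "norm ((T n / norm (U n)) *\<^sub>R N (U n)) \<le> 1 / norm (U n) * (norm (cls a) + b * norm (U n))"
      unfolding norm_scaleR using T[of n] U_pos[of n] norm_N[of "U n"]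
      by (intro mult_mono) (auto intro: divide_right_mono)
    also have "\<dots> \<le> norm (cls a) + b" using U1[of n] U_pos[of n]
      by (simp add: field_simps) (metis mult_left_mono mult.commute mult_1 norm_ge_zero)
    finally show ?thesis by simp
  qed
  have "B (w n) (w n) + (norm (w n))\<^sup>2 \<le> \<bar>\<mu>\<bar> + norm (cls a) + b + 1" for n
    using Bw[OF wD[of n], of n] norm_cauchy_schwarz[of "h n" "w n"] h_norm[of n] by (simp add: w1)
  with wD have "\<exists>l r1. strict_mono (r1 :: nat \<Rightarrow> nat) \<and> (w \<circ> r1) \<longlonglongrightarrow> l"
    by (rule compact)
  then obtain l r1 where r1: "strict_mono (r1 :: nat \<Rightarrow> nat)" "(w \<circ> r1) \<longlonglongrightarrow> l"
    by blast
  have l1: "norm l = 1" using tendsto_norm[OF r1(2)] by (simp add: o_def w1 LIMSEQ_const_iff)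
  obtain r2 G1 where r2: "strict_mono r2" and G1: "integrable lebesgue G1"
    and ae1: "AE x in lebesgue. (\<forall>n. (rep ((w \<circ> r1) (r2 n)) x)\<^sup>2 \<le> G1 x) \<and> (\<lambda>n. rep ((w \<circ> r1) (r2 n)) x) \<longlonglongrightarrow> rep l x"
    by (rule l2_convergent_subseq[OF r1(2)])
  \<comment> \<open>The projections form a sequence of their own, so a further subsequence is
    extracted to give them a majorant as well.\<close>
  have "(\<lambda>n. P ((w \<circ> r1) (r2 n))) \<longlonglongrightarrow> P l"
    using tendsto_P[OF LIMSEQ_subseq_LIMSEQ[OF r1(2) r2]] by (simp add: o_def)
  then obtain r3 G2 where r3: "strict_mono r3" and G2: "integrable lebesgue G2"
    and ae2: "AE x in lebesgue. (\<forall>n. (rep (P ((w \<circ> r1) (r2 (r3 n)))) x)\<^sup>2 \<le> G2 x) \<and>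
       (\<lambda>n. rep (P ((w \<circ> r1) (r2 (r3 n)))) x) \<longlonglongrightarrow> rep (P l) x"
    by (rule l2_convergent_subseq)
  define q where "q n = r1 (r2 (r3 n))" for n
  have q: "strict_mono q" using r1(1) r2 r3 by (simp add: q_def strict_mono_def)
  define W where "W n = rep (w (q n))" for n
  define V where "V n = rep (P (w (q n)))" for n
  define H where "H n = rep (h (q n))" for n
  define c where "c n = norm (U (q n))" for n
  define t where "t n = T (q n)" for n
  have sq: "W n \<in> sq_int" "V n \<in> sq_int" "H n \<in> sq_int" for n by (simp_all add: W_def V_def H_def)
  have [measurable]: "W n \<in> borel_measurable lebesgue" "V n \<in> borel_measurable lebesgue"
    "H n \<in> borel_measurable lebesgue" for n by (simp_all add: W_def V_def H_def)
  have aeW: "AE x in lebesgue. (\<forall>n. (W n x)\<^sup>2 \<le> G1 x) \<and> (\<lambda>n. W n x) \<longlonglongrightarrow> rep l x"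
    using ae1
  proof eventually_elim
    case (elim x)
    have "(\<lambda>n. rep ((w \<circ> r1) (r2 (r3 n))) x) \<longlonglongrightarrow> rep l x"
      using LIMSEQ_subseq_LIMSEQ[OF conjunct2[OF elim] r3] by (simp add: o_def)
    then show ?case using elim by (simp add: W_def q_def)
  qed
  have aeV: "AE x in lebesgue. (\<forall>n. (V n x)\<^sup>2 \<le> G2 x) \<and> (\<lambda>n. V n x) \<longlonglongrightarrow> rep (P l) x"
    using ae2 by (simp add: V_def q_def)
  have aeH: "AE x in lebesgue. \<forall>n. H n x = (1 - t n) * \<mu> * W n x + t n / c n * g x (c n * W n x)"
    unfolding AE_all_countable
  proof
    fix n
    have "AE x in lebesgue. rep (U (q n)) x = c n * W n x"
      using rep_scale[of "norm (U (q n))" "w (q n)"] Uw[of "q n"] by (simp add: c_def W_def)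
    moreover have "AE x in lebesgue. rep (N (U (q n))) x = g x (rep (U (q n)) x)"
      using rep_cls[OF superposition_sq_int[of "U (q n)"]] by (simp add: N_def)
    moreover note rep_add[of "((1 - t n) * \<mu>) *\<^sub>R w (q n)" "(t n / c n) *\<^sub>R N (U (q n))"]
      rep_scale[of "(1 - t n) * \<mu>" "w (q n)"] rep_scale[of "t n / c n" "N (U (q n))"]
    ultimately show "AE x in lebesgue. H n x = (1 - t n) * \<mu> * W n x + t n / c n * g x (c n * W n x)"
      by eventually_elim (simp add: H_def h_def t_def c_def W_def)
  qed
  have ae_vanish: "AE x in lebesgue. x \<notin> S \<longrightarrow> (\<forall>n. W n x = 0)"
  proof -
    have "AE x in lebesgue. \<forall>n. x \<notin> S \<longrightarrow> W n x = 0"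
      unfolding AE_all_countable W_def using vanish wD by blast
    then show ?thesis by eventually_elim auto
  qed
  define \<psi> where "\<psi> n x = lp * (W n x - V n x)\<^sup>2 - lm * (V n x)\<^sup>2 - H n x * ((W n x - V n x) - V n x)" for n x
  have int1: "integrable lebesgue (\<lambda>x. (W n x - V n x)\<^sup>2)" "integrable lebesgue (\<lambda>x. (V n x)\<^sup>2)"
    "integrable lebesgue (\<lambda>x. H n x * ((W n x - V n x) - V n x))" for n
    using sq_int_diff[OF sq(1,2), of n n] sq(2)[of n]
      sq_int_mult_integrable[OF sq(3) sq_int_diff[OF sq_int_diff[OF sq(1,2)] sq(2)], of n n n n]
    by (simp_all add: sq_int_def)
  have psi_int: "integrable lebesgue (\<psi> n)" for n
    unfolding \<psi>_def by (intro Bochner_Integration.integrable_diff integrable_mult_right int1)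
  have psi_le: "(\<integral>x. \<psi> n x \<partial>lebesgue) \<le> 0" for n
  proof -
    let ?w = "w (q n)"
    have "(\<integral>x. \<psi> n x \<partial>lebesgue) = lp * (\<integral>x. (W n x - V n x)\<^sup>2 \<partial>lebesgue) - lm * (\<integral>x. (V n x)\<^sup>2 \<partial>lebesgue)
        - (\<integral>x. H n x * ((W n x - V n x) - V n x) \<partial>lebesgue)"
    proof -
      have i: "integrable lebesgue (\<lambda>x. lp * (W n x - V n x)\<^sup>2)" "integrable lebesgue (\<lambda>x. lm * (V n x)\<^sup>2)"
        by (intro integrable_mult_right int1)+
      show ?thesis unfolding \<psi>_def
        Bochner_Integration.integral_diff[OF Bochner_Integration.integrable_diff[OF i] int1(3)]
        Bochner_Integration.integral_diff[OF i] by simp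
    qed
    also have "(\<integral>x. (W n x - V n x)\<^sup>2 \<partial>lebesgue) = (norm (?w - P ?w))\<^sup>2"
      by (simp add: W_def V_def norm_diff_rep)
    also have "(\<integral>x. (V n x)\<^sup>2 \<partial>lebesgue) = (norm (P ?w))\<^sup>2" by (simp add: V_def norm_rep)
    finally have "(\<integral>x. \<psi> n x \<partial>lebesgue) = lp * (norm (?w - P ?w))\<^sup>2 - lm * (norm (P ?w))\<^sup>2
        - (\<integral>x. H n x * ((W n x - V n x) - V n x) \<partial>lebesgue)" .
    moreover have "(?w - P ?w) - P ?w = cls (\<lambda>x. W n x - V n x - V n x)"
      using cls_diff[OF sq_int_diff[OF sq(1,2)] sq(2), of n n n] cls_diff[OF sq(1,2), of n n]
      by (simp add: W_def V_def)
    then have "(\<integral>x. H n x * ((W n x - V n x) - V n x) \<partial>lebesgue) = inner (h (q n)) ((?w - P ?w) - P ?w)"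
      using inner_cls[OF sq(3) sq_int_diff[OF sq_int_diff[OF sq(1,2)] sq(2)], of n n n n] by (simp add: H_def)
    ultimately show ?thesis using energy_inequality[OF wD Bw, of "q n"] by simp
  qed
  define Lp where "Lp = \<bar>lp\<bar>"
  define Lm where "Lm = \<bar>lm\<bar>"
  define K where "K = \<bar>\<mu>\<bar> + b"
  have L: "0 \<le> Lp" "- Lp \<le> lp" "0 \<le> Lm" "lm \<le> Lm" "0 \<le> K" using b by (auto simp: Lp_def Lm_def K_def)
  \<comment> \<open>An integrable bound for the negative parts of all \<psi> n. The last two terms
    come from (W - 2 V)^2 \<le> 2 W^2 + 8 V^2, the two before them from the growth bound on
    \<open>H\<close>.\<close>
  define F where "F x = Lp * (2 * (G1 x + G2 x)) + Lm * G2 x + 2 * (K\<^sup>2 * G1 x) + 2 * (a x)\<^sup>2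
      + 2 * G1 x + 8 * G2 x" for x
  have F_int: "integrable lebesgue F" unfolding F_def
    using a G1 G2 by (intro Bochner_Integration.integrable_add integrable_mult_right) (auto simp: sq_int_def)
  have [measurable]: "F \<in> borel_measurable lebesgue" "\<psi> n \<in> borel_measurable lebesgue" for n
    using F_int psi_int by auto
  have c1: "1 \<le> c n" for n unfolding c_def by (rule U1)
  have t: "0 \<le> t n" "t n \<le> 1" for n using T by (auto simp: t_def)
  have lower: "AE x in lebesgue. 0 \<le> F x \<and> (\<forall>n. 0 \<le> \<psi> n x + F x)"
    using aeW aeV aeH
  proof eventually_elim
    case (elim x)
    have G: "0 \<le> G1 x" "0 \<le> G2 x" using elim by (metis order_trans zero_le_power2)+
    have "0 \<le> \<psi> n x + F x" for n
    proof -
      have WV: "(W n x)\<^sup>2 \<le> G1 x" "(V n x)\<^sup>2 \<le> G2 x" using elim by auto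
      have "\<bar>H n x\<bar> \<le> \<bar>(1 - t n) * \<mu> * W n x\<bar> + \<bar>t n / c n * g x (c n * W n x)\<bar>"
      proof -
        have "H n x = (1 - t n) * \<mu> * W n x + t n / c n * g x (c n * W n x)" using elim(3) by blast
        then show ?thesis by (simp only: abs_triangle_ineq)
      qed
      also have "\<bar>(1 - t n) * \<mu> * W n x\<bar> \<le> 1 * (\<bar>\<mu>\<bar> * \<bar>W n x\<bar>)"
        unfolding abs_mult mult.assoc using t[of n] by (intro mult_right_mono) auto
      also have "\<bar>t n / c n * g x (c n * W n x)\<bar> \<le> 1 / c n * (a x + b * \<bar>c n * W n x\<bar>)"
        unfolding abs_mult[of "t n / c n"] abs_divide
        using t[of n] c1[of n] growth[of x "c n * W n x"] by (intro mult_mono divide_mono) auto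
      also have "\<dots> = a x / c n + b * \<bar>W n x\<bar>" using c1[of n] by (simp add: abs_mult field_simps)
      also have "a x / c n \<le> a x" using c1[of n] a_nonneg[of x]
        using divide_left_mono[of 1 "c n" "a x"] by simp
      finally have "\<bar>H n x\<bar> \<le> K * \<bar>W n x\<bar> + a x" by (simp add: K_def algebra_simps)
      from power_mono[OF this, of 2] have "(H n x)\<^sup>2 \<le> (K * \<bar>W n x\<bar> + a x)\<^sup>2" by simp
      also have "\<dots> \<le> 2 * (K * \<bar>W n x\<bar>)\<^sup>2 + 2 * (a x)\<^sup>2"
        using zero_le_power2[of "K * \<bar>W n x\<bar> - a x"] unfolding power2_sum power2_diff by linarith
      also have "(K * \<bar>W n x\<bar>)\<^sup>2 = K\<^sup>2 * (W n x)\<^sup>2" by (simp add: power_mult_distrib)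
      also have "\<dots> \<le> K\<^sup>2 * G1 x" using WV by (intro mult_left_mono) auto
      finally have H2: "(H n x)\<^sup>2 \<le> 2 * (K\<^sup>2 * G1 x) + 2 * (a x)\<^sup>2" by simp
      have "H n x * (W n x - V n x - V n x) \<le> (H n x)\<^sup>2 + (W n x - V n x - V n x)\<^sup>2"
        using zero_le_power2[of "H n x - (W n x - V n x - V n x)"] zero_le_power2[of "H n x"]
          zero_le_power2[of "W n x - V n x - V n x"]
        unfolding power2_diff[of "H n x"] by linarith
      moreover have "(W n x - V n x - V n x)\<^sup>2 \<le> 2 * (W n x)\<^sup>2 + 8 * (V n x)\<^sup>2"
        using zero_le_power2[of "W n x + 2 * V n x"] by (simp add: power2_eq_square algebra_simps)
      moreover have "(W n x - V n x)\<^sup>2 \<le> 2 * (G1 x + G2 x)"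
      proof -
        have "(W n x - V n x)\<^sup>2 \<le> 2 * (W n x)\<^sup>2 + 2 * (V n x)\<^sup>2"
          using zero_le_power2[of "W n x + V n x"] by (simp add: power2_eq_square algebra_simps)
        then show ?thesis using WV by simp
      qed
      then have "Lp * (W n x - V n x)\<^sup>2 \<le> Lp * (2 * (G1 x + G2 x))" using L by (intro mult_left_mono) auto
      moreover have "- (Lp * (W n x - V n x)\<^sup>2) \<le> lp * (W n x - V n x)\<^sup>2"
        using mult_right_mono[OF L(2), of "(W n x - V n x)\<^sup>2"] by simp
      moreover have "lm * (V n x)\<^sup>2 \<le> Lm * G2 x" using WV L by (intro mult_mono) auto
      ultimately show ?thesis using H2 WV unfolding \<psi>_def F_def by linarith
    qed
    moreover have "0 \<le> F x" using G L by (simp add: F_def)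
    ultimately show ?case by blast
  qed
  have F_nn: "(\<integral>\<^sup>+x. ennreal (F x) \<partial>lebesgue) = ennreal (\<integral>x. F x \<partial>lebesgue)"
  proof (rule nn_integral_eq_integral[OF F_int])
    show "AE x in lebesgue. 0 \<le> F x" using lower by eventually_elim blast
  qed
  \<comment> \<open>Adding \<open>F\<close> makes the integrand nonnegative almost everywhere, as
    Fatou's lemma requires; by \<open>psi_le\<close> its integral does not exceed that of
    \<open>F\<close>.\<close>
  define \<Phi> where "\<Phi> n x = ennreal (\<psi> n x + F x)" for n x
  have [measurable]: "\<Phi> n \<in> borel_measurable lebesgue" for n unfolding \<Phi>_def by measurable
  have "(\<integral>\<^sup>+x. \<Phi> n x \<partial>lebesgue) \<le> (\<integral>\<^sup>+x. ennreal (F x) \<partial>lebesgue)" for n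
  proof -
    have "(\<integral>\<^sup>+x. \<Phi> n x \<partial>lebesgue) = ennreal (\<integral>x. \<psi> n x + F x \<partial>lebesgue)" unfolding \<Phi>_def
    proof (rule nn_integral_eq_integral)
      show "integrable lebesgue (\<lambda>x. \<psi> n x + F x)" by (intro Bochner_Integration.integrable_add psi_int F_int)
      show "AE x in lebesgue. 0 \<le> \<psi> n x + F x" using lower by eventually_elim blast
    qed
    also have "\<dots> \<le> ennreal (\<integral>x. F x \<partial>lebesgue)"
    proof (rule ennreal_leI)
      have "(\<integral>x. \<psi> n x + F x \<partial>lebesgue) = (\<integral>x. \<psi> n x \<partial>lebesgue) + (\<integral>x. F x \<partial>lebesgue)"
        by (rule Bochner_Integration.integral_add[OF psi_int F_int])
      then show "(\<integral>x. \<psi> n x + F x \<partial>lebesgue) \<le> (\<integral>x. F x \<partial>lebesgue)" using psi_le[of n] by linarith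
    qed
    also have "\<dots> = (\<integral>\<^sup>+x. ennreal (F x) \<partial>lebesgue)"
      by (rule F_nn[symmetric])
    finally show ?thesis .
  qed
  then have "liminf (\<lambda>n. \<integral>\<^sup>+x. \<Phi> n x \<partial>lebesgue) \<le> (\<integral>\<^sup>+x. ennreal (F x) \<partial>lebesgue)"
    by (intro Liminf_le always_eventually) auto
  then have fatou: "(\<integral>\<^sup>+x. liminf (\<lambda>n. \<Phi> n x) \<partial>lebesgue) \<le> (\<integral>\<^sup>+x. ennreal (F x) \<partial>lebesgue)"
    using nn_integral_liminf[of \<Phi> lebesgue] by simp
  have c_top: "filterlim c at_top sequentially"
  proof (rule filterlim_at_top_mono[OF filterlim_real_sequentially always_eventually], safe)
    fix n
    have "real n \<le> real (q n)" using seq_suble[OF q, of n] by simp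
    then show "real n \<le> c n" using U_large[of "q n"] by (simp add: c_def)
  qed
  have pointwise: "AE x in lebesgue. ennreal (F x) \<le> liminf (\<lambda>n. \<Phi> n x) \<and>
      (liminf (\<lambda>n. \<Phi> n x) \<le> ennreal (F x) \<longrightarrow> rep l x = 0)"
    using aeW aeV aeH ae_vanish alpha lower
  proof eventually_elim
    case (elim x)
    have xS: "x \<in> S" if "rep l x \<noteq> 0"
    proof (rule ccontr)
      assume "x \<notin> S"
      then have "(\<lambda>n. W n x) = (\<lambda>n. 0)" using elim(4) by auto
      then show False using elim(1) that by (simp add: LIMSEQ_const_iff)
    qed
    have "\<exists>\<eta>\<ge>0. (rep l x \<noteq> 0 \<longrightarrow> \<eta> > 0) \<and> (\<forall>e>0. eventually (\<lambda>n. \<eta> - e \<le> lp * (W n x - V n x)\<^sup>2 - lm * (V n x)\<^sup>2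
        - ((1 - t n) * \<mu> * W n x + t n / c n * g x (c n * W n x)) * ((W n x - V n x) - V n x)) sequentially)"
    proof (rule nonresonant_liminf[where g = "g x" and a = "a x" and b = b and \<mu> = \<mu> and lm = lm and lp = lp and c = c])
      show "lm < \<mu>" "\<mu> < lp" using less by (simp_all add: \<mu>_def)
      show "0 < c n" for n using c1[of n] by linarith
    qed (use elim xS c_top t growth b in auto)
    then obtain \<eta> where \<eta>: "\<eta> \<ge> 0" "rep l x \<noteq> 0 \<Longrightarrow> \<eta> > 0"
      and ev: "\<And>e. e > 0 \<Longrightarrow> eventually (\<lambda>n. \<eta> - e \<le> \<psi> n x) sequentially"
      using elim(3) by (auto simp: \<psi>_def)
    have low: "ennreal (\<eta> - e + F x) \<le> liminf (\<lambda>n. \<Phi> n x)" if "e > 0" for e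
      by (rule Liminf_bounded) (use ev[OF that] in \<open>auto simp: \<Phi>_def elim!: eventually_mono intro!: ennreal_leI\<close>)
    have "ennreal (F x) \<le> liminf (\<lambda>n. \<Phi> n x)"
    proof (rule ennreal_le_epsilon)
      fix e :: real assume e: "0 < e"
      have "ennreal (F x) \<le> ennreal (\<eta> - e + F x) + ennreal e"
      proof (cases "\<eta> - e + F x \<ge> 0")
        case True
        then have "ennreal (\<eta> - e + F x) + ennreal e = ennreal (\<eta> + F x)" using e by (simp flip: ennreal_plus)
        then show ?thesis using \<eta>(1) by (simp add: ennreal_leI)
      next
        case False
        then show ?thesis using \<eta>(1) by (intro add_increasing ennreal_leI) auto
      qed
      also have "\<dots> \<le> liminf (\<lambda>n. \<Phi> n x) + ennreal e" by (intro add_right_mono low e)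
      finally show "ennreal (F x) \<le> liminf (\<lambda>n. \<Phi> n x) + ennreal e" .
    qed
    moreover have "rep l x = 0" if le: "liminf (\<lambda>n. \<Phi> n x) \<le> ennreal (F x)"
    proof (rule ccontr)
      assume "rep l x \<noteq> 0"
      then have "\<eta> > 0" by (rule \<eta>(2))
      then have "ennreal (\<eta> - \<eta> / 2 + F x) \<le> ennreal (F x)" using low[of "\<eta> / 2"] le by simp
      then show False using \<open>\<eta> > 0\<close> elim(6) by (simp add: ennreal_le_iff)
    qed
    ultimately show ?case by blast
  qed
  \<comment> \<open>The lower limit dominates \<open>F\<close> but has no larger integral, so the
    two agree almost everywhere; \<open>pointwise\<close> then says that l vanishes.\<close>
  have "AE x in lebesgue. liminf (\<lambda>n. \<Phi> n x) \<le> ennreal (F x)"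
  proof (rule ccontr)
    assume no: "\<not> ?thesis"
    have "(\<integral>\<^sup>+x. ennreal (F x) \<partial>lebesgue) < (\<integral>\<^sup>+x. liminf (\<lambda>n. \<Phi> n x) \<partial>lebesgue)"
    proof (rule nn_integral_less)
      show "(\<integral>\<^sup>+x. ennreal (F x) \<partial>lebesgue) \<noteq> \<infinity>" by (simp add: F_nn)
      show "AE x in lebesgue. ennreal (F x) \<le> liminf (\<lambda>n. \<Phi> n x)"
        using pointwise by eventually_elim blast
    qed (use no in measurable)
    then show False using fatou by simp
  qed
  with pointwise have "AE x in lebesgue. (rep l x)\<^sup>2 = 0" by eventually_elim simp
  then have "(\<integral>x. (rep l x)\<^sup>2 \<partial>lebesgue) = 0"
    by (rule integral_eq_zero_AE)
  then have "norm l = 0" using norm_rep[of l] by simp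
  then show False using l1 by simp
qed

theorem nonresonant_solution: "\<exists>u\<in>D. \<forall>y\<in>D. B u y = inner (N u) y"
proof -
  obtain r where r: "r > 0" "\<And>u \<tau>. u \<in> D \<Longrightarrow> 0 \<le> \<tau> \<Longrightarrow> \<tau> \<le> 1 \<Longrightarrow>
     (\<And>y. y \<in> D \<Longrightarrow> B u y = inner ((1 - \<tau>) *\<^sub>R \<mu> *\<^sub>R u + \<tau> *\<^sub>R N u) y) \<Longrightarrow> norm u < r"
    using apriori_bound by blast
  show ?thesis by (rule nonlinear_solution[OF continuous_N norm_N b r(2,1)])
qed

end

section \<open>Energy forms of difference quotients\<close>

lemma AE_lborel_fst:
  fixes P :: "'a::euclidean_space \<Rightarrow> bool"
  assumes "AE x in lborel. P x"
  shows "AE p in (lborel :: ('a \<times> 'b::euclidean_space) measure). P (fst p)"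
proof -
  obtain N where N: "{x \<in> space lborel. \<not> P x} \<subseteq> N" "emeasure lborel N = 0" "N \<in> sets lborel"
    using AE_E[OF assms] by metis
  have "emeasure (lborel \<Otimes>\<^sub>M lborel) (N \<times> (UNIV :: 'b set)) = 0"
    using N by (subst lborel.emeasure_pair_measure_Times) auto
  moreover have "N \<times> (UNIV :: 'b set) \<in> sets (lborel \<Otimes>\<^sub>M lborel)" using N(3) by (intro pair_measureI) auto
  ultimately have "N \<times> (UNIV :: 'b set) \<in> null_sets lborel" unfolding lborel_prod[symmetric] by (rule null_setsI)
  then show ?thesis by (rule AE_I') (use N(1) in auto)
qed

lemma AE_lborel_snd:
  fixes P :: "'b::euclidean_space \<Rightarrow> bool"
  assumes "AE x in lborel. P x"
  shows "AE p in (lborel :: ('a::euclidean_space \<times> 'b) measure). P (snd p)"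
proof -
  obtain N where N: "{x \<in> space lborel. \<not> P x} \<subseteq> N" "emeasure lborel N = 0" "N \<in> sets lborel"
    using AE_E[OF assms] by metis
  have "emeasure (lborel \<Otimes>\<^sub>M lborel) ((UNIV :: 'a set) \<times> N) = 0"
    using N by (subst lborel.emeasure_pair_measure_Times) auto
  moreover have "(UNIV :: 'a set) \<times> N \<in> sets (lborel \<Otimes>\<^sub>M lborel)" using N(3) by (intro pair_measureI) auto
  ultimately have "(UNIV :: 'a set) \<times> N \<in> null_sets lborel" unfolding lborel_prod[symmetric] by (rule null_setsI)
  then show ?thesis by (rule AE_I') (use N(1) in auto)
qed

lemma lborel_distr_reflect: "distr lborel borel (\<lambda>y. x - y) = (lborel :: 'a::euclidean_space measure)"
  using lborel_affine[of "-1" x] by (simp add: density_1)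

lemma nn_integral_reflect:
  fixes f :: "'a::euclidean_space \<Rightarrow> ennreal"
  assumes "f \<in> borel_measurable borel"
  shows "(\<integral>\<^sup>+y. f (x - y) \<partial>lborel) = (\<integral>\<^sup>+z. f z \<partial>lborel)"
proof -
  have "(\<integral>\<^sup>+z. f z \<partial>lborel) = (\<integral>\<^sup>+z. f z \<partial>distr lborel borel (\<lambda>y. x - y))"
    by (simp add: lborel_distr_reflect)
  also have "\<dots> = (\<integral>\<^sup>+y. f (x - y) \<partial>lborel)" using assms by (intro nn_integral_distr) auto
  finally show ?thesis by simp
qed

text \<open>By Fubini: each section of the exceptional set is a reflected translate of a null set.
  This carries statements about the kernel at z over to x - y.\<close>

lemma AE_lborel_difference:
  fixes P :: "'a::euclidean_space \<Rightarrow> bool"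
  assumes "AE x in lborel. P x"
  shows "AE p in lborel. P (fst p - snd p)"
proof -
  obtain N where N: "{x \<in> space lborel. \<not> P x} \<subseteq> N" "emeasure lborel N = 0" "N \<in> sets lborel"
    using AE_E[OF assms] by metis
  have [measurable]: "N \<in> sets borel" using N(3) by simp
  define M where "M = {p \<in> space (borel :: ('a \<times> 'a) measure). fst p - snd p \<in> N}"
  have [measurable]: "(\<lambda>p :: 'a \<times> 'a. fst p - snd p) \<in> borel_measurable borel"
    by (intro borel_measurable_continuous_onI continuous_intros)
  have Mb: "M \<in> sets borel"
    unfolding M_def by measurable
  then have M: "M \<in> sets (lborel \<Otimes>\<^sub>M lborel)" unfolding lborel_prod by simp
  have "emeasure (lborel \<Otimes>\<^sub>M lborel) M = (\<integral>\<^sup>+x. emeasure lborel (Pair x -` M) \<partial>lborel)"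
    by (rule lborel.emeasure_pair_measure_alt[OF M])
  also have "\<dots> = (\<integral>\<^sup>+x. 0 \<partial>(lborel :: 'a measure))"
  proof (rule nn_integral_cong)
    fix x :: 'a
    have "emeasure lborel N = emeasure (distr lborel borel (\<lambda>y. x - y)) N" by (simp add: lborel_distr_reflect)
    also have "\<dots> = emeasure lborel ((\<lambda>y. x - y) -` N \<inter> space lborel)" by (rule emeasure_distr) auto
    also have "(\<lambda>y. x - y) -` N \<inter> space lborel = Pair x -` M" by (auto simp: M_def)
    finally show "emeasure lborel (Pair x -` M) = 0" using N(2) by simp
  qed
  finally have "emeasure (lborel \<Otimes>\<^sub>M lborel) M = 0" by simp
  then have "M \<in> null_sets lborel" using M unfolding lborel_prod[symmetric] by (rule null_setsI)
  then show ?thesis by (rule AE_I') (use N(1) in \<open>auto simp: M_def\<close>)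
qed

lemma lebesgue_borel_version:
  fixes h :: "'a::euclidean_space \<Rightarrow> real"
  assumes "h \<in> borel_measurable lebesgue"
  obtains h' where "h' \<in> borel_measurable borel" "AE x in lborel. h x = h' x"
  using completion_ex_borel_measurable_real[of h lborel] assms by auto

text \<open>Replace \<open>h\<close> by a Borel version; the third hypothesis, that preimages of
  null sets are null, makes the change invisible almost everywhere after composition.\<close>

lemma lebesgue_measurable_compose:
  fixes h :: "'a::euclidean_space \<Rightarrow> real" and T :: "'b::euclidean_space \<Rightarrow> 'a"
  assumes h: "h \<in> borel_measurable lebesgue" and T: "T \<in> borel_measurable borel"
    and AE: "\<And>P. (AE x in lborel. P x) \<Longrightarrow> (AE y in lborel. P (T y))"
  shows "(\<lambda>y. h (T y)) \<in> borel_measurable lebesgue"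
proof -
  obtain h' where h': "h' \<in> borel_measurable borel" "AE x in lborel. h x = h' x"
    using lebesgue_borel_version[OF h] .
  have ae: "AE y in lebesgue. h' (T y) = h (T y)"
    unfolding AE_completion_iff using AE[OF h'(2)] by eventually_elim simp
  moreover have "(\<lambda>y. h' (T y)) \<in> borel_measurable lebesgue"
    using h'(1) T by (intro measurable_completion) (simp add: measurable_compose)
  ultimately show ?thesis by (rule borel_measurable_AE[rotated])
qed

locale energy =
  fixes Wt :: "'a::euclidean_space \<times> 'a \<Rightarrow> real" and \<T> :: "('a \<Rightarrow> real) set"
  assumes Wt_borel [measurable]: "Wt \<in> borel_measurable borel" and Wt_nonneg: "\<And>p. 0 \<le> Wt p"
begin

text \<open>With the square root of the weight, the energy form becomes the inner product of L2 on
  pairs. The weight will also absorb the restriction to Q.\<close>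

definition dq :: "('a \<Rightarrow> real) \<Rightarrow> 'a \<times> 'a \<Rightarrow> real" where
  "dq u p = (u (fst p) - u (snd p)) * sqrt (Wt p)"

lemma dq_measurable: "u \<in> borel_measurable lebesgue \<Longrightarrow> dq u \<in> borel_measurable lebesgue"
proof -
  assume u: "u \<in> borel_measurable lebesgue"
  have 1: "(\<lambda>p :: 'a \<times> 'a. u (fst p)) \<in> borel_measurable lebesgue"
    by (rule lebesgue_measurable_compose[OF u _ AE_lborel_fst])
       (intro borel_measurable_continuous_onI continuous_intros)
  have 2: "(\<lambda>p :: 'a \<times> 'a. u (snd p)) \<in> borel_measurable lebesgue"
    by (rule lebesgue_measurable_compose[OF u _ AE_lborel_snd])
       (intro borel_measurable_continuous_onI continuous_intros)
  have 3: "(\<lambda>p. sqrt (Wt p)) \<in> borel_measurable lebesgue"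
    by (intro measurable_completion) simp
  show ?thesis unfolding dq_def[abs_def] using 1 2 3 by measurable
qed

lemma dq_cong: "(AE x in lebesgue. u x = v x) \<Longrightarrow> AE p in lebesgue. dq u p = dq v p"
proof -
  assume "AE x in lebesgue. u x = v x"
  then have ae: "AE x in lborel. u x = v x" by (simp add: AE_completion_iff)
  show ?thesis
    unfolding AE_completion_iff
    using AE_lborel_fst[OF ae, where 'b = 'a] AE_lborel_snd[OF ae, where 'a = 'a]
    by eventually_elim (simp add: dq_def)
qed

lemma dq_add: "dq (\<lambda>x. u x + v x) = (\<lambda>p. dq u p + dq v p)" by (auto simp: dq_def algebra_simps)

lemma dq_diff: "dq (\<lambda>x. u x - v x) = (\<lambda>p. dq u p - dq v p)" by (auto simp: dq_def algebra_simps)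

lemma dq_scale: "dq (\<lambda>x. c * u x) = (\<lambda>p. c * dq u p)" by (auto simp: dq_def algebra_simps)

text \<open>\<open>dq\<close> acts pointwise, hence is closable: along a subsequence both sequences
  converge almost everywhere, the first one at both entries of almost every pair, and this
  determines the second limit.\<close>

lemma dq_closed:
  fixes \<phi> :: "nat \<Rightarrow> 'a \<Rightarrow> real"
  assumes \<phi>: "\<And>n. \<phi> n \<in> sq_int" "\<And>n. dq (\<phi> n) \<in> sq_int"
    and lim: "(\<lambda>n. cls (\<phi> n)) \<longlonglongrightarrow> U" "(\<lambda>n. cls (dq (\<phi> n))) \<longlonglongrightarrow> Y"
  shows "dq (rep U) \<in> sq_int" "cls (dq (rep U)) = Y"
proof -
  obtain r G where r: "strict_mono r"
    and ae1: "AE x in lebesgue. (\<forall>n. (rep (cls (\<phi> (r n))) x)\<^sup>2 \<le> G x) \<and> (\<lambda>n. rep (cls (\<phi> (r n))) x) \<longlonglongrightarrow> rep U x"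
    by (rule l2_convergent_subseq[OF lim(1)])
  obtain s G' where s: "strict_mono s"
    and ae2: "AE x in lebesgue. (\<forall>n. (rep (cls (dq (\<phi> (r (s n))))) x)\<^sup>2 \<le> G' x) \<and>
      (\<lambda>n. rep (cls (dq (\<phi> (r (s n))))) x) \<longlonglongrightarrow> rep Y x"
    by (rule l2_convergent_subseq[OF LIMSEQ_subseq_LIMSEQ[OF lim(2) r, unfolded o_def]])
  have "AE x in lebesgue. \<forall>n. rep (cls (\<phi> n)) x = \<phi> n x"
    unfolding AE_all_countable using rep_cls[OF \<phi>(1)] by blast
  with ae1 have "AE x in lebesgue. (\<lambda>n. \<phi> (r (s n)) x) \<longlonglongrightarrow> rep U x"
  proof eventually_elim
    case (elim x)
    then have "(\<lambda>n. \<phi> (r n) x) \<longlonglongrightarrow> rep U x" by simp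
    from LIMSEQ_subseq_LIMSEQ[OF this s] show ?case by (simp add: o_def)
  qed
  then have ae: "AE x in lborel. (\<lambda>n. \<phi> (r (s n)) x) \<longlonglongrightarrow> rep U x" by (simp add: AE_completion_iff)
  have "AE p in lebesgue. \<forall>n. rep (cls (dq (\<phi> n))) p = dq (\<phi> n) p"
    unfolding AE_all_countable using rep_cls[OF \<phi>(2)] by blast
  moreover have "AE p in lebesgue. (\<lambda>n. \<phi> (r (s n)) (fst p)) \<longlonglongrightarrow> rep U (fst (p :: 'a \<times> 'a))"
    using AE_lborel_fst[OF ae] by (simp add: AE_completion_iff)
  moreover have "AE p in lebesgue. (\<lambda>n. \<phi> (r (s n)) (snd p)) \<longlonglongrightarrow> rep U (snd (p :: 'a \<times> 'a))"
    using AE_lborel_snd[OF ae] by (simp add: AE_completion_iff)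
  ultimately have eq: "AE p in lebesgue. rep Y p = dq (rep U) p"
    using ae2
  proof eventually_elim
    case (elim p)
    have "(\<lambda>n. dq (\<phi> (r (s n))) p) \<longlonglongrightarrow> dq (rep U) p"
      unfolding dq_def by (intro tendsto_intros elim)
    moreover have "(\<lambda>n. dq (\<phi> (r (s n))) p) \<longlonglongrightarrow> rep Y p" using elim by simp
    ultimately show ?case using LIMSEQ_unique by blast
  qed
  have m: "dq (rep U) \<in> borel_measurable lebesgue" by (intro dq_measurable sq_int_measurable) simp
  show "dq (rep U) \<in> sq_int"
    by (rule sq_int_bound[OF m, of "\<lambda>p. (rep Y p)\<^sup>2"])
       (use rep_sq_int[of Y] eq in \<open>auto simp: sq_int_def elim: eventually_mono\<close>)
  then show "cls (dq (rep U)) = Y" using cls_eq_iff[of "dq (rep U)" "rep Y"] eq by (simp add: eq_commute)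
qed

end

section \<open>The form domain generated by the test functions\<close>

lemma closure_subspace_inner:
  fixes S :: "'h::real_normed_vector set"
  assumes "subspace S" shows "subspace (closure S)"
proof (rule subspaceI)
  show "0 \<in> closure S" using subspace_0[OF assms] closure_subset by blast
next
  fix x y assume "x \<in> closure S" "y \<in> closure S"
  then obtain f g where fg: "\<And>n :: nat. f n \<in> S" "f \<longlonglongrightarrow> x" "\<And>n :: nat. g n \<in> S" "g \<longlonglongrightarrow> y"
    unfolding closure_sequential by blast
  show "x + y \<in> closure S" unfolding closure_sequential
    by (rule exI[of _ "\<lambda>n. f n + g n"]) (use fg assms in \<open>auto intro: tendsto_add subspace_add\<close>)
next
  fix c x assume "x \<in> closure S"
  then obtain f where f: "\<And>n :: nat. f n \<in> S" "f \<longlonglongrightarrow> x" unfolding closure_sequential by blast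
  show "c *\<^sub>R x \<in> closure S" unfolding closure_sequential
    by (rule exI[of _ "\<lambda>n. c *\<^sub>R f n"]) (use f assms in \<open>auto intro: tendsto_intros subspace_scale\<close>)
qed

locale energy_space = energy Wt \<T> for Wt :: "'a::euclidean_space \<times> 'a \<Rightarrow> real" and \<T> +
  assumes \<T>_zero: "(\<lambda>_. 0) \<in> \<T>"
    and \<T>_add: "\<And>u v. u \<in> \<T> \<Longrightarrow> v \<in> \<T> \<Longrightarrow> (\<lambda>x. u x + v x) \<in> \<T>"
    and \<T>_scale: "\<And>u c. u \<in> \<T> \<Longrightarrow> (\<lambda>x. c * u x) \<in> \<T>"
    and \<T>_sq_int: "\<And>u. u \<in> \<T> \<Longrightarrow> u \<in> sq_int"
    and \<T>_dq: "\<And>u. u \<in> \<T> \<Longrightarrow> dq u \<in> sq_int"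
begin

definition \<Gamma> :: "('a \<Rightarrow> real) \<Rightarrow> 'a l2 \<times> ('a \<times> 'a) l2" where "\<Gamma> u = (cls u, cls (dq u))"

definition C :: "('a l2 \<times> ('a \<times> 'a) l2) set" where "C = closure (\<Gamma> ` \<T>)"

definition D :: "'a l2 set" where "D = fst ` C"

definition \<E> :: "'a l2 \<Rightarrow> ('a \<times> 'a) l2" where "\<E> U = cls (dq (rep U))"

definition B :: "'a l2 \<Rightarrow> 'a l2 \<Rightarrow> real" where "B U V = inner (\<E> U) (\<E> V)"

lemma \<Gamma>_add: "u \<in> \<T> \<Longrightarrow> v \<in> \<T> \<Longrightarrow> \<Gamma> (\<lambda>x. u x + v x) = \<Gamma> u + \<Gamma> v"
  by (simp add: \<Gamma>_def dq_add cls_add \<T>_sq_int \<T>_dq)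

lemma \<Gamma>_scale: "u \<in> \<T> \<Longrightarrow> \<Gamma> (\<lambda>x. c * u x) = c *\<^sub>R \<Gamma> u"
  by (simp add: \<Gamma>_def dq_scale cls_scale \<T>_sq_int \<T>_dq)

lemma subspace_C: "subspace C"
  unfolding C_def
proof (rule closure_subspace_inner, rule subspaceI)
  show "0 \<in> \<Gamma> ` \<T>" using \<Gamma>_scale[OF \<T>_zero, of 0] \<T>_zero by (metis image_eqI mult_zero_left scaleR_zero_left)
  show "x + y \<in> \<Gamma> ` \<T>" if "x \<in> \<Gamma> ` \<T>" "y \<in> \<Gamma> ` \<T>" for x y
    using that by (auto simp flip: \<Gamma>_add intro: \<T>_add)
  show "c *\<^sub>R x \<in> \<Gamma> ` \<T>" if "x \<in> \<Gamma> ` \<T>" for x c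
    using that by (auto simp flip: \<Gamma>_scale intro: \<T>_scale)
qed

text \<open>By \<open>dq_closed\<close> the closure of the graph is again a graph, namely that of
  \<E> on \<open>D\<close>.\<close>

lemma C_graph: assumes "(U, Y) \<in> C" shows "dq (rep U) \<in> sq_int" "\<E> U = Y"
proof -
  obtain f where f: "\<And>n :: nat. f n \<in> \<Gamma> ` \<T>" "f \<longlonglongrightarrow> (U, Y)"
    using assms unfolding C_def closure_sequential by blast
  then have "\<forall>n. \<exists>\<phi>. \<phi> \<in> \<T> \<and> f n = \<Gamma> \<phi>" by blast
  then obtain \<phi> where \<phi>: "\<And>n. \<phi> n \<in> \<T>" "\<And>n. f n = \<Gamma> (\<phi> n)" by metis
  have "(\<lambda>n. cls (\<phi> n)) \<longlonglongrightarrow> U" "(\<lambda>n. cls (dq (\<phi> n))) \<longlonglongrightarrow> Y"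
    using tendsto_fst[OF f(2)] tendsto_snd[OF f(2)] by (simp_all add: \<phi>(2) \<Gamma>_def)
  from dq_closed[OF \<T>_sq_int \<T>_dq this] \<phi>(1)
  show "dq (rep U) \<in> sq_int" "\<E> U = Y" by (auto simp: \<E>_def)
qed

lemma D_iff: "U \<in> D \<longleftrightarrow> (U, \<E> U) \<in> C"
proof
  assume "U \<in> D"
  then obtain Y where "(U, Y) \<in> C" by (auto simp: D_def)
  then show "(U, \<E> U) \<in> C" using C_graph(2) by blast
qed (auto simp: D_def intro: rev_image_eqI)

lemma D_dq: "U \<in> D \<Longrightarrow> dq (rep U) \<in> sq_int" using D_iff[of U] C_graph(1)[of U "\<E> U"] by simp

lemma D_approx:
  assumes "U \<in> D"
  obtains \<phi> where "\<And>n :: nat. \<phi> n \<in> \<T>" "(\<lambda>n. cls (\<phi> n)) \<longlonglongrightarrow> U" "(\<lambda>n. cls (dq (\<phi> n))) \<longlonglongrightarrow> \<E> U"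
proof -
  obtain f where f: "\<And>n :: nat. f n \<in> \<Gamma> ` \<T>" "f \<longlonglongrightarrow> (U, \<E> U)"
    using assms unfolding D_iff C_def closure_sequential by blast
  then have "\<forall>n. \<exists>\<phi>. \<phi> \<in> \<T> \<and> f n = \<Gamma> \<phi>" by blast
  then obtain \<phi> where \<phi>: "\<And>n. \<phi> n \<in> \<T>" "\<And>n. f n = \<Gamma> (\<phi> n)" by metis
  have "(\<lambda>n. cls (\<phi> n)) \<longlonglongrightarrow> U" "(\<lambda>n. cls (dq (\<phi> n))) \<longlonglongrightarrow> \<E> U"
    using tendsto_fst[OF f(2)] tendsto_snd[OF f(2)] by (simp_all add: \<phi>(2) \<Gamma>_def)
  then show thesis using \<phi>(1) that by blast
qed

lemma D_limit:
  assumes "\<And>n :: nat. \<phi> n \<in> \<T>" "(\<lambda>n. cls (\<phi> n)) \<longlonglongrightarrow> U" "(\<lambda>n. cls (dq (\<phi> n))) \<longlonglongrightarrow> Y"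
  shows "U \<in> D" "\<E> U = Y"
proof -
  have "(\<lambda>n. \<Gamma> (\<phi> n)) \<longlonglongrightarrow> (U, Y)" unfolding \<Gamma>_def using assms(2,3) by (rule tendsto_Pair)
  then have "(U, Y) \<in> C" unfolding C_def closure_sequential
    using assms(1) by (intro exI[of _ "\<lambda>n. \<Gamma> (\<phi> n)"]) auto
  then show "U \<in> D" "\<E> U = Y" using C_graph(2) by (auto simp: D_def intro: rev_image_eqI)
qed

lemma \<E>_cls:
  assumes "u \<in> sq_int" "dq u \<in> sq_int" shows "\<E> (cls u) = cls (dq u)"
proof -
  have ae: "AE p in lebesgue. dq (rep (cls u)) p = dq u p" by (rule dq_cong[OF rep_cls[OF assms(1)]])
  have "dq (rep (cls u)) \<in> sq_int"
  proof (rule sq_int_bound)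
    show "dq (rep (cls u)) \<in> borel_measurable lebesgue" by (intro dq_measurable sq_int_measurable) simp
    show "integrable lebesgue (\<lambda>p. (dq u p)\<^sup>2)" using assms(2) by (simp add: sq_int_def)
    show "AE p in lebesgue. (dq (rep (cls u)) p)\<^sup>2 \<le> (dq u p)\<^sup>2" using ae by eventually_elim simp
  qed
  then show ?thesis unfolding \<E>_def using cls_eq_iff[OF _ assms(2)] ae by simp
qed

lemma \<E>_add: assumes "U \<in> D" "V \<in> D" shows "U + V \<in> D" "\<E> (U + V) = \<E> U + \<E> V"
proof -
  have "(U + V, \<E> U + \<E> V) \<in> C"
    using subspace_add[OF subspace_C, of "(U, \<E> U)" "(V, \<E> V)"] assms by (simp add: D_iff)
  then show "U + V \<in> D" "\<E> (U + V) = \<E> U + \<E> V" using C_graph(2) by (auto simp: D_def intro: rev_image_eqI)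
qed

lemma \<E>_scale: assumes "U \<in> D" shows "c *\<^sub>R U \<in> D" "\<E> (c *\<^sub>R U) = c *\<^sub>R \<E> U"
proof -
  have "(c *\<^sub>R U, c *\<^sub>R \<E> U) \<in> C"
    using subspace_scale[OF subspace_C, of "(U, \<E> U)"] assms by (simp add: D_iff)
  then show "c *\<^sub>R U \<in> D" "\<E> (c *\<^sub>R U) = c *\<^sub>R \<E> U" using C_graph(2) by (auto simp: D_def intro: rev_image_eqI)
qed

lemma zero_in_D: "0 \<in> D"
  using imageI[OF subspace_0[OF subspace_C], of fst] by (simp add: D_def)

sublocale nonneg_form D B
proof
  show "subspace D" by (rule subspaceI) (auto simp: zero_in_D \<E>_add \<E>_scale)
  show "B x y = B y x" for x y unfolding B_def by (rule inner_commute)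
qed (auto simp: B_def \<E>_add \<E>_scale inner_add_left)

text \<open>The graph norm is the product norm on the pairs (U, \<E> U), and these make up a closed
  set in a complete space.\<close>

lemma form_complete:
  assumes x: "\<And>n. x n \<in> D"
    and C: "\<And>e. e > 0 \<Longrightarrow> \<exists>N. \<forall>m\<ge>N. \<forall>n\<ge>N. B (x m - x n) (x m - x n) + (norm (x m - x n))\<^sup>2 < e"
  shows "\<exists>l\<in>D. (\<lambda>n. B (x n - l) (x n - l) + (norm (x n - l))\<^sup>2) \<longlonglongrightarrow> 0"
proof -
  have E_diff: "\<E> (U - V) = \<E> U - \<E> V" if "U \<in> D" "V \<in> D" for U V
    using \<E>_add(2)[of U "(-1) *\<^sub>R V"] \<E>_scale[of V "-1"] that by simp
  have q: "B (U - V) (U - V) + (norm (U - V))\<^sup>2 = (norm ((U, \<E> U) - (V, \<E> V)))\<^sup>2" if "U \<in> D" "V \<in> D" for U V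
    using that by (simp add: B_def E_diff norm_prod_def power2_norm_eq_inner)
  have "Cauchy (\<lambda>n. (x n, \<E> (x n)))"
    unfolding Cauchy_def
  proof (intro allI impI)
    fix e :: real assume e: "e > 0"
    obtain N where N: "\<forall>m\<ge>N. \<forall>n\<ge>N. B (x m - x n) (x m - x n) + (norm (x m - x n))\<^sup>2 < e\<^sup>2"
      using C[of "e\<^sup>2"] e by auto
    have "dist (x m, \<E> (x m)) (x n, \<E> (x n)) < e" if "m \<ge> N" "n \<ge> N" for m n
    proof -
      have "(norm ((x m, \<E> (x m)) - (x n, \<E> (x n))))\<^sup>2 < e\<^sup>2"
        using N that q[OF x x, of m n] by metis
      then show ?thesis unfolding dist_norm by (rule power2_less_imp_less) (use e in simp)
    qed
    then show "\<exists>M. \<forall>m\<ge>M. \<forall>n\<ge>M. dist (x m, \<E> (x m)) (x n, \<E> (x n)) < e" by blast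
  qed
  then obtain L where L: "(\<lambda>n. (x n, \<E> (x n))) \<longlonglongrightarrow> L" using Cauchy_convergent convergent_def by blast
  have "closed C" by (simp add: C_def)
  then have "L \<in> C" by (rule closed_sequentially[OF _ _ L]) (use x D_iff in blast)
  then have l: "fst L \<in> D" "\<E> (fst L) = snd L" using C_graph(2)[of "fst L" "snd L"] by (auto simp: D_def)
  have "(\<lambda>n. norm ((x n, \<E> (x n)) - L)) \<longlonglongrightarrow> 0" using L by (simp add: LIM_zero tendsto_norm_zero)
  from tendsto_power[OF this, of 2]
  have "(\<lambda>n. (norm ((x n, \<E> (x n)) - (fst L, \<E> (fst L))))\<^sup>2) \<longlonglongrightarrow> 0" by (simp add: l)
  then have "(\<lambda>n. B (x n - fst L) (x n - fst L) + (norm (x n - fst L))\<^sup>2) \<longlonglongrightarrow> 0"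
    using q[OF x l(1)] by simp
  then show ?thesis using l(1) by blast
qed

end

section \<open>Test functions\<close>

lemma class_C_add: "class_C k u \<Longrightarrow> class_C k v \<Longrightarrow> class_C k (\<lambda>x. u x + v x)"
proof (induction k arbitrary: u v)
  case 0 then show ?case by (auto intro: continuous_intros)
next
  case (Suc k)
  then have d: "u differentiable at x" "v differentiable at x" for x
    by (auto simp: differentiable_on_def)
  have "partial_deriv i (\<lambda>x. u x + v x) = (\<lambda>x. partial_deriv i u x + partial_deriv i v x)" for i
  proof
    fix x
    have "frechet_derivative (\<lambda>x. u x + v x) (at x)
        = (\<lambda>h. frechet_derivative u (at x) h + frechet_derivative v (at x) h)"
      using d[of x] by (intro frechet_derivative_at[symmetric] has_derivative_add)
        (auto simp: frechet_derivative_works)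
    then show "partial_deriv i (\<lambda>x. u x + v x) x = partial_deriv i u x + partial_deriv i v x"
      by (simp add: partial_deriv_def)
  qed
  then show ?case using Suc by (auto intro: differentiable_on_add)
qed

lemma class_C_scale: "class_C k u \<Longrightarrow> class_C k (\<lambda>x. c * u x)"
proof (induction k arbitrary: u)
  case 0 then show ?case by (auto intro: continuous_intros)
next
  case (Suc k)
  then have d: "u differentiable at x" for x
    by (auto simp: differentiable_on_def)
  have "partial_deriv i (\<lambda>x. c * u x) = (\<lambda>x. c * partial_deriv i u x)" for i
  proof
    fix x
    have "frechet_derivative (\<lambda>x. c * u x) (at x) = (\<lambda>h. c * frechet_derivative u (at x) h)"
      using d[of x] by (intro frechet_derivative_at[symmetric] has_derivative_mult_right)
        (auto simp: frechet_derivative_works)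
    then show "partial_deriv i (\<lambda>x. c * u x) x = c * partial_deriv i u x"
      by (simp add: partial_deriv_def)
  qed
  then show ?case using Suc by (auto intro: differentiable_on_mult differentiable_on_const)
qed

lemma class_C_zero: "class_C k (\<lambda>_. 0 :: real)"
proof (induction k)
  case 0 then show ?case by simp
next
  case (Suc k)
  have "partial_deriv i (\<lambda>_. 0 :: real) = (\<lambda>_. 0)" for i :: 'a
    by (auto simp: partial_deriv_def frechet_derivative_const)
  then show ?case using Suc by (simp add: differentiable_on_const)
qed

lemma closure_support_subset:
  assumes "\<And>x. w x \<noteq> 0 \<Longrightarrow> u x \<noteq> 0 \<or> v x \<noteq> (0::real)"
    "closure {x. u x \<noteq> 0} \<subseteq> \<Omega>" "closure {x. v x \<noteq> 0} \<subseteq> \<Omega>"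
    "compact (closure {x. u x \<noteq> 0})" "compact (closure {x. v x \<noteq> 0})"
  shows "compact (closure {x :: real^'n. w x \<noteq> 0})" "closure {x. w x \<noteq> 0} \<subseteq> \<Omega>"
proof -
  have sub: "closure {x. w x \<noteq> 0} \<subseteq> closure {x. u x \<noteq> 0} \<union> closure {x. v x \<noteq> 0}"
    unfolding closure_Un[symmetric] using assms(1) by (intro closure_mono) auto
  then show "closure {x. w x \<noteq> 0} \<subseteq> \<Omega>" using assms(2,3) by blast
  have "compact (closure {x. u x \<noteq> 0} \<union> closure {x. v x \<noteq> 0})" using assms(4,5) by (rule compact_Un)
  then show "compact (closure {x. w x \<noteq> 0})"
    using sub by (metis closed_closure compact_Int_closed inf.absorb_iff2)
qed

lemma test_functionsD:
  assumes "u \<in> test_functions \<Omega>"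
  shows "class_C k u" "compact (closure {x. u x \<noteq> 0})" "closure {x. u x \<noteq> 0} \<subseteq> \<Omega>"
  using assms by (simp_all add: test_functions_def)

lemma test_functions_add:
  assumes u: "u \<in> test_functions \<Omega>" and v: "v \<in> test_functions \<Omega>"
  shows "(\<lambda>x. u x + v x) \<in> test_functions \<Omega>"
proof -
  have "u x \<noteq> 0 \<or> v x \<noteq> 0" if "u x + v x \<noteq> 0" for x using that by auto
  note supp = closure_support_subset[of "\<lambda>x. u x + v x" u v \<Omega>, OF this test_functionsD(3)[OF u]
      test_functionsD(3)[OF v] test_functionsD(2)[OF u] test_functionsD(2)[OF v]]
  show ?thesis unfolding test_functions_def mem_Collect_eq
    using supp class_C_add[OF test_functionsD(1)[OF u] test_functionsD(1)[OF v]] by blast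
qed

lemma test_functions_scale:
  assumes u: "u \<in> test_functions \<Omega>"
  shows "(\<lambda>x. c * u x) \<in> test_functions \<Omega>"
proof -
  have "u x \<noteq> 0 \<or> u x \<noteq> 0" if "c * u x \<noteq> 0" for x using that by auto
  note supp = closure_support_subset[of "\<lambda>x. c * u x" u u \<Omega>, OF this test_functionsD(3)[OF u]
      test_functionsD(3)[OF u] test_functionsD(2)[OF u] test_functionsD(2)[OF u]]
  show ?thesis unfolding test_functions_def mem_Collect_eq
    using supp class_C_scale[OF test_functionsD(1)[OF u]] by blast
qed

lemma test_functions_zero: "(\<lambda>_. 0) \<in> test_functions \<Omega>"
  by (simp add: test_functions_def class_C_zero)

lemma test_functions_continuous: "u \<in> test_functions \<Omega> \<Longrightarrow> continuous_on UNIV u"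
  using test_functionsD(1)[of u \<Omega> 0] by simp

lemma test_functions_vanish: "u \<in> test_functions \<Omega> \<Longrightarrow> x \<notin> \<Omega> \<Longrightarrow> u x = 0"
  using test_functionsD(3)[of u \<Omega>] closure_subset[of "{x. u x \<noteq> 0}"] by blast

lemma compact_support_bounded:
  fixes g :: "'a::topological_space \<Rightarrow> real"
  assumes "continuous_on UNIV g" "compact S" "\<And>x. x \<notin> S \<Longrightarrow> g x = 0"
  obtains M where "M \<ge> 0" "\<And>x. \<bar>g x\<bar> \<le> M"
proof -
  have "compact (g ` S)" using assms(1,2) by (meson compact_continuous_image continuous_on_subset subset_UNIV)
  then obtain M where "\<And>x. x \<in> S \<Longrightarrow> \<bar>g x\<bar> \<le> M"
    using compact_imp_bounded bounded_iff by (metis image_eqI real_norm_def)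
  then have "\<bar>g x\<bar> \<le> max M 0" for x using assms(3)[of x] by (cases "x \<in> S") (auto simp: le_max_iff_disj)
  then show thesis by (intro that[of "max M 0"]) auto
qed

text \<open>The partial derivatives are continuous and vanish outside the compact support, hence are
  bounded; the mean value inequality does the rest.\<close>

lemma test_functions_Lipschitz:
  fixes u :: "real^'n::finite \<Rightarrow> real"
  assumes u: "u \<in> test_functions \<Omega>"
  obtains L where "L \<ge> 0" "\<And>x y. \<bar>u x - u y\<bar> \<le> L * norm (x - y)"
proof -
  define S where "S = closure {x. u x \<noteq> 0}"
  have S: "compact S" using u by (simp add: test_functions_def S_def)
  have "class_C (Suc 0) u" using u by (rule test_functionsD(1))
  then have d: "\<And>x. u differentiable at x" and pc: "\<And>i. continuous_on UNIV (partial_deriv i u)"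
    by (auto simp: differentiable_on_def)
  have D: "(u has_derivative frechet_derivative u (at x)) (at x)" for x
    using d frechet_derivative_works by blast
  have zero: "partial_deriv i u x = 0" if "x \<notin> S" for i x
  proof -
    have "(u has_derivative (\<lambda>_. 0)) (at x)"
    proof (rule has_derivative_transform_within_open[of "\<lambda>_. 0"])
      show "open (- S)" by (simp add: S_def open_Compl)
      show "x \<in> - S" using that by simp
      show "0 = u y" if "y \<in> - S" for y using that closure_subset[of "{x. u x \<noteq> 0}"] by (auto simp: S_def)
    qed (rule has_derivative_const)
    then show ?thesis using frechet_derivative_at unfolding partial_deriv_def by metis
  qed
  have "\<exists>M\<ge>0. \<forall>x. \<bar>partial_deriv i u x\<bar> \<le> M" for i
    using compact_support_bounded[OF pc S zero] by metis
  then obtain M where M: "\<And>i. 0 \<le> M i" "\<And>i x. \<bar>partial_deriv i u x\<bar> \<le> M i" by metis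
  define L where "L = (\<Sum>i\<in>UNIV. M i)"
  have bound: "norm (frechet_derivative u (at x) h) \<le> L * norm h" for x h
  proof -
    have lin: "linear (frechet_derivative u (at x))"
      using D has_derivative_linear by blast
    have h: "h = (\<Sum>i\<in>UNIV. (h $ i) *\<^sub>R axis i 1)"
      using basis_expansion[of h] by (simp add: scalar_mult_eq_scaleR)
    have "frechet_derivative u (at x) h = (\<Sum>i\<in>UNIV. (h $ i) * partial_deriv i u x)"
      by (subst h) (simp add: linear_sum[OF lin] linear_scale[OF lin] partial_deriv_def)
    also have "\<bar>\<dots>\<bar> \<le> (\<Sum>i\<in>UNIV. M i * norm h)"
    proof (rule order_trans[OF sum_abs], rule sum_mono)
      fix i
      show "\<bar>h $ i * partial_deriv i u x\<bar> \<le> M i * norm h"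
        using mult_mono[OF M(2)[of i x] component_le_norm_cart[of h i]] M(1)[of i]
        by (simp add: abs_mult mult.commute)
    qed
    finally show ?thesis by (simp add: L_def sum_distrib_right)
  qed
  have "\<bar>u x - u y\<bar> \<le> L * norm (x - y)" for x y
    using differentiable_bound[of UNIV u "\<lambda>x. frechet_derivative u (at x)" L x y] D bound
    by (simp add: onorm_le)
  moreover have "L \<ge> 0" unfolding L_def by (intro sum_nonneg M)
  ultimately show thesis by (rule that[rotated])
qed

section \<open>The space Z\<close>

lemma borel_fst [measurable]: "fst \<in> borel_measurable (borel :: ('a::euclidean_space \<times> 'b::euclidean_space) measure)"
  and borel_snd [measurable]: "snd \<in> borel_measurable (borel :: ('a::euclidean_space \<times> 'b::euclidean_space) measure)"
  by (intro borel_measurable_continuous_onI continuous_intros)+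

locale kernel =
  fixes \<Omega> :: "(real^'n::finite) set" and K :: "real^'n \<Rightarrow> real" and \<theta> s :: real
  assumes open_Omega: "open \<Omega>" and bounded_Omega: "bounded \<Omega>" and Omega_ne: "\<Omega> \<noteq> {}"
    and K_meas: "K \<in> borel_measurable (lebesgue_on (- {0}))"
    and K_int: "integrable (lebesgue_on (- {0})) (\<lambda>x. min ((norm x)\<^sup>2) 1 * K x)"
    and \<theta>: "\<theta> > 0" and s: "0 < s"
    and K_lower: "\<And>x. x \<noteq> 0 \<Longrightarrow> K x \<ge> \<theta> * norm x powr (- (real CARD('n) + 2 * s))"
begin

text \<open>A multiple of the kernel of the fractional Laplacian of order s. At 0 its value is 0,
  since \<open>powr\<close> with base 0 is 0.\<close>

definition low :: "real^'n \<Rightarrow> real" where "low x = \<theta> * norm x powr (- (real CARD('n) + 2 * s))"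

text \<open>A Borel version of the kernel that satisfies the lower bound everywhere.\<close>

definition k :: "real^'n \<Rightarrow> real" where
  "k x = max (low x) ((SOME h. h \<in> borel_measurable borel \<and> (AE x in lborel. (if x \<in> -{0} then K x else 0) = h x)) x)"

lemma k_borel [measurable]: "k \<in> borel_measurable borel"
  and AE_k: "AE x in lborel. x \<noteq> 0 \<and> k x = K x"
proof -
  have "(\<lambda>x. if x \<in> -{0} then K x else 0) \<in> borel_measurable lebesgue"
    using K_meas by (subst borel_measurable_if) auto
  then have "\<exists>h. h \<in> borel_measurable borel \<and> (AE x in lborel. (if x \<in> -{0} then K x else 0) = h x)"
    by (rule lebesgue_borel_version) blast
  from someI_ex[OF this]
  obtain h where h: "h \<in> borel_measurable borel" "AE x in lborel. (if x \<in> -{0} then K x else 0) = h x"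
    and k: "k = (\<lambda>x. max (low x) (h x))" by (auto simp: k_def[abs_def])
  have [measurable]: "low \<in> borel_measurable borel" unfolding low_def by measurable
  show "k \<in> borel_measurable borel" unfolding k using h(1) by measurable
  have "AE x in lborel. x \<noteq> (0 :: real^'n)" by (rule AE_lborel_singleton)
  with h(2) show "AE x in lborel. x \<noteq> 0 \<and> k x = K x"
  proof eventually_elim
    case (elim x)
    then have "low x \<le> h x" using K_lower[of x] by (simp add: low_def)
    then show ?case using elim by (simp add: k)
  qed
qed

lemma low_le_k: "low x \<le> k x" by (simp add: k_def)

lemma low_pos: "x \<noteq> 0 \<Longrightarrow> low x > 0" using \<theta> by (simp add: low_def)

lemma k_nonneg: "0 \<le> k x" using low_le_k[of x] \<theta> by (auto simp: low_def intro: order_trans[rotated])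

lemma k_integral: "(\<integral>\<^sup>+x. ennreal (min ((norm x)\<^sup>2) 1 * k x) \<partial>lborel) < \<infinity>"
proof -
  have "integrable lebesgue (\<lambda>x. indicator (-{0}) x *\<^sub>R (min ((norm x)\<^sup>2) 1 * K x))"
    using K_int by (subst (asm) integrable_restrict_space) auto
  then have "(\<integral>\<^sup>+x. ennreal (norm (indicator (-{0}) x *\<^sub>R (min ((norm x)\<^sup>2) 1 * K x))) \<partial>lebesgue) < \<infinity>"
    by (simp add: integrable_iff_bounded)
  also have "(\<integral>\<^sup>+x. ennreal (norm (indicator (-{0}) x *\<^sub>R (min ((norm x)\<^sup>2) 1 * K x))) \<partial>lebesgue)
      = (\<integral>\<^sup>+x. ennreal (min ((norm x)\<^sup>2) 1 * k x) \<partial>lborel)"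
    unfolding nn_integral_completion
  proof (rule nn_integral_cong_AE)
    show "AE x in lborel. ennreal (norm (indicator (-{0}) x *\<^sub>R (min ((norm x)\<^sup>2) 1 * K x)))
        = ennreal (min ((norm x)\<^sup>2) 1 * k x)"
      using AE_k
    proof eventually_elim
      case (elim x)
      then have "K x \<ge> 0" using k_nonneg[of x] by simp
      then show ?case using elim by (simp add: abs_mult min_def)
    qed
  qed
  finally show ?thesis .
qed

definition Wt :: "(real^'n) \<times> (real^'n) \<Rightarrow> real" where "Wt p = indicator (Q \<Omega>) p * k (fst p - snd p)"

lemma Q_iff: "p \<in> Q \<Omega> \<longleftrightarrow> fst p \<in> \<Omega> \<or> snd p \<in> \<Omega>"
  by (cases p) (auto simp: Q_def)

lemma Q_borel [measurable]: "Q \<Omega> \<in> sets borel"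
  unfolding Q_def using open_Omega by (intro borel_open open_Compl closed_Times) auto

lemma diff_borel [measurable]: "(\<lambda>p. fst p - snd p) \<in> borel_measurable (borel :: ((real^'n) \<times> (real^'n)) measure)"
  by (intro borel_measurable_continuous_onI continuous_intros)

sublocale energy Wt "test_functions \<Omega>"
proof
  have [measurable]: "(\<lambda>p :: (real^'n) \<times> (real^'n). k (fst p - snd p)) \<in> borel_measurable borel"
    by (rule measurable_compose[OF diff_borel k_borel])
  show "Wt \<in> borel_measurable borel" unfolding Wt_def by measurable
qed (simp add: Wt_def k_nonneg)

text \<open>The kernel and its Borel version differ only where x - y lies in a null set, the
  diagonal included. The right-hand side has the shape that integrals restricted to Q take.\<close>

lemma AE_Wt:
  assumes u: "u \<in> borel_measurable lebesgue" and v: "v \<in> borel_measurable lebesgue"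
  shows "AE p in lebesgue. dq u p * dq v p
    = indicator (Q \<Omega>) p *\<^sub>R (case p of (x, y) \<Rightarrow> (u x - u y) * (v x - v y) * K (x - y))"
  unfolding AE_completion_iff using AE_lborel_difference[OF AE_k]
proof eventually_elim
  case (elim p)
  have "dq u p * dq v p = (u (fst p) - u (snd p)) * (v (fst p) - v (snd p)) * (sqrt (Wt p) * sqrt (Wt p))"
    by (simp add: dq_def)
  also have "sqrt (Wt p) * sqrt (Wt p) = Wt p" by (simp add: Wt_nonneg)
  also have "Wt p = indicator (Q \<Omega>) p * K (fst p - snd p)" using elim by (simp add: Wt_def[of p])
  finally show ?case by (simp add: case_prod_unfold)
qed

lemma Q_lebesgue: "Q \<Omega> \<in> sets lebesgue" by (simp add: sets_completionI_sets)

lemma Omega_lebesgue [measurable]: "\<Omega> \<in> sets lebesgue" "\<Omega> \<in> sets borel"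
  using open_Omega by (auto simp: borel_open)

lemma pair_integrand_measurable:
  assumes u: "u \<in> borel_measurable lebesgue" and v: "v \<in> borel_measurable lebesgue"
  shows "(\<lambda>p. indicator (Q \<Omega>) p *\<^sub>R (case p of (x, y) \<Rightarrow> (u x - u y) * (v x - v y) * K (x - y)))
    \<in> borel_measurable lebesgue"
  by (rule borel_measurable_AE[OF _ AE_Wt[OF u v]]) (use dq_measurable[OF u] dq_measurable[OF v] in measurable)

lemma inner_Z_dq:
  assumes u: "u \<in> borel_measurable lebesgue" and v: "v \<in> borel_measurable lebesgue"
  shows "inner_Z \<Omega> K u v = (\<integral>p. dq u p * dq v p \<partial>lebesgue)"
proof -
  have "inner_Z \<Omega> K u v = (\<integral>p. indicator (Q \<Omega>) p *\<^sub>R (case p of (x, y) \<Rightarrow> (u x - u y) * (v x - v y) * K (x - y)) \<partial>lebesgue)"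
    unfolding inner_Z_def using Q_lebesgue by (subst integral_restrict_space) auto
  also have "\<dots> = (\<integral>p. dq u p * dq v p \<partial>lebesgue)"
  proof (rule integral_cong_AE)
    show "AE p in lebesgue. indicator (Q \<Omega>) p *\<^sub>R (case p of (x, y) \<Rightarrow> (u x - u y) * (v x - v y) * K (x - y))
        = dq u p * dq v p" using AE_Wt[OF u v] by eventually_elim simp
    show "(\<lambda>p. dq u p * dq v p) \<in> borel_measurable lebesgue"
      using dq_measurable[OF u] dq_measurable[OF v] by measurable
  qed (rule pair_integrand_measurable[OF u v])
  finally show ?thesis .
qed

lemma space_X_iff: "u \<in> space_X \<Omega> K \<longleftrightarrow> u \<in> borel_measurable lebesgue \<and> dq u \<in> sq_int"
proof (cases "u \<in> borel_measurable lebesgue")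
  case True
  have "integrable (lebesgue_on (Q \<Omega>)) (\<lambda>(x, y). (u x - u y)\<^sup>2 * K (x - y)) \<longleftrightarrow>
    integrable lebesgue (\<lambda>p. indicator (Q \<Omega>) p *\<^sub>R (case p of (x, y) \<Rightarrow> (u x - u y) * (u x - u y) * K (x - y)))"
    using Q_lebesgue by (subst integrable_restrict_space) (auto simp: power2_eq_square)
  also have "\<dots> \<longleftrightarrow> integrable lebesgue (\<lambda>p. dq u p * dq u p)"
  proof (rule integrable_cong_AE)
    show "AE p in lebesgue. indicator (Q \<Omega>) p *\<^sub>R (case p of (x, y) \<Rightarrow> (u x - u y) * (u x - u y) * K (x - y))
        = dq u p * dq u p" using AE_Wt[OF True True] by eventually_elim simp
    show "(\<lambda>p. dq u p * dq u p) \<in> borel_measurable lebesgue"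
      using dq_measurable[OF True] by measurable
  qed (rule pair_integrand_measurable[OF True True])
  finally show ?thesis using True dq_measurable[OF True] by (simp add: space_X_def sq_int_def power2_eq_square)
qed (simp add: space_X_def)

lemma norm_X_dq:
  assumes u: "u \<in> borel_measurable lebesgue"
  shows "norm_X \<Omega> K u = sqrt ((\<integral>x. (u x)\<^sup>2 \<partial>lebesgue_on \<Omega>) + (\<integral>p. (dq u p)\<^sup>2 \<partial>lebesgue))"
proof -
  have "(\<integral>(x, y). \<bar>u x - u y\<bar>\<^sup>2 * K (x - y) \<partial>lebesgue_on (Q \<Omega>)) = inner_Z \<Omega> K u u"
    unfolding inner_Z_def power2_abs by (simp add: power2_eq_square)
  then show ?thesis unfolding norm_X_def power2_abs by (simp add: inner_Z_dq[OF u u] power2_eq_square)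
qed

lemma Omega_measure: "emeasure lborel \<Omega> < \<infinity>" "emeasure lborel \<Omega> > 0"
proof -
  show "emeasure lborel \<Omega> < \<infinity>" by (rule emeasure_bounded_finite[OF bounded_Omega])
  have "\<not> negligible \<Omega>" using open_Omega Omega_ne open_not_negligible by blast
  then show "emeasure lborel \<Omega> > 0"
    using Omega_lebesgue by (auto simp: negligible_iff_null_sets null_sets_def zero_less_iff_neq_zero)
qed

text \<open>\<Omega> has positive measure. This selects a good point, for instance when one variable
  of a double integral is frozen.\<close>

lemma AE_exists_Omega:
  assumes "AE x in lborel. P x" obtains x where "x \<in> \<Omega>" "P x"
proof (rule ccontr)
  assume "\<not> thesis"
  then have "AE x in lborel. x \<notin> \<Omega>" using assms that by (auto elim: eventually_mono)
  then have "emeasure lborel \<Omega> = 0" using AE_iff_measurable[of \<Omega> lborel "\<lambda>x. x \<notin> \<Omega>"] by auto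
  then show False using Omega_measure(2) by simp
qed

end

lemma test_functions_bounded:
  assumes u: "u \<in> test_functions \<Omega>"
  shows "\<exists>M\<ge>0. \<forall>x. \<bar>u x\<bar> \<le> M"
proof -
  have z: "u x = 0" if "x \<notin> closure {x. u x \<noteq> 0}" for x
    using that closure_subset[of "{x. u x \<noteq> 0}"] by blast
  show ?thesis
    using compact_support_bounded[OF test_functions_continuous[OF u] test_functionsD(2)[OF u] z] by metis
qed

section \<open>Finite energy of test functions, and square integrability on \<Omega>\<close>

context kernel begin

lemma nn_integral_pair_fst:
  fixes f :: "(real^'n) \<times> (real^'n) \<Rightarrow> ennreal"
  assumes "f \<in> borel_measurable borel"
  shows "(\<integral>\<^sup>+p. f p \<partial>lborel) = (\<integral>\<^sup>+x. \<integral>\<^sup>+y. f (x, y) \<partial>lborel \<partial>lborel)"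
proof -
  have "f \<in> borel_measurable (lborel \<Otimes>\<^sub>M lborel)" unfolding lborel_prod using assms by simp
  from lborel.nn_integral_fst[OF this] show ?thesis by (simp add: lborel_prod)
qed

lemma nn_integral_pair_snd:
  fixes f :: "(real^'n) \<times> (real^'n) \<Rightarrow> ennreal"
  assumes "f \<in> borel_measurable borel"
  shows "(\<integral>\<^sup>+p. f p \<partial>lborel) = (\<integral>\<^sup>+y. \<integral>\<^sup>+x. f (x, y) \<partial>lborel \<partial>lborel)"
proof -
  have "f \<in> borel_measurable (lborel \<Otimes>\<^sub>M lborel)" unfolding lborel_prod using assms by simp
  from lborel_pair.nn_integral_snd[OF this] show ?thesis by (simp add: lborel_prod)
qed

lemma test_function_sq_int:
  assumes u: "u \<in> test_functions \<Omega>" shows "u \<in> sq_int"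
proof -
  obtain M where M: "M \<ge> 0" "\<And>x. \<bar>u x\<bar> \<le> M"
    using test_functions_bounded[OF u] by blast
  show ?thesis
  proof (rule sq_int_bound)
    show "u \<in> borel_measurable lebesgue"
      using borel_measurable_continuous_onI[OF test_functions_continuous[OF u]]
      by (intro measurable_completion) simp
    show "integrable lebesgue (\<lambda>x. M\<^sup>2 * indicator \<Omega> x)"
      using Omega_measure(1) by (intro integrable_mult_right) (simp add: integrable_indicator_iff)
    show "AE x in lebesgue. (u x)\<^sup>2 \<le> M\<^sup>2 * indicator \<Omega> x"
    proof (rule AE_I2)
      fix x
      show "(u x)\<^sup>2 \<le> M\<^sup>2 * indicator \<Omega> x"
      proof (cases "x \<in> \<Omega>")
        case True
        have "(u x)\<^sup>2 \<le> M\<^sup>2" using power_mono[OF M(2)[of x], of 2] by simp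
        then show ?thesis using True by simp
      qed (simp add: test_functions_vanish[OF u])
    qed
  qed
qed

text \<open>The squared difference is at most L^2 |x - y|^2 and at most 4 M^2, hence at most c
  min(|x - y|^2, 1). On Q one of the points lies in \<Omega>; integrating over the other one first
  leaves the measure of \<Omega> times the integral of min(|z|^2, 1) K.\<close>

lemma test_function_dq:
  assumes u: "u \<in> test_functions \<Omega>" shows "dq u \<in> sq_int"
proof -
  obtain M where M: "M \<ge> 0" "\<And>x. \<bar>u x\<bar> \<le> M"
    using test_functions_bounded[OF u] by blast
  obtain L where L: "L \<ge> 0" "\<And>x y. \<bar>u x - u y\<bar> \<le> L * norm (x - y)"
    using test_functions_Lipschitz[OF u] by metis
  define c where "c = L\<^sup>2 + 4 * M\<^sup>2"
  define h where "h z = ennreal (min ((norm z)\<^sup>2) 1 * k z)" for z :: "real^'n"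
  have [measurable]: "h \<in> borel_measurable borel" unfolding h_def by measurable
  have h_fin: "(\<integral>\<^sup>+z. h z \<partial>lborel) < \<infinity>" using k_integral by (simp add: h_def)
  have c0: "c \<ge> 0" by (simp add: c_def)
  have u_borel [measurable]: "u \<in> borel_measurable borel"
    by (rule borel_measurable_continuous_onI[OF test_functions_continuous[OF u]])
  have le: "ennreal ((dq u p)\<^sup>2) \<le> ennreal c * (indicator \<Omega> (fst p) * h (fst p - snd p) + indicator \<Omega> (snd p) * h (fst p - snd p))" for p
  proof (cases "p \<in> Q \<Omega>")
    case False
    then show ?thesis by (simp add: dq_def Wt_def)
  next
    case True
    obtain x y where p: "p = (x, y)" by (cases p)
    have 1: "(u x - u y)\<^sup>2 \<le> L\<^sup>2 * (norm (x - y))\<^sup>2"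
      using power_mono[OF L(2)[of x y], of 2] by (simp add: power_mult_distrib)
    have "\<bar>u x - u y\<bar> \<le> 2 * M" using M(2)[of x] M(2)[of y] by linarith
    from power_mono[OF this, of 2] have 2: "(u x - u y)\<^sup>2 \<le> 4 * M\<^sup>2" by (simp add: power_mult_distrib)
    have "(u x - u y)\<^sup>2 \<le> c * min ((norm (x - y))\<^sup>2) 1"
    proof (cases "(norm (x - y))\<^sup>2 \<le> 1")
      case True
      then have "c * min ((norm (x - y))\<^sup>2) 1 = L\<^sup>2 * (norm (x - y))\<^sup>2 + 4 * M\<^sup>2 * (norm (x - y))\<^sup>2"
        by (simp add: c_def distrib_right)
      moreover have "0 \<le> 4 * M\<^sup>2 * (norm (x - y))\<^sup>2" by simp
      ultimately show ?thesis using 1 by linarith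
    next
      case False
      then have "c * min ((norm (x - y))\<^sup>2) 1 = L\<^sup>2 + 4 * M\<^sup>2" by (simp add: c_def)
      then show ?thesis using 2 zero_le_power2[of L] by linarith
    qed
    from mult_right_mono[OF this k_nonneg[of "x - y"]]
    have "(dq u p)\<^sup>2 \<le> c * (min ((norm (x - y))\<^sup>2) 1 * k (x - y))"
      using True by (simp add: dq_def p power_mult_distrib Wt_nonneg) (simp add: Wt_def mult.assoc)
    then have "ennreal ((dq u p)\<^sup>2) \<le> ennreal c * h (x - y)"
      using c0 k_nonneg by (simp add: h_def ennreal_mult[symmetric] ennreal_leI)
    also have "\<dots> \<le> ennreal c * (indicator \<Omega> (fst p) * h (fst p - snd p) + indicator \<Omega> (snd p) * h (fst p - snd p))"
      using True by (intro mult_left_mono) (auto simp: p Q_iff indicator_def add_increasing add_increasing2)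
    finally show ?thesis .
  qed
  have [measurable]: "(\<lambda>p :: (real^'n) \<times> (real^'n). h (fst p - snd p)) \<in> borel_measurable borel"
    by (rule measurable_compose[OF diff_borel]) measurable
  have fin: "(\<integral>\<^sup>+p. ennreal ((dq u p)\<^sup>2) \<partial>lborel) < \<infinity>"
  proof -
    have "(\<integral>\<^sup>+p. ennreal ((dq u p)\<^sup>2) \<partial>lborel)
        \<le> (\<integral>\<^sup>+p. ennreal c * (indicator \<Omega> (fst p) * h (fst p - snd p) + indicator \<Omega> (snd p) * h (fst p - snd p)) \<partial>lborel)"
      by (intro nn_integral_mono le)
    also have "\<dots> = ennreal c * ((\<integral>\<^sup>+p. indicator \<Omega> (fst p) * h (fst p - snd p) \<partial>lborel)
        + (\<integral>\<^sup>+p. indicator \<Omega> (snd p) * h (fst p - snd p) \<partial>lborel))"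
      by (simp add: nn_integral_cmult nn_integral_add)
    also have "(\<integral>\<^sup>+p. indicator \<Omega> (fst p) * h (fst p - snd p) \<partial>lborel) = emeasure lborel \<Omega> * (\<integral>\<^sup>+z. h z \<partial>lborel)"
      by (simp add: nn_integral_pair_fst nn_integral_cmult nn_integral_reflect nn_integral_multc)
    also have "(\<integral>\<^sup>+p. indicator \<Omega> (snd p) * h (fst p - snd p) \<partial>lborel)
        = emeasure lborel \<Omega> * (\<integral>\<^sup>+z. h z \<partial>lborel)"
    proof -
      have "(\<integral>\<^sup>+x. h (x - y) \<partial>lborel) = (\<integral>\<^sup>+z. h z \<partial>lborel)" for y
      proof -
        have "(\<integral>\<^sup>+x. h (x - y) \<partial>lborel) = (\<integral>\<^sup>+x. (\<lambda>z. h (- z)) (y - x) \<partial>lborel)" by simp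
        also have "\<dots> = (\<integral>\<^sup>+z. h (- z) \<partial>lborel)" by (rule nn_integral_reflect) measurable
        also have "\<dots> = (\<integral>\<^sup>+z. h (0 - z) \<partial>lborel)" by simp
        also have "\<dots> = (\<integral>\<^sup>+z. h z \<partial>lborel)" by (rule nn_integral_reflect) measurable
        finally show ?thesis .
      qed
      then show ?thesis by (simp add: nn_integral_pair_snd nn_integral_cmult nn_integral_multc)
    qed
    also have "ennreal c * (emeasure lborel \<Omega> * (\<integral>\<^sup>+z. h z \<partial>lborel) + emeasure lborel \<Omega> * (\<integral>\<^sup>+z. h z \<partial>lborel)) < \<infinity>"
      using Omega_measure(1) h_fin by (simp add: ennreal_mult_less_top)
    finally show ?thesis .
  qed
  have m: "dq u \<in> borel_measurable lebesgue"
    by (intro dq_measurable sq_int_measurable test_function_sq_int u)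
  have "integrable lebesgue (\<lambda>p. (dq u p)\<^sup>2)"
  proof (rule integrableI_bounded)
    show "(\<lambda>p. (dq u p)\<^sup>2) \<in> borel_measurable lebesgue" using m by measurable
    show "(\<integral>\<^sup>+p. ennreal (norm ((dq u p)\<^sup>2)) \<partial>lebesgue) < \<infinity>"
      unfolding nn_integral_completion using fin by simp
  qed
  then show ?thesis using m by (simp add: sq_int_def)
qed

sublocale energy_space Wt "test_functions \<Omega>"
  by unfold_locales
     (simp_all add: test_functions_zero test_functions_add test_functions_scale test_function_sq_int test_function_dq)

lemma D_vanish:
  assumes U: "U \<in> D" shows "AE x in lebesgue. x \<notin> \<Omega> \<longrightarrow> rep U x = 0"
proof -
  obtain \<phi> where \<phi>: "\<And>n :: nat. \<phi> n \<in> test_functions \<Omega>" "(\<lambda>n. cls (\<phi> n)) \<longlonglongrightarrow> U"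
    using D_approx[OF U] by metis
  obtain r G where ae: "AE x in lebesgue. (\<forall>n. (rep (cls (\<phi> (r n))) x)\<^sup>2 \<le> G x) \<and> (\<lambda>n. rep (cls (\<phi> (r n))) x) \<longlonglongrightarrow> rep U x"
    by (rule l2_convergent_subseq[OF \<phi>(2)])
  have "AE x in lebesgue. \<forall>n. rep (cls (\<phi> n)) x = \<phi> n x"
    unfolding AE_all_countable using rep_cls[OF test_function_sq_int[OF \<phi>(1)]] by blast
  with ae show ?thesis
  proof eventually_elim
    case (elim x)
    show ?case
    proof
      assume "x \<notin> \<Omega>"
      then have "(\<lambda>n. rep (cls (\<phi> (r n))) x) = (\<lambda>n. 0)"
        using elim(2) test_functions_vanish[OF \<phi>(1)] by auto
      then show "rep U x = 0" using elim(1) by (simp add: LIMSEQ_const_iff)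
    qed
  qed
qed

text \<open>On \<Omega> \<times> \<Omega> the kernel is at least c > 0 off the diagonal, so finite
  energy and Fubini give a point x0 with v x0 - v square integrable over \<Omega>, a set of finite
  measure. Outside \<Omega> functions of X can fail to be square integrable, as constants do; hence
  the indicator.\<close>

lemma space_X_sq_int_Omega:
  assumes u: "u \<in> space_X \<Omega> K" shows "(\<lambda>x. indicator \<Omega> x * u x) \<in> sq_int"
proof -
  have um: "u \<in> borel_measurable lebesgue" and du: "dq u \<in> sq_int" using u by (auto simp: space_X_iff)
  obtain v where v [measurable]: "v \<in> borel_measurable borel" and uv: "AE x in lborel. u x = v x"
    by (rule lebesgue_borel_version[OF um])
  have ae: "AE p in lebesgue. dq u p = dq v p" by (rule dq_cong) (simp add: AE_completion_iff uv)
  obtain d where d: "d > 0" "\<And>x y. x \<in> \<Omega> \<Longrightarrow> y \<in> \<Omega> \<Longrightarrow> norm (x - y) \<le> d"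
  proof -
    obtain R where R: "R > 0" "\<And>x. x \<in> \<Omega> \<Longrightarrow> norm x \<le> R" using bounded_Omega bounded_pos by metis
    show thesis
    proof (rule that)
      show "0 < 2 * R" using R(1) by simp
      show "norm (x - y) \<le> 2 * R" if "x \<in> \<Omega>" "y \<in> \<Omega>" for x y
        using norm_triangle_ineq4[of x y] R(2)[OF that(1)] R(2)[OF that(2)] by linarith
    qed
  qed
  define c where "c = \<theta> * d powr (- (real CARD('n) + 2 * s))"
  have c: "c > 0" using \<theta> d(1) by (simp add: c_def)
  have c_le: "c \<le> k z" if "z \<noteq> 0" "norm z \<le> d" for z
  proof -
    have "d powr (- (real CARD('n) + 2 * s)) \<le> norm z powr (- (real CARD('n) + 2 * s))"
      using that s by (intro powr_mono2') auto
    then have "c \<le> low z" unfolding c_def low_def using \<theta> by (intro mult_left_mono) auto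
    then show ?thesis using low_le_k[of z] by simp
  qed
  define F where "F p = ennreal (c * (indicator \<Omega> (fst p) * indicator \<Omega> (snd p) * (v (fst p) - v (snd p))\<^sup>2))" for p
  have [measurable]: "F \<in> borel_measurable borel" unfolding F_def by measurable
  have F_le: "F p \<le> ennreal ((dq v p)\<^sup>2)" for p
  proof (cases "fst p \<in> \<Omega> \<and> snd p \<in> \<Omega> \<and> fst p \<noteq> snd p")
    case True
    then have "(dq v p)\<^sup>2 = (v (fst p) - v (snd p))\<^sup>2 * k (fst p - snd p)"
      by (simp add: dq_def power_mult_distrib Wt_nonneg) (simp add: Wt_def Q_iff)
    moreover have "c \<le> k (fst p - snd p)" using True d by (intro c_le) auto
    ultimately have "c * (v (fst p) - v (snd p))\<^sup>2 \<le> (dq v p)\<^sup>2" by (simp add: mult.commute[of _ "k _"] mult_right_mono)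
    then show ?thesis using True by (simp add: F_def ennreal_leI)
  next
    case False
    then have "F p = 0" by (auto simp: F_def indicator_def)
    then show ?thesis by simp
  qed
  have "(\<integral>\<^sup>+p. F p \<partial>lborel) \<le> (\<integral>\<^sup>+p. ennreal ((dq v p)\<^sup>2) \<partial>lborel)" by (intro nn_integral_mono F_le)
  also have "\<dots> = (\<integral>\<^sup>+p. ennreal ((dq u p)\<^sup>2) \<partial>lebesgue)"
  proof -
    have "AE p in lebesgue. ennreal ((dq v p)\<^sup>2) = ennreal ((dq u p)\<^sup>2)" using ae by eventually_elim simp
    from nn_integral_cong_AE[OF this] show ?thesis by (simp add: nn_integral_completion)
  qed
  also have "\<dots> < \<infinity>"
    using du by (simp add: sq_int_def integrable_iff_bounded)
  finally have "(\<integral>\<^sup>+x. \<integral>\<^sup>+y. F (x, y) \<partial>lborel \<partial>lborel) < \<infinity>" by (simp add: nn_integral_pair_fst)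
  then have "AE x in lborel. (\<integral>\<^sup>+y. F (x, y) \<partial>lborel) \<noteq> \<infinity>"
    by (intro nn_integral_PInf_AE) (auto intro!: lborel.borel_measurable_nn_integral)
  then obtain x0 where x0: "x0 \<in> \<Omega>" "(\<integral>\<^sup>+y. F (x0, y) \<partial>lborel) \<noteq> \<infinity>" by (rule AE_exists_Omega)
  have "integrable lborel (\<lambda>y. c * (indicator \<Omega> x0 * indicator \<Omega> y * (v x0 - v y)\<^sup>2))"
  proof (rule integrableI_nonneg)
    show "(\<integral>\<^sup>+y. ennreal (c * (indicator \<Omega> x0 * indicator \<Omega> y * (v x0 - v y)\<^sup>2)) \<partial>lborel) < \<infinity>"
      using x0(2) by (simp add: F_def less_top)
  qed (use c in auto)
  then have "integrable lborel (\<lambda>y. (1 / c) * (c * (indicator \<Omega> x0 * indicator \<Omega> y * (v x0 - v y)\<^sup>2)))"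
    by (rule integrable_mult_right)
  then have i1: "integrable lborel (\<lambda>y. indicator \<Omega> y * (v x0 - v y)\<^sup>2)" using c x0(1) by simp
  have "integrable lborel (\<lambda>y. 2 * (indicator \<Omega> y * (v x0 - v y)\<^sup>2) + 2 * (v x0)\<^sup>2 * indicator \<Omega> y)"
    using Omega_measure(1) i1
    by (intro Bochner_Integration.integrable_add integrable_mult_right) (simp_all add: integrable_indicator_iff)
  then have i2: "integrable lebesgue (\<lambda>y. 2 * (indicator \<Omega> y * (v x0 - v y)\<^sup>2) + 2 * (v x0)\<^sup>2 * indicator \<Omega> y)"
    by (subst integrable_completion) simp_all
  show ?thesis
  proof (rule sq_int_bound[OF _ i2])
    show "(\<lambda>x. indicator \<Omega> x * u x) \<in> borel_measurable lebesgue" using um by measurable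
    have "AE x in lebesgue. u x = v x" using uv by (simp add: AE_completion_iff)
    then show "AE x in lebesgue. (indicator \<Omega> x * u x)\<^sup>2
        \<le> 2 * (indicator \<Omega> x * (v x0 - v x)\<^sup>2) + 2 * (v x0)\<^sup>2 * indicator \<Omega> x"
    proof eventually_elim
      case (elim x)
      have "(v x)\<^sup>2 \<le> 2 * (v x0 - v x)\<^sup>2 + 2 * (v x0)\<^sup>2"
        using zero_le_power2[of "2 * v x0 - v x"] by (simp add: power2_eq_square algebra_simps)
      then show ?case using elim by (simp add: indicator_def)
    qed
  qed
qed

end

section \<open>The space Z as the form domain\<close>

context kernel begin

lemma norm_X_cls:
  assumes u: "u \<in> space_X \<Omega> K"
  shows "(norm_X \<Omega> K u)\<^sup>2 = (norm (cls (\<lambda>x. indicator \<Omega> x * u x)))\<^sup>2 + (norm (cls (dq u)))\<^sup>2"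
proof -
  have um: "u \<in> borel_measurable lebesgue" and du: "dq u \<in> sq_int" using u by (auto simp: space_X_iff)
  have "(\<integral>x. (u x)\<^sup>2 \<partial>lebesgue_on \<Omega>) = (\<integral>x. indicator \<Omega> x *\<^sub>R (u x)\<^sup>2 \<partial>lebesgue)"
    by (rule integral_restrict_space) (simp add: Omega_lebesgue)
  also have "\<dots> = (\<integral>x. (indicator \<Omega> x * u x)\<^sup>2 \<partial>lebesgue)"
    by (intro Bochner_Integration.integral_cong) (auto simp: indicator_def)
  also have "\<dots> = (norm (cls (\<lambda>x. indicator \<Omega> x * u x)))\<^sup>2"
    by (simp add: norm_cls space_X_sq_int_Omega[OF u])
  finally have 1: "(\<integral>x. (u x)\<^sup>2 \<partial>lebesgue_on \<Omega>) = (norm (cls (\<lambda>x. indicator \<Omega> x * u x)))\<^sup>2" .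
  show ?thesis unfolding norm_X_dq[OF um] 1 norm_cls[OF du, symmetric] by simp
qed

lemma space_X_diff_test:
  assumes u: "u \<in> space_X \<Omega> K" and \<phi>: "\<phi> \<in> test_functions \<Omega>"
  shows "(\<lambda>x. u x - \<phi> x) \<in> space_X \<Omega> K"
    "cls (\<lambda>x. indicator \<Omega> x * (u x - \<phi> x)) = cls (\<lambda>x. indicator \<Omega> x * u x) - cls \<phi>"
    "cls (dq (\<lambda>x. u x - \<phi> x)) = cls (dq u) - cls (dq \<phi>)"
proof -
  have um: "u \<in> borel_measurable lebesgue" and du: "dq u \<in> sq_int" using u by (auto simp: space_X_iff)
  note \<phi>s = test_function_sq_int[OF \<phi>] and \<phi>d = test_function_dq[OF \<phi>]
  show "(\<lambda>x. u x - \<phi> x) \<in> space_X \<Omega> K"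
    using um du \<phi>d sq_int_measurable[OF \<phi>s] by (simp add: space_X_iff dq_diff sq_int_diff)
  have "(\<lambda>x. indicator \<Omega> x * (u x - \<phi> x)) = (\<lambda>x. indicator \<Omega> x * u x - \<phi> x)"
    using test_functions_vanish[OF \<phi>] by (auto simp: indicator_def)
  then show "cls (\<lambda>x. indicator \<Omega> x * (u x - \<phi> x)) = cls (\<lambda>x. indicator \<Omega> x * u x) - cls \<phi>"
    using cls_diff[OF space_X_sq_int_Omega[OF u] \<phi>s] by simp
  show "cls (dq (\<lambda>x. u x - \<phi> x)) = cls (dq u) - cls (dq \<phi>)"
    unfolding dq_diff by (rule cls_diff[OF du \<phi>d])
qed

text \<open>The norm of X sees the function itself on \<Omega> only, so the test functions
  approximate \<open>u0\<close>, which is \<open>u\<close> cut off outside \<Omega>, while their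
  difference quotients approximate those of \<open>u\<close>. Hence u - u0 has zero energy; it is 0
  on \<Omega>, and positivity of the kernel between \<Omega> and its complement forces it to
  vanish.\<close>

lemma space_Z_cls:
  assumes u: "u \<in> space_Z \<Omega> K"
  shows "u \<in> sq_int" "dq u \<in> sq_int" "cls u \<in> D"
proof -
  have uX: "u \<in> space_X \<Omega> K"
    and appr: "\<And>\<epsilon>. \<epsilon> > 0 \<Longrightarrow> \<exists>\<phi>\<in>test_functions \<Omega>. norm_X \<Omega> K (\<lambda>x. u x - \<phi> x) < \<epsilon>"
    using u by (auto simp: space_Z_def)
  have um: "u \<in> borel_measurable lebesgue" and du: "dq u \<in> sq_int" using uX by (auto simp: space_X_iff)
  define u0 where "u0 x = indicator \<Omega> x * u x" for x
  have u0s: "u0 \<in> sq_int" unfolding u0_def by (rule space_X_sq_int_Omega[OF uX])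
  have "\<exists>\<phi>. \<phi> \<in> test_functions \<Omega> \<and> norm_X \<Omega> K (\<lambda>x. u x - \<phi> x) < inverse (real (Suc n))" for n
    using appr[of "inverse (real (Suc n))"] by auto
  then obtain \<phi> where \<phi>: "\<And>n. \<phi> n \<in> test_functions \<Omega>"
    "\<And>n. norm_X \<Omega> K (\<lambda>x. u x - \<phi> n x) < inverse (real (Suc n))" by metis
  have sq: "(norm_X \<Omega> K (\<lambda>x. u x - \<phi> n x))\<^sup>2 = (norm (cls u0 - cls (\<phi> n)))\<^sup>2 + (norm (cls (dq u) - cls (dq (\<phi> n))))\<^sup>2" for n
    using norm_X_cls[OF space_X_diff_test(1)[OF uX \<phi>(1)]] space_X_diff_test(2,3)[OF uX \<phi>(1)]
    by (simp add: u0_def[abs_def])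
  have n0: "0 \<le> norm_X \<Omega> K (\<lambda>x. u x - \<phi> n x)" for n
  proof -
    have m: "(\<lambda>x. u x - \<phi> n x) \<in> borel_measurable lebesgue"
      using space_X_diff_test(1)[OF uX \<phi>(1)] by (simp add: space_X_iff)
    show ?thesis unfolding norm_X_dq[OF m]
      by (intro real_sqrt_ge_zero add_nonneg_nonneg Bochner_Integration.integral_nonneg) simp_all
  qed
  have sqn: "(norm_X \<Omega> K (\<lambda>x. u x - \<phi> n x))\<^sup>2 \<le> (inverse (real (Suc n)))\<^sup>2" for n
    using n0[of n] \<phi>(2)[of n] by (intro power_mono) auto
  have b1: "norm (cls (\<phi> n) - cls u0) \<le> inverse (real (Suc n))" for n
  proof (rule power2_le_imp_le)
    show "(norm (cls (\<phi> n) - cls u0))\<^sup>2 \<le> (inverse (real (Suc n)))\<^sup>2"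
      using sqn[of n] sq[of n] zero_le_power2[of "norm (cls (dq u) - cls (dq (\<phi> n)))"]
      unfolding norm_minus_commute[of "cls (\<phi> n)"] by linarith
  qed simp
  have b2: "norm (cls (dq (\<phi> n)) - cls (dq u)) \<le> inverse (real (Suc n))" for n
  proof (rule power2_le_imp_le)
    show "(norm (cls (dq (\<phi> n)) - cls (dq u)))\<^sup>2 \<le> (inverse (real (Suc n)))\<^sup>2"
      using sqn[of n] sq[of n] zero_le_power2[of "norm (cls u0 - cls (\<phi> n))"]
      unfolding norm_minus_commute[of "cls (dq (\<phi> n))"] by linarith
  qed simp
  have lim1: "(\<lambda>n. cls (\<phi> n)) \<longlonglongrightarrow> cls u0"
    by (rule LIM_zero_cancel, rule Lim_null_comparison[OF always_eventually[OF allI[OF b1]] LIMSEQ_inverse_real_of_nat])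
  have lim2: "(\<lambda>n. cls (dq (\<phi> n))) \<longlonglongrightarrow> cls (dq u)"
    by (rule LIM_zero_cancel, rule Lim_null_comparison[OF always_eventually[OF allI[OF b2]] LIMSEQ_inverse_real_of_nat])
  note u0D = D_limit[OF \<phi>(1) lim1 lim2]
  have "AE p in lebesgue. dq (rep (cls u0)) p = dq u p"
    using u0D(2) cls_eq_iff[OF D_dq[OF u0D(1)] du] by (simp add: \<E>_def)
  with dq_cong[OF rep_cls[OF u0s]] have eq: "AE p in lebesgue. dq u0 p = dq u p"
    by eventually_elim simp
  define w where "w x = u x - u0 x" for x
  have wm: "w \<in> borel_measurable lebesgue" unfolding w_def using um sq_int_measurable[OF u0s] by measurable
  obtain v where v: "v \<in> borel_measurable borel" and wv: "AE x in lborel. w x = v x"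
    by (rule lebesgue_borel_version[OF wm])
  have "AE x in lebesgue. w x = v x" using wv by (simp add: AE_completion_iff)
  from dq_cong[OF this] have "AE p in lebesgue. dq v p = 0"
    using eq unfolding w_def dq_diff by eventually_elim simp
  then have "AE p in lborel \<Otimes>\<^sub>M lborel. dq v p = 0"
    unfolding lborel_prod AE_completion_iff .
  from lborel_pair.AE_pair[OF this] have "AE x in lborel. w x = v x \<and> (AE y in lborel. dq v (x, y) = 0)"
    using wv by eventually_elim simp
  \<comment> \<open>A single point x of \<Omega> suffices: \<open>v\<close> vanishes at x, the
    difference quotients from x to almost every y vanish, and the kernel is positive there.\<close>
  then obtain x where x: "x \<in> \<Omega>" "w x = v x" "AE y in lborel. dq v (x, y) = 0"
    using AE_exists_Omega by blast
  have vx: "v x = 0" using x(1,2) by (simp add: w_def u0_def)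
  have "AE y in lborel. y \<noteq> x" by (rule AE_lborel_singleton)
  with x(3) wv have "AE y in lborel. w y = 0"
  proof eventually_elim
    case (elim y)
    have "0 < k (x - y)" using low_pos[of "x - y"] low_le_k[of "x - y"] elim by simp
    moreover have "Wt (x, y) = k (x - y)" using x(1) by (simp add: Wt_def Q_iff)
    ultimately show ?case using elim vx by (simp add: dq_def)
  qed
  then have uu0: "AE x in lebesgue. u x = u0 x" by (simp add: AE_completion_iff w_def)
  show us: "u \<in> sq_int"
  proof (rule sq_int_bound[OF um])
    show "integrable lebesgue (\<lambda>x. (u0 x)\<^sup>2)" using u0s by (simp add: sq_int_def)
    show "AE x in lebesgue. (u x)\<^sup>2 \<le> (u0 x)\<^sup>2" using uu0 by eventually_elim simp
  qed
  show "dq u \<in> sq_int" by (rule du)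
  have "cls u = cls u0" using cls_eq_iff[OF us u0s] uu0 by simp
  then show "cls u \<in> D" using u0D(1) by simp
qed

lemma D_rep_space_Z:
  assumes U: "U \<in> D" shows "rep U \<in> space_Z \<Omega> K"
proof -
  have X: "rep U \<in> space_X \<Omega> K"
    using D_dq[OF U] sq_int_measurable[OF rep_sq_int[of U]] by (simp add: space_X_iff)
  have "AE x in lebesgue. indicator \<Omega> x * rep U x = rep U x"
    using D_vanish[OF U] by eventually_elim (auto simp: indicator_def)
  then have UO: "cls (\<lambda>x. indicator \<Omega> x * rep U x) = U"
    using cls_eq_iff[OF space_X_sq_int_Omega[OF X] rep_sq_int] by simp
  obtain \<phi> where \<phi>: "\<And>n :: nat. \<phi> n \<in> test_functions \<Omega>" and lim1: "(\<lambda>n. cls (\<phi> n)) \<longlonglongrightarrow> U"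
    and lim2: "(\<lambda>n. cls (dq (\<phi> n))) \<longlonglongrightarrow> \<E> U"
    using D_approx[OF U] by metis
  have sq: "(norm_X \<Omega> K (\<lambda>x. rep U x - \<phi> n x))\<^sup>2 = (norm (U - cls (\<phi> n)))\<^sup>2 + (norm (\<E> U - cls (dq (\<phi> n))))\<^sup>2" for n
    using norm_X_cls[OF space_X_diff_test(1)[OF X \<phi>]] space_X_diff_test(2,3)[OF X \<phi>]
    by (simp add: UO \<E>_def)
  have "(\<lambda>n. (norm (U - cls (\<phi> n)))\<^sup>2 + (norm (\<E> U - cls (dq (\<phi> n))))\<^sup>2) \<longlonglongrightarrow> (norm (U - U))\<^sup>2 + (norm (\<E> U - \<E> U))\<^sup>2"
    by (intro tendsto_intros lim1 lim2)
  then have "(\<lambda>n. (norm_X \<Omega> K (\<lambda>x. rep U x - \<phi> n x))\<^sup>2) \<longlonglongrightarrow> 0" by (simp add: sq)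
  then have lim: "(\<lambda>n. norm_X \<Omega> K (\<lambda>x. rep U x - \<phi> n x)) \<longlonglongrightarrow> 0" by simp
  have "\<exists>\<psi>\<in>test_functions \<Omega>. norm_X \<Omega> K (\<lambda>x. rep U x - \<psi> x) < \<epsilon>" if "\<epsilon> > 0" for \<epsilon>
  proof -
    have "\<forall>\<^sub>F n in sequentially. norm_X \<Omega> K (\<lambda>x. rep U x - \<phi> n x) < \<epsilon>"
      by (rule order_tendstoD(2)[OF lim that])
    then obtain n where "norm_X \<Omega> K (\<lambda>x. rep U x - \<phi> n x) < \<epsilon>" by (auto simp: eventually_sequentially)
    then show ?thesis using \<phi> by blast
  qed
  then show ?thesis using X by (simp add: space_Z_def)
qed

lemma inner_Z_B:
  assumes u: "u \<in> space_Z \<Omega> K" and v: "v \<in> space_Z \<Omega> K"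
  shows "inner_Z \<Omega> K u v = B (cls u) (cls v)"
  using inner_Z_dq[OF sq_int_measurable sq_int_measurable, OF space_Z_cls(1)[OF u] space_Z_cls(1)[OF v]]
    inner_cls[OF space_Z_cls(2)[OF u] space_Z_cls(2)[OF v]]
  by (simp add: B_def \<E>_cls space_Z_cls[OF u] space_Z_cls[OF v])

lemma inner_Omega:
  assumes u: "u \<in> space_Z \<Omega> K" and v: "v \<in> sq_int"
  shows "(\<integral>x. u x * v x \<partial>lebesgue_on \<Omega>) = inner (cls u) (cls v)"
proof -
  have "AE x in lebesgue. x \<notin> \<Omega> \<longrightarrow> u x = 0"
    using D_vanish[OF space_Z_cls(3)[OF u]] rep_cls[OF space_Z_cls(1)[OF u]] by eventually_elim simp
  then have ae: "AE x in lebesgue. indicator \<Omega> x *\<^sub>R (u x * v x) = u x * v x"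
    by eventually_elim (auto simp: indicator_def)
  have [measurable]: "u \<in> borel_measurable lebesgue" "v \<in> borel_measurable lebesgue"
    using space_Z_cls(1)[OF u] v by (auto intro: sq_int_measurable)
  have "(\<integral>x. u x * v x \<partial>lebesgue_on \<Omega>) = (\<integral>x. indicator \<Omega> x *\<^sub>R (u x * v x) \<partial>lebesgue)"
    by (rule integral_restrict_space) (simp add: Omega_lebesgue)
  also have "\<dots> = (\<integral>x. u x * v x \<partial>lebesgue)"
    by (rule integral_cong_AE[OF _ _ ae]) measurable
  also have "\<dots> = inner (cls u) (cls v)" by (rule inner_cls[OF space_Z_cls(1)[OF u] v, symmetric])
  finally show ?thesis .
qed

end

section \<open>Compact embedding\<close>

lemma compact_bounded_combinations:
  fixes e :: "'i \<Rightarrow> 'a::real_normed_vector"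
  assumes "finite I"
  shows "compact {\<Sum>j\<in>I. c j *\<^sub>R e j | c. \<forall>j\<in>I. \<bar>c j\<bar> \<le> (R::real)}"
  using assms
proof (induction I rule: finite_induct)
  case empty
  have "{\<Sum>j\<in>{}. c j *\<^sub>R e j | c. \<forall>j\<in>{}. \<bar>c j\<bar> \<le> R} = {0}" by auto
  then show ?case by simp
next
  case (insert i I)
  let ?S = "\<lambda>I. {\<Sum>j\<in>I. c j *\<^sub>R e j | c. \<forall>j\<in>I. \<bar>c j\<bar> \<le> R}"
  have seg: "compact ((\<lambda>t. t *\<^sub>R e i) ` {-R..R})"
    by (intro compact_continuous_image continuous_intros compact_Icc)
  have "?S (insert i I) = {x + y | x y. x \<in> (\<lambda>t. t *\<^sub>R e i) ` {-R..R} \<and> y \<in> ?S I}"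
  proof (intro set_eqI iffI)
    fix z assume "z \<in> ?S (insert i I)"
    then obtain c where c: "z = (\<Sum>j\<in>insert i I. c j *\<^sub>R e j)" "\<forall>j\<in>insert i I. \<bar>c j\<bar> \<le> R" by blast
    have "z = c i *\<^sub>R e i + (\<Sum>j\<in>I. c j *\<^sub>R e j)" using insert c(1) by simp
    moreover have "c i \<in> {-R..R}" using c(2) by (auto simp: abs_le_iff)
    ultimately show "z \<in> {x + y | x y. x \<in> (\<lambda>t. t *\<^sub>R e i) ` {-R..R} \<and> y \<in> ?S I}" using c(2) by blast
  next
    fix z assume "z \<in> {x + y | x y. x \<in> (\<lambda>t. t *\<^sub>R e i) ` {-R..R} \<and> y \<in> ?S I}"
    then obtain t c where tc: "t \<in> {-R..R}" "z = t *\<^sub>R e i + (\<Sum>j\<in>I. c j *\<^sub>R e j)" "\<forall>j\<in>I. \<bar>c j\<bar> \<le> R" by blast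
    have "(\<Sum>j\<in>I. (c(i := t)) j *\<^sub>R e j) = (\<Sum>j\<in>I. c j *\<^sub>R e j)"
      using insert.hyps(2) by (intro sum.cong) auto
    then have "z = (\<Sum>j\<in>insert i I. (c(i := t)) j *\<^sub>R e j)" using insert.hyps tc(2) by simp
    moreover have "\<forall>j\<in>insert i I. \<bar>(c(i := t)) j\<bar> \<le> R" using tc(1,3) by auto
    ultimately show "z \<in> ?S (insert i I)" by blast
  qed
  then show ?case using compact_sums[OF seg insert.IH] by simp
qed

text \<open>For h > 0 this is the half-open cube of side h with lower corner h j; such cubes
  partition the space.\<close>

definition cell :: "real \<Rightarrow> ('n \<Rightarrow> int) \<Rightarrow> (real^'n::finite) set" where
  "cell h j = {x. \<forall>i. j i = \<lfloor>x $ i / h\<rfloor>}"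

lemma cell_disjoint: "x \<in> cell h j \<Longrightarrow> x \<in> cell h j' \<Longrightarrow> j = j'"
  by (auto simp: cell_def)

lemma cell_borel [measurable]: "cell h j \<in> sets borel"
proof -
  have [measurable]: "(\<lambda>x :: real^'a. x $ i) \<in> borel_measurable borel" for i
    by (intro borel_measurable_continuous_onI continuous_intros)
  have "cell h j = (\<Inter>i\<in>UNIV. {x \<in> space borel. \<lfloor>x $ i / h\<rfloor> = j i})" by (auto simp: cell_def)
  also have "\<dots> \<in> sets borel"
  proof (rule sets.finite_INT)
    show "{x \<in> space borel. \<lfloor>x $ i / h\<rfloor> = j i} \<in> sets borel" for i
      by measurable
  qed auto
  finally show ?thesis .
qed

lemma cell_iff: "h > 0 \<Longrightarrow> x \<in> cell h j \<longleftrightarrow> (\<forall>i. of_int (j i) * h \<le> x $ i \<and> x $ i < (of_int (j i) + 1) * h)"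
proof -
  assume h: "h > 0"
  have "j i = \<lfloor>x $ i / h\<rfloor> \<longleftrightarrow> of_int (j i) * h \<le> x $ i \<and> x $ i < (of_int (j i) + 1) * h" for i
    unfolding eq_commute[of "j i"] floor_eq_iff using h by (simp add: pos_le_divide_eq pos_divide_less_eq)
  then show ?thesis by (simp add: cell_def)
qed

lemma cell_measure:
  fixes j :: "'n::finite \<Rightarrow> int"
  assumes h: "h > 0"
  shows "emeasure lborel (cell h j :: (real^'n) set) = ennreal (h ^ CARD('n))"
proof -
  define l :: "real^'n" where "l = (\<chi> i. of_int (j i) * h)"
  define u :: "real^'n" where "u = (\<chi> i. (of_int (j i) + 1) * h)"
  have ul: "(u - l) \<bullet> b = h" if "b \<in> Basis" for b
    using that by (auto simp: Basis_vec_def inner_axis u_def l_def algebra_simps)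
  have prod: "(\<Prod>b\<in>Basis. (u - l) \<bullet> b) = h ^ CARD('n)" by (simp add: ul)
  have le: "l \<bullet> b \<le> u \<bullet> b" if "b \<in> Basis" for b
    using ul[OF that] h by (simp add: inner_diff_left)
  have "box l u \<subseteq> cell h j"
    by (auto simp: cell_iff[OF h] mem_box_cart l_def u_def less_imp_le)
  then have 1: "ennreal (h ^ CARD('n)) \<le> emeasure lborel (cell h j :: (real^'n) set)"
    using emeasure_mono[of "box l u" "cell h j" lborel] le prod by (simp add: emeasure_lborel_box)
  have "cell h j \<subseteq> cbox l u"
    by (auto simp: cell_iff[OF h] mem_box_cart l_def u_def less_imp_le)
  then have 2: "emeasure lborel (cell h j :: (real^'n) set) \<le> ennreal (h ^ CARD('n))"
    using emeasure_mono[of "cell h j" "cbox l u" lborel] le prod by (simp add: emeasure_lborel_cbox)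
  show ?thesis using 1 2 by simp
qed

lemma cell_diameter:
  fixes x y :: "real^'n::finite"
  assumes h: "h > 0" and "x \<in> cell h j" "y \<in> cell h j"
  shows "norm (x - y) \<le> real CARD('n) * h"
proof -
  have "norm (x - y) \<le> (\<Sum>i\<in>UNIV. \<bar>(x - y) $ i\<bar>)" by (rule norm_le_l1_cart)
  also have "\<dots> \<le> (\<Sum>i\<in>(UNIV :: 'n set). h)"
  proof (rule sum_mono)
    fix i
    have "of_int (j i) * h \<le> x $ i" "x $ i < (of_int (j i) + 1) * h"
      "of_int (j i) * h \<le> y $ i" "y $ i < (of_int (j i) + 1) * h"
      using assms by (auto simp: cell_iff[OF h])
    then show "\<bar>(x - y) $ i\<bar> \<le> h" by (simp add: abs_if distrib_right)
  qed
  finally show ?thesis by simp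
qed

lemma bounded_cover_cells:
  assumes "bounded (S :: (real^'n::finite) set)" "h > 0"
  obtains I where "finite I" "S \<subseteq> (\<Union>j\<in>I. cell h j)"
proof -
  obtain R where R: "\<And>x. x \<in> S \<Longrightarrow> norm x \<le> R" using assms(1) bounded_iff by metis
  define m where "m = \<lceil>R / h\<rceil> + 1"
  define I where "I = (UNIV :: 'n set) \<rightarrow>\<^sub>E {-m..m}"
  have "finite I" unfolding I_def by (intro finite_PiE) auto
  moreover have "x \<in> (\<Union>j\<in>I. cell h j)" if "x \<in> S" for x
  proof
    show "x \<in> cell h (\<lambda>i. \<lfloor>x $ i / h\<rfloor>)" by (simp add: cell_def)
    have "\<lfloor>x $ i / h\<rfloor> \<in> {-m..m}" for i
    proof -
      have "\<bar>x $ i\<bar> \<le> R" using component_le_norm_cart[of x i] R[OF that] by simp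
      then have "\<bar>x $ i / h\<bar> \<le> R / h" using assms(2) by (simp add: abs_divide divide_right_mono)
      then have "- (R / h) \<le> x $ i / h" "x $ i / h \<le> R / h" unfolding abs_le_iff by linarith+
      then show ?thesis unfolding m_def by (simp, linarith)
    qed
    then show "(\<lambda>i. \<lfloor>x $ i / h\<rfloor>) \<in> I" by (auto simp: I_def)
  qed
  ultimately show thesis using that by blast
qed

text \<open>Expand the square: every integral reduces to the measure of \<open>S\<close> and the
  first two moments of \<open>v\<close> on it. The identity lets nonlocal energy bound the distance
  from the mean; the last part, Jensen's inequality, bounds the mean itself.\<close>

lemma variance_double_integral:
  fixes v :: "'a::euclidean_space \<Rightarrow> real" and S :: "'a set"
  assumes [measurable]: "v \<in> borel_measurable borel" "S \<in> sets borel" and v2: "integrable lborel (\<lambda>x. (v x)\<^sup>2)"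
    and m: "emeasure lborel S = ennreal m" "m > 0"
  defines "av \<equiv> (\<integral>x. indicator S x * v x \<partial>lborel) / m"
  shows "(\<integral>\<^sup>+x. \<integral>\<^sup>+y. ennreal (indicator S x * indicator S y * (v x - v y)\<^sup>2) \<partial>lborel \<partial>lborel)
      = ennreal (2 * m * (\<integral>x. indicator S x * (v x - av)\<^sup>2 \<partial>lborel))" (is ?eq)
    and "integrable lborel (\<lambda>x. indicator S x * (v x - av)\<^sup>2)" (is ?int)
    and "av\<^sup>2 * m \<le> (\<integral>x. (v x)\<^sup>2 \<partial>lborel)" (is ?le)
proof -
  define A where "A = (\<integral>x. indicator S x * (v x)\<^sup>2 \<partial>lborel)"
  define a where "a = (\<integral>x. indicator S x * v x \<partial>lborel)"
  have iS: "integrable lborel (\<lambda>x. indicator S x :: real)" using m by (simp add: integrable_indicator_iff)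
  have lS: "measure lborel S = m" using m by (simp add: measure_def)
  have iv2: "integrable lborel (\<lambda>x. indicator S x * (v x)\<^sup>2)"
    by (rule Bochner_Integration.integrable_bound[OF v2]) (auto simp: indicator_def)
  have iv: "integrable lborel (\<lambda>x. indicator S x * v x)"
  proof (rule Bochner_Integration.integrable_bound)
    show "integrable lborel (\<lambda>x. indicator S x + indicator S x * (v x)\<^sup>2)"
      by (intro Bochner_Integration.integrable_add iS iv2)
    have "\<bar>t\<bar> \<le> 1 + t\<^sup>2" for t :: real
      using zero_le_power2[of "\<bar>t\<bar> - 1/2"] by (simp add: power2_diff power_divide)
    then show "AE x in lborel. norm (indicator S x * v x) \<le> norm (indicator S x + indicator S x * (v x)\<^sup>2)"
      by (auto simp: indicator_def)
  qed measurable
  have quad: "integrable lborel (\<lambda>y. indicator S y * (p * (v y)\<^sup>2 + q * v y + r))"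
    "(\<integral>y. indicator S y * (p * (v y)\<^sup>2 + q * v y + r) \<partial>lborel) = p * A + q * a + r * m" for p q r
  proof -
    have eq: "(\<lambda>y. indicator S y * (p * (v y)\<^sup>2 + q * v y + r))
        = (\<lambda>y. p * (indicator S y * (v y)\<^sup>2) + q * (indicator S y * v y) + r * indicator S y)"
      by (simp add: algebra_simps)
    show "integrable lborel (\<lambda>y. indicator S y * (p * (v y)\<^sup>2 + q * v y + r))"
      unfolding eq by (intro Bochner_Integration.integrable_add integrable_mult_right iS iv iv2)
    show "(\<integral>y. indicator S y * (p * (v y)\<^sup>2 + q * v y + r) \<partial>lborel) = p * A + q * a + r * m"
      unfolding eq A_def a_def by (simp add: iS iv iv2 lS)
  qed
  have inner: "(\<integral>\<^sup>+y. ennreal (indicator S x * indicator S y * (v x - v y)\<^sup>2) \<partial>lborel)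
      = ennreal (indicator S x * (m * (v x)\<^sup>2 + (- 2 * a) * v x + A))" for x
  proof -
    have e: "indicator S x * indicator S y * (v x - v y)\<^sup>2
        = indicator S x * (indicator S y * (1 * (v y)\<^sup>2 + (- 2 * v x) * v y + (v x)\<^sup>2))" for y
      by (simp add: power2_eq_square algebra_simps)
    have "(\<integral>\<^sup>+y. ennreal (indicator S x * indicator S y * (v x - v y)\<^sup>2) \<partial>lborel)
        = ennreal (\<integral>y. indicator S x * indicator S y * (v x - v y)\<^sup>2 \<partial>lborel)"
    proof (rule nn_integral_eq_integral)
      show "integrable lborel (\<lambda>y. indicator S x * indicator S y * (v x - v y)\<^sup>2)"
        unfolding e by (intro integrable_mult_right quad(1))
    qed simp
    also have "(\<integral>y. indicator S x * indicator S y * (v x - v y)\<^sup>2 \<partial>lborel)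
        = indicator S x * (1 * A + (- 2 * v x) * a + (v x)\<^sup>2 * m)"
      unfolding e using quad(2)[of 1 "- 2 * v x" "(v x)\<^sup>2"] by (simp only: integral_mult_right_zero)
    also have "\<dots> = indicator S x * (m * (v x)\<^sup>2 + (- 2 * a) * v x + A)" by (simp add: algebra_simps)
    finally show ?thesis .
  qed
  have nonneg: "0 \<le> indicator S x * (m * (v x)\<^sup>2 + (- 2 * a) * v x + A)" for x
  proof -
    have "0 \<le> (\<integral>y. indicator S x * (indicator S y * (1 * (v y)\<^sup>2 + (- 2 * v x) * v y + (v x)\<^sup>2)) \<partial>lborel)"
    proof (rule Bochner_Integration.integral_nonneg)
      fix y
      have "1 * (v y)\<^sup>2 + (- 2 * v x) * v y + (v x)\<^sup>2 = (v x - v y)\<^sup>2" by (simp add: power2_eq_square algebra_simps)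
      then show "0 \<le> indicator S x * (indicator S y * (1 * (v y)\<^sup>2 + (- 2 * v x) * v y + (v x)\<^sup>2))" by simp
    qed
    then show ?thesis unfolding integral_mult_right_zero quad(2) by (simp add: algebra_simps)
  qed
  have av: "av = a / m" by (simp add: av_def a_def)
  have sq: "(v x - av)\<^sup>2 = 1 * (v x)\<^sup>2 + (- 2 * av) * v x + av\<^sup>2" for x
    by (simp add: power2_eq_square algebra_simps)
  have V: "(\<integral>x. indicator S x * (v x - av)\<^sup>2 \<partial>lborel) = A - a\<^sup>2 / m"
    unfolding sq quad(2) using m(2) by (simp add: av power2_eq_square field_simps)
  show ?int unfolding sq by (rule quad(1))
  have "(\<integral>\<^sup>+x. \<integral>\<^sup>+y. ennreal (indicator S x * indicator S y * (v x - v y)\<^sup>2) \<partial>lborel \<partial>lborel)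
      = ennreal (\<integral>x. indicator S x * (m * (v x)\<^sup>2 + (- 2 * a) * v x + A) \<partial>lborel)"
    unfolding inner by (rule nn_integral_eq_integral[OF quad(1)]) (use nonneg in simp)
  also have "(\<integral>x. indicator S x * (m * (v x)\<^sup>2 + (- 2 * a) * v x + A) \<partial>lborel) = 2 * m * (A - a\<^sup>2 / m)"
    unfolding quad(2) using m(2) by (simp add: power2_eq_square field_simps)
  finally show ?eq unfolding V .
  have "0 \<le> (\<integral>x. indicator S x * (v x - av)\<^sup>2 \<partial>lborel)" by (rule Bochner_Integration.integral_nonneg) simp
  then have "av\<^sup>2 * m \<le> A" unfolding V using m(2) by (simp add: av power2_eq_square)
  also have "A \<le> (\<integral>x. (v x)\<^sup>2 \<partial>lborel)"
    unfolding A_def by (rule integral_mono[OF iv2 v2]) (auto simp: indicator_def)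
  finally show ?le .
qed

lemma cls_sum:
  assumes "finite J" "\<And>j. j \<in> J \<Longrightarrow> f j \<in> sq_int"
  shows "(\<lambda>x. \<Sum>j\<in>J. f j x) \<in> sq_int" "cls (\<lambda>x. \<Sum>j\<in>J. f j x) = (\<Sum>j\<in>J. cls (f j))"
proof -
  have "(\<lambda>x. \<Sum>j\<in>J. f j x) \<in> sq_int \<and> cls (\<lambda>x. \<Sum>j\<in>J. f j x) = (\<Sum>j\<in>J. cls (f j))"
    using assms
  proof (induction J rule: finite_induct)
    case empty
    have "cls (\<lambda>_ :: 'b. 0 :: real) = 0"
      using cls_scale[of "\<lambda>_. 0" 0] by (simp add: sq_int_def)
    then show ?case by (simp add: sq_int_def)
  qed (simp add: sq_int_add cls_add)
  then show "(\<lambda>x. \<Sum>j\<in>J. f j x) \<in> sq_int" "cls (\<lambda>x. \<Sum>j\<in>J. f j x) = (\<Sum>j\<in>J. cls (f j))" by blast+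
qed

section \<open>Approximation by means over cells\<close>

context kernel begin

text \<open>A Poincare inequality on each cell: two distinct points of a cell are at distance at
  most n h, n being the dimension, where the kernel is at least \<open>c\<close>, and the sets of
  pairs within single cells are disjoint. The approximant takes the mean of \<open>U\<close> on each
  cell.\<close>

lemma cell_approximation:
  assumes h: "h > 0" and I: "finite I" "\<Omega> \<subseteq> (\<Union>j\<in>I. cell h j)" and U: "U \<in> D" and M: "(norm U)\<^sup>2 \<le> M"
  defines "c \<equiv> \<theta> * (real CARD('n) * h) powr (- (real CARD('n) + 2 * s))"
  shows "\<exists>V\<in>{\<Sum>j\<in>I. a j *\<^sub>R cls (indicator (cell h j)) | a. \<forall>j\<in>I. \<bar>a j\<bar> \<le> sqrt (M / h ^ CARD('n))}.
    (norm (U - V))\<^sup>2 \<le> B U U / (2 * h ^ CARD('n) * c)"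
proof -
  define m where "m = h ^ CARD('n)"
  have m: "m > 0" using h by (simp add: m_def)
  have c: "c > 0" using \<theta> h by (simp add: c_def)
  \<comment> \<open>A representative that vanishes everywhere outside \<Omega>: two points at which
    it differs then form a pair in Q.\<close>
  define v where "v x = indicator \<Omega> x * rep U x" for x
  have [measurable]: "v \<in> borel_measurable borel" unfolding v_def by measurable
  have "AE x in lebesgue. v x = rep U x"
    using D_vanish[OF U] by eventually_elim (auto simp: v_def indicator_def)
  note ae = this
  have vs: "v \<in> sq_int"
  proof (rule sq_int_bound)
    show "v \<in> borel_measurable lebesgue" by (intro measurable_completion) simp
    show "integrable lebesgue (\<lambda>x. (rep U x)\<^sup>2)" using rep_sq_int[of U] by (simp add: sq_int_def)
    show "AE x in lebesgue. (v x)\<^sup>2 \<le> (rep U x)\<^sup>2" using ae by eventually_elim simp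
  qed
  have Uv: "cls v = U" using cls_eq_iff[OF vs rep_sq_int[of U]] ae by simp
  have v2: "integrable lborel (\<lambda>x. (v x)\<^sup>2)"
    using vs by (subst integrable_completion[symmetric]) (simp_all add: sq_int_def)
  have v2_le: "(\<integral>x. (v x)\<^sup>2 \<partial>lborel) \<le> M"
    using norm_cls[OF vs] M by (simp add: Uv integral_completion)
  have BU: "(\<integral>\<^sup>+p. ennreal ((dq v p)\<^sup>2) \<partial>lborel) = ennreal (B U U)"
  proof -
    have dqs: "dq (rep U) \<in> sq_int" by (rule D_dq[OF U])
    have "(\<integral>\<^sup>+p. ennreal ((dq v p)\<^sup>2) \<partial>lborel) = (\<integral>\<^sup>+p. ennreal ((dq v p)\<^sup>2) \<partial>lebesgue)"
      by (simp add: nn_integral_completion)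
    also have "\<dots> = (\<integral>\<^sup>+p. ennreal ((dq (rep U) p)\<^sup>2) \<partial>lebesgue)"
    proof (rule nn_integral_cong_AE)
      show "AE p in lebesgue. ennreal ((dq v p)\<^sup>2) = ennreal ((dq (rep U) p)\<^sup>2)"
        using dq_cong[OF ae] by eventually_elim simp
    qed
    also have "\<dots> = ennreal (\<integral>p. (dq (rep U) p)\<^sup>2 \<partial>lebesgue)"
      using dqs by (intro nn_integral_eq_integral) (auto simp: sq_int_def)
    also have "(\<integral>p. (dq (rep U) p)\<^sup>2 \<partial>lebesgue) = B U U"
      using norm_cls[OF dqs] by (simp add: B_def \<E>_def power2_norm_eq_inner)
    finally show ?thesis .
  qed
  define S where "S j = (cell h j :: (real^'n) set)" for j
  have [measurable]: "S j \<in> sets borel" for j by (simp add: S_def)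
  have mS: "emeasure lborel (S j) = ennreal m" for j using cell_measure[OF h] by (simp add: S_def m_def)
  define av where "av j = (\<integral>x. indicator (S j) x * v x \<partial>lborel) / m" for j
  define Vj where "Vj j = (\<integral>x. indicator (S j) x * (v x - av j)\<^sup>2 \<partial>lborel)" for j
  note var = variance_double_integral[OF _ _ v2 mS m, folded av_def, folded Vj_def]
  have Vj0: "0 \<le> Vj j" for j unfolding Vj_def by (rule Bochner_Integration.integral_nonneg) simp
  have avb: "\<bar>av j\<bar> \<le> sqrt (M / m)" for j
  proof -
    have "(av j)\<^sup>2 * m \<le> M" using var(3)[of j] v2_le by simp
    then have "(av j)\<^sup>2 \<le> M / m" using m by (simp add: field_simps)
    then have "sqrt ((av j)\<^sup>2) \<le> sqrt (M / m)" by (rule real_sqrt_le_mono)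
    then show ?thesis by simp
  qed
  have sI: "indicator (S j) \<in> sq_int" for j
  proof (rule sq_int_bound)
    show "indicator (S j) \<in> borel_measurable lebesgue" by (intro measurable_completion) simp
    show "integrable lebesgue (\<lambda>x. indicator (S j) x :: real)"
      using mS[of j] by (subst integrable_completion) (simp_all add: integrable_indicator_iff)
  qed (auto simp: indicator_def)
  define w where "w x = (\<Sum>j\<in>I. av j * indicator (S j) x)" for x
  have avI: "(\<lambda>x. av j * indicator (S j) x) \<in> sq_int" for j by (intro sq_int_scale sI)
  have ws: "w \<in> sq_int" and wc: "cls w = (\<Sum>j\<in>I. av j *\<^sub>R cls (indicator (S j)))"
    using cls_sum[OF I(1), of "\<lambda>j x. av j * indicator (S j) x"] avI
    by (simp_all only: w_def[abs_def] cls_scale[OF sI])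
  have ind: "indicator (S j) x = (if j = i then 1 else 0 :: real)" if i: "x \<in> S i" for x i j
  proof (cases "j = i")
    case False
    then have "x \<notin> S j" using i cell_disjoint[of x h] unfolding S_def by blast
    then show ?thesis using False by simp
  qed (use i in simp)
  have ptw: "(v x - w x)\<^sup>2 = (\<Sum>j\<in>I. indicator (S j) x * (v x - av j)\<^sup>2)" for x
  proof (cases "\<exists>i\<in>I. x \<in> S i")
    case True
    then obtain i where i: "i \<in> I" "x \<in> S i" by blast
    have "w x = (\<Sum>j\<in>I. if j = i then av i else 0)" 
      unfolding w_def by (intro sum.cong refl) (simp add: ind[OF i(2)])
    then have w: "w x = av i" using i I(1) by simp
    have "(\<Sum>j\<in>I. indicator (S j) x * (v x - av j)\<^sup>2) = (\<Sum>j\<in>I. if j = i then (v x - av i)\<^sup>2 else 0)"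
      by (intro sum.cong refl) (simp add: ind[OF i(2)])
    then show ?thesis using i I(1) w by simp
  next
    case False
    then have "x \<notin> \<Omega>" using I(2) by (auto simp: S_def)
    then have "v x = 0" by (simp add: v_def)
    moreover have "w x = 0" unfolding w_def using False by (intro sum.neutral) auto
    moreover have "(\<Sum>j\<in>I. indicator (S j) x * (v x - av j)\<^sup>2) = 0" using False by (intro sum.neutral) auto
    ultimately show ?thesis by simp
  qed
  have dist: "(norm (U - cls w))\<^sup>2 = (\<Sum>j\<in>I. Vj j)"
  proof -
    have [measurable]: "w \<in> borel_measurable borel" unfolding w_def by measurable
    have "(norm (U - cls w))\<^sup>2 = (\<integral>x. (v x - w x)\<^sup>2 \<partial>lebesgue)"
      using norm_cls[OF sq_int_diff[OF vs ws]] cls_diff[OF vs ws] by (simp add: Uv)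
    also have "\<dots> = (\<integral>x. (v x - w x)\<^sup>2 \<partial>lborel)" by (rule integral_completion) measurable
    also have "\<dots> = (\<Sum>j\<in>I. Vj j)" unfolding ptw Vj_def
      by (rule Bochner_Integration.integral_sum) (rule var(2), simp_all)
    finally show ?thesis .
  qed
  define F where "F j p = ennreal (indicator (S j) (fst p) * indicator (S j) (snd p) * (v (fst p) - v (snd p))\<^sup>2)" for j p
  have [measurable]: "F j \<in> borel_measurable borel" for j unfolding F_def by measurable
  have FV: "(\<integral>\<^sup>+p. F j p \<partial>lborel) = ennreal (2 * m * Vj j)" for j
    using var(1)[of j] by (simp add: nn_integral_pair_fst) (simp add: F_def)
  \<comment> \<open>The cells are disjoint, so at most one summand is nonzero.\<close>
  have F_le: "ennreal c * (\<Sum>j\<in>I. F j p) \<le> ennreal ((dq v p)\<^sup>2)" for p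
  proof (cases "\<exists>i\<in>I. fst p \<in> S i \<and> snd p \<in> S i \<and> v (fst p) \<noteq> v (snd p)")
    case True
    then obtain i where i: "i \<in> I" "fst p \<in> S i" "snd p \<in> S i" and ne: "v (fst p) \<noteq> v (snd p)" by blast
    have "(\<Sum>j\<in>I. F j p) = (\<Sum>j\<in>I. if j = i then ennreal ((v (fst p) - v (snd p))\<^sup>2) else 0)"
      by (intro sum.cong refl) (simp add: F_def ind[OF i(2)] ind[OF i(3)])
    then have sumF: "(\<Sum>j\<in>I. F j p) = ennreal ((v (fst p) - v (snd p))\<^sup>2)" using i(1) I(1) by simp
    have Q: "p \<in> Q \<Omega>" using ne by (auto simp: Q_iff v_def indicator_def split: if_splits)
    have d: "norm (fst p - snd p) \<le> real CARD('n) * h" using i cell_diameter[OF h] by (auto simp: S_def)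
    have "(real CARD('n) * h) powr (- (real CARD('n) + 2 * s)) \<le> norm (fst p - snd p) powr (- (real CARD('n) + 2 * s))"
      using d ne s by (intro powr_mono2') auto
    then have "c \<le> low (fst p - snd p)" unfolding c_def low_def using \<theta> by (intro mult_left_mono) auto
    then have "c \<le> k (fst p - snd p)" using low_le_k[of "fst p - snd p"] by simp
    then have "c * (v (fst p) - v (snd p))\<^sup>2 \<le> k (fst p - snd p) * (v (fst p) - v (snd p))\<^sup>2"
      by (intro mult_right_mono) auto
    also have "\<dots> = (dq v p)\<^sup>2"
      using Q by (simp add: dq_def power_mult_distrib Wt_nonneg) (simp add: Wt_def)
    finally show ?thesis unfolding sumF using c by (simp add: ennreal_mult[symmetric] ennreal_leI)
  next
    case False
    then have "(\<Sum>j\<in>I. F j p) = 0" by (intro sum.neutral) (auto simp: F_def indicator_def)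
    then show ?thesis by simp
  qed
  have "ennreal (c * (2 * m * (\<Sum>j\<in>I. Vj j))) = ennreal c * (\<Sum>j\<in>I. ennreal (2 * m * Vj j))"
    using c m Vj0 by (simp add: sum_distrib_left ennreal_mult sum_nonneg flip: sum_ennreal)
  also have "\<dots> = (\<integral>\<^sup>+p. ennreal c * (\<Sum>j\<in>I. F j p) \<partial>lborel)"
    by (simp add: nn_integral_cmult nn_integral_sum FV)
  also have "\<dots> \<le> ennreal (B U U)" unfolding BU[symmetric] by (intro nn_integral_mono F_le)
  finally have "c * (2 * m * (\<Sum>j\<in>I. Vj j)) \<le> B U U"
    using nonneg[OF U] by simp
  then have "(norm (U - cls w))\<^sup>2 \<le> B U U / (2 * m * c)"
    unfolding dist using c m by (simp add: pos_le_divide_eq mult_ac)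
  then show ?thesis using avb unfolding wc m_def S_def by blast
qed

text \<open>The squared error of the cell means is of order h^(2 s): the kernel bound contributes
  h^(n + 2 s), and the volume of a cell takes h^n away. So sets bounded in the graph norm are
  uniformly close to compact sets of step functions, hence totally bounded.\<close>

lemma compact_embedding:
  fixes x :: "nat \<Rightarrow> (real^'n) l2"
  assumes x: "\<And>n. x n \<in> D" "\<And>n. B (x n) (x n) + (norm (x n))\<^sup>2 \<le> M"
  shows "\<exists>l r. strict_mono (r :: nat \<Rightarrow> nat) \<and> (x \<circ> r) \<longlonglongrightarrow> l"
proof -
  define S where "S = {U \<in> D. B U U + (norm U)\<^sup>2 \<le> M}"
  define N where "N = real CARD('n)"
  have N: "N > 0" by (simp add: N_def)
  have M0: "0 \<le> M" using order_trans[OF _ x(2)[of 0], of 0] nonneg[OF x(1)[of 0]] by simp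
  have fine: "\<exists>F. compact F \<and> (\<forall>U\<in>S. \<exists>V\<in>F. norm (U - V) \<le> e)" if e: "e > 0" for e :: real
  proof -
    \<comment> \<open>Chosen so that the error bound of \<open>cell_approximation\<close> is at most
      C0 h^(2 s).\<close>
    define C0 where "C0 = M * N powr (N + 2 * s) / (2 * \<theta>)"
    have "((\<lambda>h. C0 * h powr (2 * s)) \<longlongrightarrow> C0 * 0) (at_right 0)"
      by (intro tendsto_intros tendsto_zero_powrI[where b = "2 * s"]) (use s in \<open>auto intro: tendsto_intros eventually_at_right_less simp: eventually_at_filter\<close>)
    then have "\<forall>\<^sub>F h in at_right 0. C0 * h powr (2 * s) < e\<^sup>2"
      using e by (intro order_tendstoD(2)[of _ "C0 * 0"]) auto
    then obtain b where b: "b > 0" "\<And>h. 0 < h \<Longrightarrow> h < b \<Longrightarrow> C0 * h powr (2 * s) < e\<^sup>2"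
      by (auto simp: eventually_at_right_field)
    define h where "h = b / 2"
    have h: "h > 0" "C0 * h powr (2 * s) < e\<^sup>2" using b by (auto simp: h_def)
    obtain I where I: "finite I" "\<Omega> \<subseteq> (\<Union>j\<in>I. cell h j)" using bounded_cover_cells[OF bounded_Omega h(1)] by blast
    define F where "F = {\<Sum>j\<in>I. a j *\<^sub>R cls (indicator (cell h j) :: real^'n \<Rightarrow> real) | a. \<forall>j\<in>I. \<bar>a j\<bar> \<le> sqrt (M / h ^ CARD('n))}"
    have "compact F" unfolding F_def by (rule compact_bounded_combinations[OF I(1)])
    moreover have "\<exists>V\<in>F. norm (U - V) \<le> e" if "U \<in> S" for U
    proof -
      have U: "U \<in> D" "B U U + (norm U)\<^sup>2 \<le> M" using that by (auto simp: S_def)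
      have "(norm U)\<^sup>2 \<le> M" using U(2) nonneg[OF U(1)] by linarith
      from cell_approximation[OF h(1) I U(1) this]
      obtain V where V: "V \<in> F" "(norm (U - V))\<^sup>2 \<le> B U U / (2 * h ^ CARD('n) * (\<theta> * (N * h) powr (- (N + 2 * s))))"
        unfolding F_def N_def by blast
      have hN: "h ^ CARD('n) = h powr N" using h(1) by (simp add: N_def powr_realpow)
      have "B U U / (2 * h ^ CARD('n) * (\<theta> * (N * h) powr (- (N + 2 * s))))
          \<le> M / (2 * h ^ CARD('n) * (\<theta> * (N * h) powr (- (N + 2 * s))))"
        using U(2) h(1) \<theta> N by (intro divide_right_mono) (auto intro: order_trans[OF _ U(2)])
      also have "\<dots> = M * (N * h) powr (N + 2 * s) / (2 * \<theta> * h powr N)"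
        unfolding hN powr_minus[of "N * h" "N + 2 * s"] by (simp only: divide_inverse inverse_mult_distrib inverse_inverse_eq mult_ac)
      also have "(N * h) powr (N + 2 * s) = N powr (N + 2 * s) * (h powr N * h powr (2 * s))"
        using N h(1) by (simp add: powr_mult powr_add)
      also have "M * (N powr (N + 2 * s) * (h powr N * h powr (2 * s))) / (2 * \<theta> * h powr N) = C0 * h powr (2 * s)"
      proof -
        have "M * (X * (H * Y)) / (2 * \<theta> * H) = M * X / (2 * \<theta>) * Y" if "H \<noteq> 0" for X Y H :: real
          using that \<theta> by (simp add: field_simps)
        then show ?thesis unfolding C0_def using h(1) by simp
      qed
      finally have "(norm (U - V))\<^sup>2 \<le> e\<^sup>2" using V(2) h(2) by linarith
      then have "norm (U - V) \<le> e" by (rule power2_le_imp_le) (use e in simp)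
      then show ?thesis using V(1) by blast
    qed
    ultimately show ?thesis by blast
  qed
  have "compact (closure S)"
    unfolding compact_eq_totally_bounded
  proof (intro conjI allI impI)
    show "complete (closure S)" by (simp add: complete_eq_closed)
    fix e :: real assume e: "e > 0"
    obtain F where F: "compact F" "\<And>U. U \<in> S \<Longrightarrow> \<exists>V\<in>F. norm (U - V) \<le> e / 3"
      using fine[of "e / 3"] e by auto
    have "\<forall>e>0. \<exists>k. finite k \<and> F \<subseteq> (\<Union>x\<in>k. ball x e)" using F(1) unfolding compact_eq_totally_bounded by blast
    then obtain k where k: "finite k" "F \<subseteq> (\<Union>x\<in>k. ball x (e / 3))" using e by (meson divide_pos_pos zero_less_numeral)
    have "\<exists>z\<in>k. W \<in> ball z e" if W: "W \<in> closure S" for W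
    proof -
      have "\<exists>U\<in>S. dist U W < e / 3" 
        using W[unfolded closure_approachable, rule_format, of "e / 3"] e by simp
      then obtain U where U: "U \<in> S" "dist U W < e / 3" by blast
      obtain V where V: "V \<in> F" "norm (U - V) \<le> e / 3" using F(2)[OF U(1)] by blast
      obtain z where z: "z \<in> k" "dist z V < e / 3" using k(2) V(1) by auto
      have "dist z W \<le> dist z V + dist V U + dist U W"
        using dist_triangle[of z W V] dist_triangle[of V W U] by linarith
      also have "dist V U \<le> e / 3" using V(2) by (simp add: dist_norm norm_minus_commute)
      finally have "dist z W < e" using z(2) U(2) by linarith
      then show ?thesis using z(1) by auto
    qed
    then show "\<exists>k. finite k \<and> closure S \<subseteq> (\<Union>x\<in>k. ball x e)" using k(1) by blast
  qed
  then have "seq_compact (closure S)" by (simp add: compact_eq_seq_compact_metric)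
  moreover have "\<forall>n. x n \<in> closure S"
  proof
    fix n show "x n \<in> closure S" by (rule subsetD[OF closure_subset]) (simp add: S_def x)
  qed
  ultimately show ?thesis by (auto elim!: seq_compactE)
qed

sublocale compact_form D B
  by unfold_locales (rule form_complete, assumption+, rule compact_embedding)

end

section \<open>Eigenvalues\<close>

lemma (in compact_form) gap_from_eigenvectors:
  assumes G: "finite G" "G \<subseteq> D"
    and eigen: "\<And>g y. g \<in> G \<Longrightarrow> y \<in> D \<Longrightarrow> B g y = ev g * inner g y"
    and orthonormal: "\<And>g h. g \<in> G \<Longrightarrow> h \<in> G \<Longrightarrow> inner g h = (if g = h then 1 else 0)"
    and none: "\<And>e \<nu>. e \<in> D \<Longrightarrow> norm e = 1 \<Longrightarrow> (\<And>g. g \<in> G \<Longrightarrow> inner e g = 0) \<Longrightarrow> \<nu> < lp \<Longrightarrow>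
      (\<And>y. y \<in> D \<Longrightarrow> B e y = \<nu> * inner e y) \<Longrightarrow> False"
    and z: "z \<in> D" "\<And>g. g \<in> G \<Longrightarrow> inner z g = 0"
  shows "lp * (norm z)\<^sup>2 \<le> B z z"
proof (rule ccontr)
  assume "\<not> ?thesis"
  then have Bz: "B z z < lp * (norm z)\<^sup>2" by simp
  define E where "E = {x \<in> D. \<forall>g\<in>G. inner x g = 0}"
  have "subspace E" unfolding E_def
    by (rule subspaceI) (auto simp: inner_add_left)
  moreover have "E \<subseteq> D" by (auto simp: E_def)
  moreover have "l \<in> E" if "\<And>n. x n \<in> E" "x \<longlonglongrightarrow> l" "l \<in> D" for x l
  proof -
    have "inner l g = 0" if "g \<in> G" for g
    proof -
      have "(\<lambda>n. inner (x n) g) \<longlonglongrightarrow> inner l g" by (intro tendsto_intros \<open>x \<longlonglongrightarrow> l\<close>)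
      moreover have "inner (x n) g = 0" for n using \<open>\<And>n. x n \<in> E\<close> \<open>g \<in> G\<close> by (auto simp: E_def)
      ultimately show ?thesis by (simp add: LIMSEQ_const_iff)
    qed
    then show ?thesis using \<open>l \<in> D\<close> by (simp add: E_def)
  qed
  moreover have "z \<in> E" using z by (simp add: E_def)
  ultimately obtain e \<nu> where e: "e \<in> E" "\<nu> < lp" "norm e = 1" and eq: "\<And>y. y \<in> E \<Longrightarrow> B e y = \<nu> * inner e y"
    using rayleigh_minimizer[of E z lp] Bz by metis
  have eD: "e \<in> D" and perp: "\<And>g. g \<in> G \<Longrightarrow> inner e g = 0" using e(1) by (auto simp: E_def)
  \<comment> \<open>The Euler equation is known against \<open>E\<close> only. The remaining
    component p of y lies in the span of \<open>G\<close>, where both sides vanish because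
    \<open>G\<close> consists of eigenvectors orthogonal to e.\<close>
  have "B e y = \<nu> * inner e y" if y: "y \<in> D" for y
  proof -
    define p where "p = (\<Sum>g\<in>G. inner y g *\<^sub>R g)"
    have pD: "p \<in> D" unfolding p_def using G by (intro D_sum D_simps) auto
    have "B p e = (\<Sum>g\<in>G. B (inner y g *\<^sub>R g) e)" unfolding p_def using G eD by (intro sum) auto
    also have "\<dots> = 0"
    proof (rule sum.neutral, rule ballI)
      fix g assume g: "g \<in> G"
      then have "B (inner y g *\<^sub>R g) e = inner y g * (ev g * inner g e)"
        using G eD by (simp add: scale eigen subset_iff)
      then show "B (inner y g *\<^sub>R g) e = 0" using perp[OF g] by (simp add: inner_commute)
    qed
    finally have "B e p = 0" using sym[OF eD pD] by simp
    moreover have "inner e p = 0" unfolding p_def by (simp add: inner_sum_right perp)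
    moreover have "y - p \<in> E"
    proof -
      have "inner (y - p) g = 0" if g: "g \<in> G" for g
      proof -
        have "inner p g = (\<Sum>h\<in>G. inner y h * inner h g)" by (simp add: p_def inner_sum_left)
        also have "\<dots> = (\<Sum>h\<in>G. if h = g then inner y g else 0)"
          using g by (intro sum.cong) (auto simp: orthonormal)
        finally show ?thesis using g G by (simp add: inner_diff_left)
      qed
      then show ?thesis using y pD by (simp add: E_def)
    qed
    from eq[OF this] have "B e y - B e p = \<nu> * (inner e y - inner e p)"
      using y pD eD by (simp add: diff2 inner_diff_right)
    ultimately show ?thesis by simp
  qed
  then show False using none[OF eD e(3) perp e(2)] by blast
qed

lemma orthonormal_basis_of_span:
  fixes F :: "'h::real_inner set"
  assumes "finite F"
  obtains G where "finite G" "G \<subseteq> span F" "\<And>g h. g \<in> G \<Longrightarrow> h \<in> G \<Longrightarrow> inner g h = (if g = h then 1 else 0)"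
    "\<And>u. u \<in> span F \<Longrightarrow> (\<And>g. g \<in> G \<Longrightarrow> inner u g = 0) \<Longrightarrow> u = 0"
proof -
  obtain C where C: "finite C" "span C = span F" "pairwise orthogonal C"
    using basis_orthogonal[OF assms] by metis
  define n where "n c = (1 / norm c) *\<^sub>R c" for c :: 'h
  define G where "G = n ` (C - {0})"
  have nn: "inner (n c) (n c) = 1" if "c \<noteq> 0" for c
    using that by (simp add: n_def divide_simps power2_norm_eq_inner[symmetric] power2_eq_square)
  show thesis
  proof (rule that)
    show "finite G" using C(1) by (simp add: G_def)
    show "G \<subseteq> span F" unfolding G_def n_def C(2)[symmetric] by (auto intro: span_scale span_base)
    show "inner g h = (if g = h then 1 else 0)" if gh: "g \<in> G" "h \<in> G" for g h
    proof (cases "g = h")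
      case True
      then show ?thesis using gh nn by (auto simp: G_def)
    next
      case False
      obtain c d where cd: "c \<in> C" "d \<in> C" "g = n c" "h = n d" using gh by (auto simp: G_def)
      then have "c \<noteq> d" using False by blast
      then have "inner c d = 0" using C(3) cd by (auto simp: pairwise_def orthogonal_def)
      then show ?thesis using False cd by (simp add: n_def)
    qed
    show "u = 0" if u: "u \<in> span F" "\<And>g. g \<in> G \<Longrightarrow> inner u g = 0" for u
    proof -
      have "orthogonal u c" if "c \<in> C" for c
      proof (cases "c = 0")
        case False
        then have "inner u (n c) = 0" using u(2) that by (auto simp: G_def)
        then show ?thesis using False by (simp add: n_def orthogonal_def)
      qed (simp add: orthogonal_def)
      then have "orthogonal u u" using orthogonal_to_span[of u C u] u(1) C(2) by blast
      then show ?thesis by (simp add: orthogonal_def)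
    qed
  qed
qed

section \<open>Eigenspaces as subspaces of L2, and the gap above finitely many of them\<close>

context kernel begin

definition eig :: "real \<Rightarrow> (real^'n) l2 set" where
  "eig \<mu> = {E \<in> D. \<forall>Y\<in>D. B E Y = \<mu> * inner E Y}"

lemma subspace_eig: "subspace (eig \<mu>)"
  unfolding eig_def by (rule subspaceI) (auto simp: add scale inner_add_left distrib_left)

lemma cls_in_eig:
  assumes e: "e \<in> eigenspace \<Omega> K \<mu>" shows "cls e \<in> eig \<mu>"
proof -
  have eZ: "e \<in> space_Z \<Omega> K" using e by (simp add: eigenspace_def)
  have "B (cls e) Y = \<mu> * inner (cls e) Y" if Y: "Y \<in> D" for Y
  proof -
    have YZ: "rep Y \<in> space_Z \<Omega> K" by (rule D_rep_space_Z[OF Y])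
    have "inner_Z \<Omega> K e (rep Y) = \<mu> * (\<integral>x. e x * rep Y x \<partial>lebesgue_on \<Omega>)"
      using e YZ by (simp add: eigenspace_def)
    then show ?thesis by (simp add: inner_Z_B[OF eZ YZ] inner_Omega[OF eZ])
  qed
  then show ?thesis using space_Z_cls(3)[OF eZ] by (simp add: eig_def)
qed

lemma rep_in_eigenspace:
  assumes E: "E \<in> eig \<mu>" shows "rep E \<in> eigenspace \<Omega> K \<mu>"
proof -
  have ED: "E \<in> D" using E by (simp add: eig_def)
  have EZ: "rep E \<in> space_Z \<Omega> K" by (rule D_rep_space_Z[OF ED])
  have "inner_Z \<Omega> K (rep E) \<phi> = \<mu> * (\<integral>x. rep E x * \<phi> x \<partial>lebesgue_on \<Omega>)" if \<phi>: "\<phi> \<in> space_Z \<Omega> K" for \<phi>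
    using E space_Z_cls(3)[OF \<phi>]
    by (simp add: inner_Z_B[OF EZ \<phi>] inner_Omega[OF EZ space_Z_cls(1)[OF \<phi>]] eig_def)
  then show ?thesis using EZ by (simp add: eigenspace_def)
qed

lemma eig_finite_span:
  assumes "has_dim_ae (eigenspace \<Omega> K \<mu>) m"
  obtains F where "finite F" "F \<subseteq> eig \<mu>" "eig \<mu> \<subseteq> span F"
proof -
  from assms[unfolded has_dim_ae_def]
  obtain e :: "nat \<Rightarrow> real^'n \<Rightarrow> real" where e_all: "\<forall>i<m. e i \<in> eigenspace \<Omega> K \<mu>"
    and sp: "\<forall>u\<in>eigenspace \<Omega> K \<mu>. \<exists>c :: nat \<Rightarrow> real. AE x in lebesgue. u x = (\<Sum>i<m. c i * e i x)"
    by (elim exE conjE) (rule that)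
  have e: "e i \<in> eigenspace \<Omega> K \<mu>" if "i < m" for i using e_all that by blast
  have es: "e i \<in> sq_int" if "i < m" for i
    using e[OF that] space_Z_cls(1) by (simp add: eigenspace_def)
  define F where "F = (\<lambda>i. cls (e i)) ` {..<m}"
  have "U \<in> span F" if U: "U \<in> eig \<mu>" for U
  proof -
    obtain c where c: "AE x in lebesgue. rep U x = (\<Sum>i<m. c i * e i x)"
      using bspec[OF sp rep_in_eigenspace[OF U]] by blast
    have s: "(\<lambda>x. c i * e i x) \<in> sq_int" if "i \<in> {..<m}" for i by (rule sq_int_scale, rule es) (use that in simp)
    have "U = cls (\<lambda>x. \<Sum>i<m. c i * e i x)"
      using cls_eq_iff[OF rep_sq_int[of U] cls_sum(1)[OF finite_lessThan s]] c by simp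
    also have "\<dots> = (\<Sum>i<m. cls (\<lambda>x. c i * e i x))" by (rule cls_sum(2)[OF finite_lessThan s])
    also have "\<dots> = (\<Sum>i<m. c i *\<^sub>R cls (e i))" by (intro sum.cong refl) (simp add: cls_scale es)
    also have "\<dots> \<in> span F" by (intro span_sum span_scale span_base) (auto simp: F_def)
    finally show ?thesis .
  qed
  then show thesis using that[of F] cls_in_eig e by (auto simp: F_def)
qed

lemma eig_orthogonal:
  assumes "E \<in> eig \<mu>" "E' \<in> eig \<mu>'" "\<mu> \<noteq> \<mu>'" shows "inner E E' = 0"
proof -
  have "B E E' = \<mu> * inner E E'" "B E' E = \<mu>' * inner E' E" "B E E' = B E' E"
    using assms sym[of E E'] by (auto simp: eig_def)
  then have "\<mu> * inner E E' = \<mu>' * inner E E'" by (simp only: inner_commute[of E' E])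
  then show ?thesis using assms(3) by simp
qed

text \<open>Orthonormal bases of the eigenspaces for \<open>M\<close> together form
  \<open>G\<close>. A Rayleigh minimiser orthogonal to \<open>G\<close> with value \<nu> < lp would
  have \<nu> in \<open>M\<close>, hence lie in an eigenspace to whose basis it is orthogonal, and so
  vanish. With \<open>M\<close> empty the same argument gives the gap below the first
  eigenvalue.\<close>

lemma spectral_gap_exists:
  assumes M: "finite M" "\<And>\<mu>. \<mu> \<in> M \<Longrightarrow> \<mu> \<le> lm" "\<And>\<mu>. \<mu> \<in> M \<Longrightarrow> \<exists>m. has_dim_ae (eigenspace \<Omega> K \<mu>) m"
    and below: "\<And>\<mu>. is_eigenvalue \<Omega> K \<mu> \<Longrightarrow> \<mu> < lp \<Longrightarrow> \<mu> \<in> M"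
    and less: "lm < lp"
  shows "\<exists>G ev. spectral_gap D B G ev lm lp"
proof -
  define basis where "basis \<mu> G \<longleftrightarrow> finite G \<and> G \<subseteq> eig \<mu> \<and>
      (\<forall>g\<in>G. \<forall>h\<in>G. inner g h = (if g = h then 1 else 0)) \<and>
      (\<forall>u\<in>eig \<mu>. (\<forall>g\<in>G. inner u g = 0) \<longrightarrow> u = 0)" for \<mu> G
  have "\<exists>G. basis \<mu> G" if \<mu>: "\<mu> \<in> M" for \<mu>
  proof -
    obtain m where "has_dim_ae (eigenspace \<Omega> K \<mu>) m" using M(3)[OF \<mu>] by blast
    then obtain F where F: "finite F" "F \<subseteq> eig \<mu>" "eig \<mu> \<subseteq> span F" by (rule eig_finite_span)
    have "span F \<subseteq> eig \<mu>" using F(2) subspace_eig by (rule span_minimal)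
    moreover obtain G where "finite G" "G \<subseteq> span F" "\<And>g h. g \<in> G \<Longrightarrow> h \<in> G \<Longrightarrow> inner g h = (if g = h then 1 else 0)"
      "\<And>u. u \<in> span F \<Longrightarrow> (\<And>g. g \<in> G \<Longrightarrow> inner u g = 0) \<Longrightarrow> u = 0"
      using orthonormal_basis_of_span[OF F(1)] by metis
    ultimately show ?thesis using F(3) unfolding basis_def by (intro exI[of _ G]) blast
  qed
  then obtain Gf where GfB: "\<And>\<mu>. \<mu> \<in> M \<Longrightarrow> basis \<mu> (Gf \<mu>)" by metis
  have Gf1: "finite (Gf \<mu>)" if "\<mu> \<in> M" for \<mu> using GfB[OF that] by (simp only: basis_def)
  have Gf2: "Gf \<mu> \<subseteq> eig \<mu>" if "\<mu> \<in> M" for \<mu> using GfB[OF that] by (simp only: basis_def)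
  have Gf3: "inner g h = (if g = h then 1 else 0)" if "\<mu> \<in> M" "g \<in> Gf \<mu>" "h \<in> Gf \<mu>" for \<mu> g h
    using GfB[OF that(1)] that(2,3) by (simp only: basis_def)
  have Gf4: "u = 0" if "\<mu> \<in> M" "u \<in> eig \<mu>" "\<And>g. g \<in> Gf \<mu> \<Longrightarrow> inner u g = 0" for \<mu> u
  proof -
    have "\<forall>u\<in>eig \<mu>. (\<forall>g\<in>Gf \<mu>. inner u g = 0) \<longrightarrow> u = 0"
      using GfB[OF that(1)] unfolding basis_def by (elim conjE)
    from bspec[OF this that(2)] that(3) show ?thesis by blast
  qed
  define G where "G = (\<Union>\<mu>\<in>M. Gf \<mu>)"
  \<comment> \<open>The vectors are normalised, so B g g recovers the eigenvalue without recording
    which eigenspace g came from.\<close>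
  define ev where "ev g = B g g" for g
  have GE: "\<exists>\<mu>\<in>M. g \<in> Gf \<mu> \<and> g \<in> eig \<mu> \<and> ev g = \<mu> \<and> inner g g = 1" if g: "g \<in> G" for g
  proof -
    obtain \<mu> where \<mu>: "\<mu> \<in> M" "g \<in> Gf \<mu>" using g by (auto simp: G_def)
    then have "g \<in> eig \<mu>" "inner g g = 1" using Gf2[OF \<mu>(1)] Gf3[OF \<mu> \<mu>(2)] by auto
    moreover from this have "ev g = \<mu>" by (auto simp: ev_def eig_def)
    ultimately show ?thesis using \<mu> by blast
  qed
  have G1: "finite G" using M(1) Gf1 by (auto simp: G_def)
  have G2: "G \<subseteq> D" using GE by (auto simp: eig_def)
  have G3: "inner g h = (if g = h then 1 else 0)" if gh: "g \<in> G" "h \<in> G" for g h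
  proof -
    obtain \<mu> where \<mu>: "\<mu> \<in> M" "g \<in> Gf \<mu>" "g \<in> eig \<mu>" "inner g g = 1" using GE[OF gh(1)] by blast
    obtain \<mu>' where \<mu>': "\<mu>' \<in> M" "h \<in> Gf \<mu>'" "h \<in> eig \<mu>'" using GE[OF gh(2)] by blast
    show ?thesis
    proof (cases "\<mu> = \<mu>'")
      case True then show ?thesis using Gf3[OF \<mu>(1,2)] \<mu>' by simp
    next
      case False
      then have "inner g h = 0" using eig_orthogonal \<mu>(3) \<mu>'(3) by blast
      moreover from this have "g \<noteq> h" using \<mu>(4) by auto
      ultimately show ?thesis by simp
    qed
  qed
  have G4: "B g y = ev g * inner g y" if "g \<in> G" "y \<in> D" for g y
    using GE[OF that(1)] that(2) by (auto simp: eig_def)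
  have none: False if e: "e \<in> D" "norm e = 1" "\<And>g. g \<in> G \<Longrightarrow> inner e g = 0" and \<nu>: "\<nu> < lp"
    and eq: "\<And>y. y \<in> D \<Longrightarrow> B e y = \<nu> * inner e y" for e \<nu>
  proof -
    have ee: "e \<in> eig \<nu>" using e(1) eq by (simp add: eig_def)
    have "\<not> (AE x in lebesgue. rep e x = 0)"
    proof
      assume "AE x in lebesgue. rep e x = 0"
      then have "AE x in lebesgue. (rep e x)\<^sup>2 = 0" by eventually_elim simp
      then have "(\<integral>x. (rep e x)\<^sup>2 \<partial>lebesgue) = 0" by (rule integral_eq_zero_AE)
      then show False using norm_rep[of e] e(2) by simp
    qed
    then have "is_eigenvalue \<Omega> K \<nu>" using rep_in_eigenspace[OF ee] by (auto simp: is_eigenvalue_def)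
    then have "\<nu> \<in> M" using below \<nu> by blast
    then have "e = 0" using Gf4[of \<nu> e] ee e(3) by (auto simp: G_def)
    then show False using e(2) by simp
  qed
  have "spectral_gap D B G ev lm lp"
  proof unfold_locales
    show "ev g \<le> lm" if "g \<in> G" for g using GE[OF that] M(2) by blast
    show "lp * (norm z)\<^sup>2 \<le> B z z" if "z \<in> D" "\<And>g. g \<in> G \<Longrightarrow> inner z g = 0" for z
      by (rule gap_from_eigenvectors[OF G1 G2 G4 G3 none that])
  qed (use G1 G2 G3 G4 less in auto)
  then show ?thesis by blast
qed

end

section \<open>Nonresonance\<close>

lemma eigenvalue_sequence_facts:
  assumes "eigenvalue_sequence \<Omega> K lam"
  shows "is_eigenvalue \<Omega> K \<mu> \<Longrightarrow> \<exists>j\<ge>1. \<mu> = lam j"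
    and "is_eigenvalue \<Omega> K \<mu> \<Longrightarrow> \<exists>m. has_dim_ae (eigenspace \<Omega> K \<mu>) m"
    and "1 \<le> i \<Longrightarrow> i \<le> j \<Longrightarrow> lam i \<le> lam j"
    and "1 \<le> j \<Longrightarrow> is_eigenvalue \<Omega> K (lam j)"
proof -
  have dim: "has_dim_ae (eigenspace \<Omega> K \<mu>) (card {j. j \<ge> 1 \<and> lam j = \<mu>})" if "is_eigenvalue \<Omega> K \<mu>" for \<mu>
    using assms that by (simp add: eigenvalue_sequence_def)
  show "\<exists>m. has_dim_ae (eigenspace \<Omega> K \<mu>) m" if "is_eigenvalue \<Omega> K \<mu>" using dim[OF that] by blast
  show "\<exists>j\<ge>1. \<mu> = lam j" if ev: "is_eigenvalue \<Omega> K \<mu>"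
  proof (rule ccontr)
    assume "\<not> ?thesis"
    then have empty: "{j. j \<ge> 1 \<and> lam j = \<mu>} = {}" by auto
    \<comment> \<open>An eigenvalue absent from the list would have multiplicity 0 although it has a
      nonzero eigenfunction.\<close>
    have "has_dim_ae (eigenspace \<Omega> K \<mu>) 0" using dim[OF ev] unfolding empty by simp
    then have "\<forall>u\<in>eigenspace \<Omega> K \<mu>. AE x in lebesgue. u x = 0" by (simp add: has_dim_ae_def)
    then show False using ev by (auto simp: is_eigenvalue_def)
  qed
  have step: "lam j \<le> lam (Suc j)" if "1 \<le> j" for j using assms that by (simp add: eigenvalue_sequence_def)
  show "lam i \<le> lam j" if "1 \<le> i" "i \<le> j"
    using that(2)
  proof (induction j rule: dec_induct)
    case (step n)
    then show ?case using \<open>lam i \<le> lam n\<close> that(1) \<open>\<And>j. 1 \<le> j \<Longrightarrow> lam j \<le> lam (Suc j)\<close>[of n] by linarith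
  qed simp
  show "is_eigenvalue \<Omega> K (lam j)" if "1 \<le> j" using assms that by (simp add: eigenvalue_sequence_def)
qed

text \<open>In absolute value the quotient is at most |a| / |t| + b, so its lower limit is at least
  -b.\<close>

lemma Liminf_quotient_growth:
  fixes \<phi> :: "real \<Rightarrow> real"
  assumes growth: "\<And>t. \<bar>\<phi> t\<bar> \<le> a + b * \<bar>t\<bar>" and l: "l < - b"
  shows "ereal l < Liminf at_infinity (\<lambda>t. ereal (\<phi> t / t))"
proof -
  \<comment> \<open>A number strictly between l and -b makes the final inequality strict; beyond the
    radius |a| / (-b - m) the term |a| / |t| is at most -b - m.\<close>
  define m where "m = (l - b) / 2"
  have m: "l < m" "m < - b" using l by (simp_all add: m_def)
  have "\<forall>\<^sub>F t in at_infinity. ereal m \<le> ereal (\<phi> t / t)"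
    unfolding eventually_at_infinity
  proof (intro exI[of _ "max 1 (\<bar>a\<bar> / (- b - m))"] allI impI)
    fix t :: real assume t: "max 1 (\<bar>a\<bar> / (- b - m)) \<le> norm t"
    then have t0: "\<bar>t\<bar> > 0" by (simp only: max.bounded_iff real_norm_def) linarith
    have "\<bar>a\<bar> \<le> (- b - m) * \<bar>t\<bar>" using t m by (simp add: pos_divide_le_eq mult.commute)
    then have "\<bar>\<phi> t\<bar> \<le> - m * \<bar>t\<bar>" using growth[of t] by (simp add: left_diff_distrib)
    then have "\<bar>\<phi> t / t\<bar> \<le> - m" using t0 by (simp add: abs_divide pos_divide_le_eq)
    then have "m \<le> \<phi> t / t" by linarith
    then show "ereal m \<le> ereal (\<phi> t / t)" by simp
  qed
  then have "ereal m \<le> Liminf at_infinity (\<lambda>t. ereal (\<phi> t / t))" by (rule Liminf_bounded)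
  moreover have "ereal l < ereal m" using m(1) by simp
  ultimately show ?thesis by (rule less_le_trans[rotated])
qed

theorem theorem1:
  fixes \<Omega> :: "(real^'n::finite) set"
    and K :: "real^'n \<Rightarrow> real"
    and f :: "real^'n \<Rightarrow> real \<Rightarrow> real"
    and a :: "real^'n \<Rightarrow> real"
    and b \<theta> s :: real
    and lam :: "nat \<Rightarrow> real"
  assumes "open \<Omega>" and "bounded \<Omega>" and "\<Omega> \<noteq> {}"
    and K_pos: "\<And>x. x \<noteq> 0 \<Longrightarrow> K x > 0"
    and K_meas: "K \<in> borel_measurable (lebesgue_on (- {0}))"
    and K_int: "integrable (lebesgue_on (- {0})) (\<lambda>x. min ((norm x)\<^sup>2) 1 * K x)"
    and "\<theta> > 0" and "0 < s" and "s < 1"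
    and K_lower: "\<And>x. x \<noteq> 0 \<Longrightarrow> K x \<ge> \<theta> * norm x powr (- (real CARD('n) + 2 * s))"
    and f_car: "caratheodory \<Omega> f"
    and a_meas: "a \<in> borel_measurable (lebesgue_on \<Omega>)"
    and a_L2: "integrable (lebesgue_on \<Omega>) (\<lambda>x. (a x)\<^sup>2)"
    and "b \<ge> 0"
    and f_growth: "AE x in lebesgue_on \<Omega>. \<forall>t. \<bar>f x t\<bar> \<le> a x + b * \<bar>t\<bar>"
    and eigenvalues: "eigenvalue_sequence \<Omega> K lam"
    and nonresonance:
      "(AE x in lebesgue_on \<Omega>. alpha_upper f x < ereal (lam 1)) \<or>
       (\<exists>k\<ge>1. AE x in lebesgue_on \<Omega>.
          ereal (lam k) < alpha_lower f x \<and> alpha_lower f x \<le> alpha_upper f x \<and>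
          alpha_upper f x < ereal (lam (k + 1)))"
  shows "\<exists>u\<in>space_Z \<Omega> K. \<forall>\<phi>\<in>space_Z \<Omega> K.
    (\<integral>(x, y). (u x - u y) * (\<phi> x - \<phi> y) * K (x - y) \<partial>lebesgue_on (Q \<Omega>)) =
    (\<integral>x. f x (u x) * \<phi> x \<partial>lebesgue_on \<Omega>)"
proof -
  interpret kernel \<Omega> K \<theta> s by unfold_locales fact+
  note seq = eigenvalue_sequence_facts[OF eigenvalues]
  have Om: "\<Omega> \<in> sets lebesgue" "\<Omega> \<inter> space lebesgue \<in> sets lebesgue" using Omega_lebesgue by auto
  have ae_Om: "(AE x in lebesgue_on \<Omega>. P x) \<longleftrightarrow> (AE x in lebesgue. x \<in> \<Omega> \<longrightarrow> P x)" for P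
    by (rule AE_restrict_space_iff[OF Om(2)])
  have "\<exists>lm lp M. finite M \<and> (\<forall>\<mu>\<in>M. \<mu> \<le> lm \<and> is_eigenvalue \<Omega> K \<mu>) \<and>
     (\<forall>\<mu>. is_eigenvalue \<Omega> K \<mu> \<longrightarrow> \<mu> < lp \<longrightarrow> \<mu> \<in> M) \<and> lm < lp \<and>
     (AE x in lebesgue_on \<Omega>. ereal lm < alpha_lower f x \<and> alpha_upper f x < ereal lp)"
    using nonresonance
  proof
    assume up: "AE x in lebesgue_on \<Omega>. alpha_upper f x < ereal (lam 1)"
    \<comment> \<open>Below -b for the growth bound to apply, and below \<open>lam 1\<close> to
      leave a gap. No eigenvalue lies below \<open>lam 1\<close>, so \<open>M\<close> is empty
      here.\<close>
    define lm where "lm = min (- b - 1) (lam 1 - 1)"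
    have "AE x in lebesgue_on \<Omega>. ereal lm < alpha_lower f x \<and> alpha_upper f x < ereal (lam 1)"
      using up f_growth
    proof eventually_elim
      case (elim x)
      have "ereal lm < alpha_lower f x"
        unfolding alpha_lower_def by (rule Liminf_quotient_growth[of "f x" "a x" b]) (use elim in \<open>auto simp: lm_def\<close>)
      then show ?case using elim by simp
    qed
    moreover have "\<not> \<mu> < lam 1" if "is_eigenvalue \<Omega> K \<mu>" for \<mu>
      using seq(1)[OF that] seq(3)[of 1] by force
    ultimately show ?thesis by (intro exI[of _ lm] exI[of _ "lam 1"] exI[of _ "{}"]) (auto simp: lm_def)
  next
    assume "\<exists>k\<ge>1. AE x in lebesgue_on \<Omega>. ereal (lam k) < alpha_lower f x \<and> alpha_lower f x \<le> alpha_upper f x \<and>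
      alpha_upper f x < ereal (lam (k + 1))"
    then obtain k where k: "k \<ge> 1" and ae: "AE x in lebesgue_on \<Omega>. ereal (lam k) < alpha_lower f x \<and>
      alpha_lower f x \<le> alpha_upper f x \<and> alpha_upper f x < ereal (lam (k + 1))" by blast
    \<comment> \<open>The list of eigenvalues is only known to be nondecreasing; the strict step
      from k to k + 1 is read off from the hypothesis at one point of \<Omega>.\<close>
    have "AE x in lborel. x \<in> \<Omega> \<longrightarrow> lam k < lam (k + 1)"
      using ae unfolding ae_Om AE_completion_iff
    proof eventually_elim
      case (elim x)
      show ?case
      proof
        assume "x \<in> \<Omega>"
        then have "ereal (lam k) < ereal (lam (k + 1))" using elim by (meson less_trans order.strict_trans1 order.strict_trans2)
        then show "lam k < lam (k + 1)" by simp
      qed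
    qed
    then have less: "lam k < lam (k + 1)" using AE_exists_Omega by blast
    \<comment> \<open>By monotonicity, an eigenvalue below \<open>lam (k + 1)\<close> can occur at
      indices up to k only.\<close>
    have below: "\<mu> \<in> lam ` {1..k}" if ev: "is_eigenvalue \<Omega> K \<mu>" and lt: "\<mu> < lam (k + 1)" for \<mu>
    proof -
      obtain j where j: "j \<ge> 1" "\<mu> = lam j" using seq(1)[OF ev] by blast
      have "\<not> k + 1 \<le> j" using seq(3)[of "k + 1" j] lt j(2) by auto
      then show ?thesis using j by auto
    qed
    have "\<forall>\<mu>\<in>lam ` {1..k}. \<mu> \<le> lam k \<and> is_eigenvalue \<Omega> K \<mu>" using seq(3,4) by auto
    moreover have "AE x in lebesgue_on \<Omega>. ereal (lam k) < alpha_lower f x \<and> alpha_upper f x < ereal (lam (k + 1))"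
      using ae by eventually_elim simp
    ultimately show ?thesis using less below
      by (intro exI[of _ "lam k"] exI[of _ "lam (k + 1)"] exI[of _ "lam ` {1..k}"]) simp
  qed
  then obtain lm lp M where M: "finite M" "\<And>\<mu>. \<mu> \<in> M \<Longrightarrow> \<mu> \<le> lm \<and> is_eigenvalue \<Omega> K \<mu>"
    "\<And>\<mu>. is_eigenvalue \<Omega> K \<mu> \<Longrightarrow> \<mu> < lp \<Longrightarrow> \<mu> \<in> M" and less: "lm < lp"
    and alpha: "AE x in lebesgue_on \<Omega>. ereal lm < alpha_lower f x \<and> alpha_upper f x < ereal lp" by blast
  obtain G ev where gap: "spectral_gap D B G ev lm lp"
    using spectral_gap_exists[OF M(1) _ _ M(3) less] M(2) seq(2) by blast
  have "AE x in lebesgue_on \<Omega>. continuous_on UNIV (f x) \<and> (\<forall>t. \<bar>f x t\<bar> \<le> a x + b * \<bar>t\<bar>)"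
    using f_car f_growth by (auto simp: caratheodory_def)
  then have good: "AE x in lebesgue. x \<in> \<Omega> \<longrightarrow> continuous_on UNIV (f x) \<and> (\<forall>t. \<bar>f x t\<bar> \<le> a x + b * \<bar>t\<bar>)"
    unfolding ae_Om .
  \<comment> \<open>The points where \<open>f\<close> is continuous in t and obeys the growth bound.
    Setting \<open>f\<close> to 0 elsewhere turns conditions almost everywhere on \<Omega> into
    conditions everywhere on the whole space.\<close>
  define \<Omega>' where "\<Omega>' = {x \<in> \<Omega>. continuous_on UNIV (f x) \<and> (\<forall>t. \<bar>f x t\<bar> \<le> a x + b * \<bar>t\<bar>)}"
  have ae': "AE x in lebesgue. x \<in> \<Omega> \<longrightarrow> x \<in> \<Omega>'" using good by eventually_elim (simp add: \<Omega>'_def)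
  define g where "g x t = (if x \<in> \<Omega>' then f x t else 0)" for x t
  \<comment> \<open>The absolute value keeps the bound nonnegative at the exceptional points of
    \<Omega>, where \<open>g\<close> is 0.\<close>
  define a' where "a' x = (if x \<in> \<Omega> then \<bar>a x\<bar> else 0)" for x
  have sup: "superposition g a' b"
  proof
    fix t
    have "(\<lambda>x. if x \<in> \<Omega> then f x t else 0) \<in> borel_measurable lebesgue"
      using f_car by (subst borel_measurable_if[OF Om(1)]) (simp add: caratheodory_def)
    moreover have "AE x in lebesgue. (if x \<in> \<Omega> then f x t else 0) = g x t"
      using ae' by eventually_elim (auto simp: g_def \<Omega>'_def)
    ultimately show "(\<lambda>x. g x t) \<in> borel_measurable lebesgue" by (rule borel_measurable_AE)
  next
    show "continuous_on UNIV (g x)" for x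
    proof (cases "x \<in> \<Omega>'")
      case True
      then have "continuous_on UNIV (f x)" by (simp add: \<Omega>'_def)
      then show ?thesis using True by (simp add: g_def[abs_def])
    qed (simp add: g_def[abs_def])
  next
    have m: "a' \<in> borel_measurable lebesgue"
      unfolding a'_def[abs_def] using a_meas by (subst borel_measurable_if[OF Om(1)]) measurable
    have "integrable lebesgue (\<lambda>x. indicator \<Omega> x *\<^sub>R (a x)\<^sup>2)"
      using a_L2 by (subst (asm) integrable_restrict_space[OF Om(2)])
    moreover have "(\<lambda>x. indicator \<Omega> x *\<^sub>R (a x)\<^sup>2) = (\<lambda>x. (a' x)\<^sup>2)" by (auto simp: a'_def indicator_def)
    ultimately show "a' \<in> sq_int" using m by (simp add: sq_int_def)
  next
    show "\<bar>g x t\<bar> \<le> a' x + b * \<bar>t\<bar>" for x t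
    proof (cases "x \<in> \<Omega>'")
      case True
      then have "\<bar>f x t\<bar> \<le> a x + b * \<bar>t\<bar>" "x \<in> \<Omega>" by (auto simp: \<Omega>'_def)
      then show ?thesis using True by (simp add: g_def a'_def)
    qed (use \<open>b \<ge> 0\<close> in \<open>simp add: g_def a'_def\<close>)
  qed fact
  have nonres: "nonresonance_axioms D lm lp g \<Omega>"
  proof
    show "AE x in lebesgue. x \<notin> \<Omega> \<longrightarrow> rep u x = 0" if "u \<in> D" for u by (rule D_vanish[OF that])
    show "AE x in lebesgue. x \<in> \<Omega> \<longrightarrow> ereal lm < Liminf at_infinity (\<lambda>t. ereal (g x t / t)) \<and>
       Limsup at_infinity (\<lambda>t. ereal (g x t / t)) < ereal lp"
      using alpha[unfolded ae_Om] ae'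
      by eventually_elim (auto simp: g_def alpha_lower_def alpha_upper_def)
  qed
  interpret S: nonresonance D B G ev lm lp g a' b \<Omega>
    by (rule nonresonance.intro[OF gap sup nonres])
  obtain U where U: "U \<in> D" "\<And>Y. Y \<in> D \<Longrightarrow> B U Y = inner (S.N U) Y"
    using S.nonresonant_solution by blast
  have UZ: "rep U \<in> space_Z \<Omega> K" by (rule D_rep_space_Z[OF U(1)])
  have "(\<integral>(x, y). (rep U x - rep U y) * (\<phi> x - \<phi> y) * K (x - y) \<partial>lebesgue_on (Q \<Omega>)) =
    (\<integral>x. f x (rep U x) * \<phi> x \<partial>lebesgue_on \<Omega>)" if \<phi>: "\<phi> \<in> space_Z \<Omega> K" for \<phi>
  proof -
    have "inner_Z \<Omega> K (rep U) \<phi> = inner (S.N U) (cls \<phi>)"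
      using U(2)[OF space_Z_cls(3)[OF \<phi>]] by (simp add: inner_Z_B[OF UZ \<phi>])
    also have "\<dots> = (\<integral>x. g x (rep U x) * \<phi> x \<partial>lebesgue)"
      unfolding S.N_def by (rule inner_cls[OF S.superposition_sq_int space_Z_cls(1)[OF \<phi>]])
    also have "\<dots> = (\<integral>x. indicator \<Omega> x *\<^sub>R (f x (rep U x) * \<phi> x) \<partial>lebesgue)"
    proof -
      have ae: "AE x in lebesgue. g x (rep U x) * \<phi> x = indicator \<Omega> x *\<^sub>R (f x (rep U x) * \<phi> x)"
        using ae' by eventually_elim (auto simp: g_def indicator_def \<Omega>'_def)
      have m: "(\<lambda>x. g x (rep U x) * \<phi> x) \<in> borel_measurable lebesgue"
        using sq_int_measurable[OF S.superposition_sq_int[of U]] sq_int_measurable[OF space_Z_cls(1)[OF \<phi>]]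
        by measurable
      show ?thesis by (rule integral_cong_AE[OF m borel_measurable_AE[OF m ae] ae])
    qed
    also have "\<dots> = (\<integral>x. f x (rep U x) * \<phi> x \<partial>lebesgue_on \<Omega>)"
      by (rule integral_restrict_space[OF Om(2), symmetric])
    finally show ?thesis by (simp add: inner_Z_def)
  qed
  then show ?thesis using UZ by blast
qed

end
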